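(* Let $(F_k,E_k,H_k,G_k)_{k\ge 0}$ be the doubling iterates defined in the context from $A,B,C,D,\alpha,\beta$. Let $U_0,V_0,W_0,Q_0,Y_0,Z_0,A_{\alpha,\beta},D_{\alpha,\beta}$ and $\gamma=\alpha+\beta$ be as in the context. For $j\ge 1$ set $U_j:=A_{\alpha,\beta}U_{j-1}$, $V_j:=A_{\alpha,\beta}^{\mathsf T}V_{j-1}$, $W_j:=D_{\alpha,\beta}W_{j-1}$, $Q_j:=D_{\alpha,\beta}^{\mathsf T}Q_{j-1}$. For $k\ge 0$ put $$\check U_k=[U_0,U_1,\dots,U_{2^k-1}],\quad \check V_k=[V_0,V_1,\dots,V_{2^k-1}],\quad \check W_k=[W_0,W_1,\dots,W_{2^k-1}],\quad \check Q_k=[Q_0,Q_1,\dots,Q_{2^k-1}],$$ and for $k\ge 1$ let $$Y_k=\begin{bmatrix}0&Y_{k-1}\\ Y_{k-1}&\gamma T_{k-1}\end{bmatrix},\qquad Z_k=\begin{bmatrix}0&Z_{k-1}\\ Z_{k-1}&\gamma S_{k-1}\end{bmatrix},\qquad T_{k-1}=\check Q_{k-1}^{\mathsf T}\check W_{k-1},\quad S_{k-1}=\check V_{k-1}^{\mathsf T}\check U_{k-1}.$$ Then for all $k\ge 1$, $$F_k=A_{\alpha,\beta}^{2^k}+\gamma\,\check U_k(I-Y_kZ_k)^{-1}Y_k\check V_k^{\mathsf T},\qquad E_k=D_{\alpha,\beta}^{2^k}+\gamma\,\check W_k(I-Z_kY_k)^{-1}Z_k\check Q_k^{\mathsf T},$$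 $$H_k=\gamma\,\check U_k(I-Y_kZ_k)^{-1}\check Q_k^{\mathsf T},\qquad G_k=\gamma\,\check W_k(I-Z_kY_k)^{-1}\check V_k^{\mathsf T}.$$
   Context: Inequalities between matrices are entrywise. An M-matrix is a real square matrix of the form $sI-N$ with $N\ge 0$ and $s\ge\rho(N)$ (spectral radius); it is nonsingular iff $s>\rho(N)$ for such a representation. Standing assumptions: $A\in\mathbb R^{m\times m}$, $D\in\mathbb R^{n\times n}$, $B\in\mathbb R^{m\times n}$, $C\in\mathbb R^{n\times m}$ are such that $W=\begin{bmatrix}D&-C\\-B&A\end{bmatrix}$ is a nonsingular M-matrix or an irreducible singular M-matrix. There are full rank factorizations $B=B_lB_r^{\mathsf T}$, $C=C_lC_r^{\mathsf T}$ with $0\le B_l\in\mathbb R^{m\times p}$, $0\le B_r\in\mathbb R^{n\times p}$, $0\le C_l\in\mathbb R^{n\times q}$, $0\le C_r\in\mathbb R^{m\times q}$ (all of full column rank). The parameters satisfy $0\le\alpha\le\min_i a_{ii}^{-1}$, $0\le\beta\le\min_j d_{jj}^{-1}$, $\max\{\alpha,\beta\}>0$, where $a_{ii},d_{jj}$ are the diagonal entries of $A$ and $D$. Put $\gamma=\alpha+\beta$. For a real number $t$ write $A_t:=tA+I_m$ and $D_t:=tD+I_n$ (so $A_{-\alpha}=I-\alpha A$, $D_{-\beta}=I-\beta D$). Define $$A_{\alpha,\beta}=A_\beta^{-1}A_{-\alpha},\quad D_{\alpha,\beta}=D_\alpha^{-1}D_{-\beta},$$ $$U_0=A_\beta^{-1}B_l,\quad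 V_0=A_\beta^{-\mathsf T}C_r,\quad W_0=D_\alpha^{-1}C_l,\quad Q_0=D_\alpha^{-\mathsf T}B_r,$$ $$Y_0=\alpha B_r^{\mathsf T}D_\alpha^{-1}C_l\in\mathbb R^{p\times q},\quad Z_0=\beta C_r^{\mathsf T}A_\beta^{-1}B_l\in\mathbb R^{q\times p}.$$ (The block columns $W_j$ are not to be confused with the matrix $W$.) Doubling iteration (ADDA): the initial iterates are given by $$\begin{bmatrix}E_0&G_0\\H_0&F_0\end{bmatrix}=\begin{bmatrix}D_\alpha&-\beta C\\-\alpha B&A_\beta\end{bmatrix}^{-1}\begin{bmatrix}D_{-\beta}&\alpha C\\ \beta B&A_{-\alpha}\end{bmatrix},$$ and for $k\ge 0$ $$F_{k+1}=F_k(I_m-H_kG_k)^{-1}F_k,\qquad E_{k+1}=E_k(I_n-G_kH_k)^{-1}E_k,$$ $$H_{k+1}=H_k+F_k(I_m-H_kG_k)^{-1}H_kE_k,\qquad G_{k+1}=G_k+E_k(I_n-G_kH_k)^{-1}G_kF_k.$$ Under the standing assumptions it is known that this iteration is well defined: the matrix inverted in the initial step, and all $I-H_kG_k$ and $I-G_kH_k$, are nonsingular M-matrices. *)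

theory Defs
  imports
    "Jordan_Normal_Form.Spectral_Radius"
    "Jordan_Normal_Form.DL_Rank"
    "HOL-Combinatorics.Permutations"
begin

(* Meaningful only for invertible M; mat_inverse returns None on all other matrices. *)
definition minv :: "real mat \<Rightarrow> real mat" where
  "minv M = the (mat_inverse M)"

definition M_matrix :: "real mat \<Rightarrow> bool" where
  "M_matrix M \<longleftrightarrow>
     (\<exists>k s N. N \<in> carrier_mat k k \<and> 0\<^sub>m k k \<le> N \<and>
        spectral_radius (map_mat complex_of_real N) \<le> s \<and>
        M = s \<cdot>\<^sub>m 1\<^sub>m k - N)"

(* Some simultaneous permutation of rows and columns gives a block upper triangular matrix
   with two nonempty square diagonal blocks, the first of size r. *)
definition reducible_mat :: "real mat \<Rightarrow> bool" where
  "reducible_mat M \<longleftrightarrow>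
     (\<exists>\<pi> r. \<pi> permutes {..<dim_row M} \<and> 0 < r \<and> r < dim_row M \<and>
        (\<forall>i\<in>{r..<dim_row M}. \<forall>j<r. M $$ (\<pi> i, \<pi> j) = 0))"

definition irreducible_mat :: "real mat \<Rightarrow> bool" where
  "irreducible_mat M \<longleftrightarrow> square_mat M \<and> \<not> reducible_mat M"

(* For square M this is M_t = t M + I. *)
definition shift_mat :: "real \<Rightarrow> real mat \<Rightarrow> real mat" where
  "shift_mat t M = t \<cdot>\<^sub>m M + 1\<^sub>m (dim_row M)"

(* The matrix [X 0, X 1, ..., X (K - 1)], where every X j is an r x c matrix. *)
definition block_row :: "nat \<Rightarrow> nat \<Rightarrow> nat \<Rightarrow> (nat \<Rightarrow> real mat) \<Rightarrow> real mat" where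
  "block_row r c K X = mat r (K * c) (\<lambda>(i, j). X (j div c) $$ (i, j mod c))"

end

theory Submission
  imports Defs
begin

text \<open>The proof has two parts: an identity, obtained from a feedback picture, and the
invertibility of all the matrices that the iteration inverts, obtained from one positive vector.

The identity. Read the quadruple \<open>E, G, H, F\<close> as a two-port with inputs \<open>x, y\<close> and outputs
\<open>E x + G y\<close> and \<open>H x + F y\<close>, where \<open>x\<close> travels in one direction and \<open>y\<close> in the other. One doubling
step is the series connection of the two-port with itself: eliminating the signals at the common
junction produces exactly the recursion (\<open>doubling_composition\<close>). The claimed formulas
say that the same two-port is realized by an internal feedback loop
\<open>a = Z b + V\<^sup>T y\<close>, \<open>b = Y a + Q\<^sup>T x\<close> with outputs \<open>\<D> x + \<gamma> W a\<close> and \<open>\<A> y + \<gamma> U b\<close>; solving the loop gives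
the inverses of \<open>I - Z Y\<close> and \<open>I - Y Z\<close>. If two copies of the loop are connected in series and the
junction signals are substituted, the result is a loop of the same shape with the stacked internal
signals, and its coefficient matrices are precisely the next \<open>Y, Z\<close> and the block rows of twice the
length (\<open>realizes_doubling\<close>). So the formulas hold for all \<open>k\<close> once they hold for \<open>k = 0\<close>, and
there they follow from inserting the loop equations into the defining linear system
(\<open>realizes_initial\<close>). Invertibility of \<open>I - Y Z\<close> and \<open>I - Z Y\<close> says that the loop without input has only
the zero solution. This is carried through the induction too: zero input forces the junction
signals to vanish, because \<open>I - G H\<close> is invertible.

Invertibility. Write \<open>M\<close> for the big M-matrix, \<open>\<Delta> = diag(\<alpha> I, \<beta> I)\<close> and \<open>\<Delta>' = diag(\<beta> I, \<alpha> I)\<close>. The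
initial step is the Cayley-like transform \<open>(I + M \<Delta>)\<^sup>-\<^sup>1 (I - M \<Delta>') = I - \<gamma> (I + M \<Delta>)\<^sup>-\<^sup>1 M\<close>. There is a
positive vector \<open>v = (a, b)\<close> with \<open>M v \<ge> 0\<close>, and even \<open>M v > 0\<close> if \<open>M\<close> is nonsingular
(\<open>M_matrix_certificate\<close>). Hence the initial two-port is nonnegative and does not increase \<open>v\<close>. Moreover
\<open>G b \<le> \<theta> a\<close> for some \<open>\<theta> < 1\<close>: for nonsingular \<open>M\<close> the whole bound is strict, and for irreducible \<open>M\<close>
one has \<open>E a > 0\<close> (\<open>irreducible_cayley_transform_pos\<close>). These properties survive a doubling step
(\<open>dissipative_doubling\<close>), and they make \<open>I - G H\<close> a nonsingular M-matrix, since \<open>G H a \<le> G b < a\<close>.\<close>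

section \<open>Matrices acting on vectors\<close>

lemma le_vec_iff: "u \<le> v \<longleftrightarrow> dim_vec u = dim_vec v \<and> (\<forall>i<dim_vec v. u $ i \<le> (v $ i :: real))"
  by (rule less_eq_vec_def)

lemma nonneg_vec_iff: "0\<^sub>v k \<le> (v :: real vec) \<longleftrightarrow> dim_vec v = k \<and> (\<forall>i<k. 0 \<le> v $ i)"
  by (auto simp: less_eq_vec_def)

lemma le_vecD: "u \<le> v \<Longrightarrow> i < dim_vec v \<Longrightarrow> u $ i \<le> (v $ i :: real)"
  by (auto simp: less_eq_vec_def)

lemma nonneg_vecD: "0\<^sub>v k \<le> (v :: real vec) \<Longrightarrow> i < k \<Longrightarrow> 0 \<le> v $ i"
  by (auto simp: less_eq_vec_def)

lemma nonneg_vec_carrier: "0\<^sub>v k \<le> (v :: real vec) \<Longrightarrow> v \<in> carrier_vec k"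
  by (auto simp: less_eq_vec_def intro: carrier_vecI)

lemma nonneg_diff_iff: "u \<in> carrier_vec k \<Longrightarrow> v \<in> carrier_vec k \<Longrightarrow> 0\<^sub>v k \<le> v - u \<longleftrightarrow> u \<le> (v :: real vec)"
  by (auto simp: less_eq_vec_def)

definition pos_vec :: "real vec \<Rightarrow> bool" where
  "pos_vec v \<longleftrightarrow> (\<forall>i<dim_vec v. 0 < v $ i)"

lemma mat_vec_index:
  "i < dim_row M \<Longrightarrow> dim_vec x = dim_col M \<Longrightarrow> (M *\<^sub>v x) $ i = (\<Sum>j<dim_col M. M $$ (i, j) * x $ j)"
  by (simp add: scalar_prod_def atLeast0LessThan)

text \<open>With premises on dimensions instead of carrier sets, the simplifier has no intermediate dimension to guess.\<close>

lemma mat_vec_simps: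
  fixes M N :: "real mat" and x y :: "real vec"
  shows "dim_col M = dim_row N \<Longrightarrow> dim_col N = dim_vec x \<Longrightarrow> (M * N) *\<^sub>v x = M *\<^sub>v (N *\<^sub>v x)"
    and "dim_row N = dim_row M \<Longrightarrow> dim_col N = dim_col M \<Longrightarrow> dim_vec x = dim_col M \<Longrightarrow>
      (M + N) *\<^sub>v x = M *\<^sub>v x + N *\<^sub>v x"
    and "dim_row N = dim_row M \<Longrightarrow> dim_col N = dim_col M \<Longrightarrow> dim_vec x = dim_col M \<Longrightarrow>
      (M - N) *\<^sub>v x = M *\<^sub>v x - N *\<^sub>v x"
    and "dim_vec x = dim_col M \<Longrightarrow> (c \<cdot>\<^sub>m M) *\<^sub>v x = c \<cdot>\<^sub>v (M *\<^sub>v x)"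
    and "dim_vec x = dim_col M \<Longrightarrow> (- M) *\<^sub>v x = - (M *\<^sub>v x)"
    and "dim_vec x = dim_col M \<Longrightarrow> dim_vec y = dim_col M \<Longrightarrow> M *\<^sub>v (x + y) = M *\<^sub>v x + M *\<^sub>v y"
    and "dim_vec x = dim_col M \<Longrightarrow> dim_vec y = dim_col M \<Longrightarrow> M *\<^sub>v (x - y) = M *\<^sub>v x - M *\<^sub>v y"
    and "dim_vec x = dim_col M \<Longrightarrow> M *\<^sub>v (c \<cdot>\<^sub>v x) = c \<cdot>\<^sub>v (M *\<^sub>v x)"
    and "dim_vec x = k \<Longrightarrow> 1\<^sub>m k *\<^sub>v x = x"
    and "dim_col M = k \<Longrightarrow> dim_row M = l \<Longrightarrow> M *\<^sub>v 0\<^sub>v k = 0\<^sub>v l"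
    and "dim_vec x = c' \<Longrightarrow> 0\<^sub>m r c' *\<^sub>v x = 0\<^sub>v r"
          apply (metis assoc_mult_mat_vec carrier_matI carrier_vecI)
         apply (metis add_mult_distrib_mat_vec carrier_matI carrier_vecI)
        apply (metis minus_mult_distrib_mat_vec carrier_matI carrier_vecI)
       apply (intro eq_vecI; simp)
      apply simp
     apply (metis mult_add_distrib_mat_vec carrier_matI carrier_vecI)
    apply (metis mult_minus_distrib_mat_vec carrier_matI carrier_vecI)
   apply (intro eq_vecI; simp)
  apply (metis one_mult_mat_vec carrier_vecI)
  by (auto intro!: eq_vecI simp: scalar_prod_def)

lemma mat_vec_carrier [simp]: "M \<in> carrier_mat r k \<Longrightarrow> M *\<^sub>v v \<in> carrier_vec r"
  by (auto intro: carrier_vecI)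

lemma nonneg_mat_vec:
  assumes "0\<^sub>m r c \<le> M" "0\<^sub>v c \<le> x"
  shows "0\<^sub>v r \<le> M *\<^sub>v (x :: real vec)"
proof -
  have M: "dim_row M = r" "dim_col M = c" "\<And>i j. i < r \<Longrightarrow> j < c \<Longrightarrow> 0 \<le> M $$ (i, j)"
    using assms(1) by (auto simp: less_eq_mat_def)
  have x: "dim_vec x = c" "\<And>j. j < c \<Longrightarrow> 0 \<le> x $ j"
    using assms(2) by (auto simp: nonneg_vec_iff)
  show ?thesis unfolding nonneg_vec_iff
    using M x by (auto simp: mat_vec_index simp del: index_mult_mat_vec intro!: sum_nonneg)
qed

lemma nonneg_mat_vec_mono:
  fixes M :: "real mat"
  assumes M: "M \<in> carrier_mat r k" and nn: "\<And>x. 0\<^sub>v k \<le> x \<Longrightarrow> 0\<^sub>v r \<le> M *\<^sub>v x"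
    and uv: "u \<le> v" "v \<in> carrier_vec k"
  shows "M *\<^sub>v u \<le> M *\<^sub>v v"
proof -
  have u: "u \<in> carrier_vec k" using uv by (auto simp: less_eq_vec_def intro: carrier_vecI)
  have "0\<^sub>v r \<le> M *\<^sub>v (v - u)" using nn nonneg_diff_iff[OF u uv(2)] uv by simp
  also have "M *\<^sub>v (v - u) = M *\<^sub>v v - M *\<^sub>v u" using M u uv by (simp add: mat_vec_simps)
  finally show ?thesis using M u uv by (subst nonneg_diff_iff[symmetric, of _ r]) auto
qed

lemma mat_unit_vec_index:
  "i < dim_row M \<Longrightarrow> j < dim_col M \<Longrightarrow> dim_col M = k \<Longrightarrow> (M *\<^sub>v unit_vec k j) $ i = (M $$ (i, j) :: real)"
  by (simp add: scalar_prod_right_unit)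

lemma eq_mat_by_action:
  fixes M N :: "real mat"
  assumes "M \<in> carrier_mat r c" "N \<in> carrier_mat r c"
    and "\<And>x. x \<in> carrier_vec c \<Longrightarrow> M *\<^sub>v x = N *\<^sub>v x"
  shows "M = N"
proof (rule eq_matI)
  fix i j assume "i < dim_row N" "j < dim_col N"
  then show "M $$ (i, j) = N $$ (i, j)"
    using arg_cong[OF assms(3)[of "unit_vec c j"], of "\<lambda>v. v $ i"] assms(1,2)
    by (simp add: mat_unit_vec_index del: index_mult_mat_vec)
qed (use assms in auto)

lemma vec_shift:
  fixes x :: "real vec"
  assumes "x = a + (b + c)" "a \<in> carrier_vec k" "b \<in> carrier_vec k" "c \<in> carrier_vec k"
  shows "x - b = a + c"
  using assms by (auto intro!: eq_vecI)

lemma smult_vec_cancel: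
  fixes a :: "real vec"
  assumes "c \<noteq> 0" "a \<in> carrier_vec k" "c \<cdot>\<^sub>v a = 0\<^sub>v k"
  shows "a = 0\<^sub>v k"
proof (rule eq_vecI)
  fix i assume "i < dim_vec (0\<^sub>v k :: real vec)"
  then show "a $ i = 0\<^sub>v k $ i"
    using arg_cong[OF assms(3), of "\<lambda>u. u $ i"] assms(1,2) by simp
qed (use assms in auto)

lemma split_vec:
  assumes "x \<in> carrier_vec (r + s)"
  obtains u w where "u \<in> carrier_vec r" "w \<in> carrier_vec s" "x = u @\<^sub>v w"
  using vec_first_last_append[OF assms] that vec_first_carrier vec_last_carrier by metis

lemma nonneg_append_iff:
  assumes "u \<in> carrier_vec n" "w \<in> carrier_vec m"
  shows "0\<^sub>v (n + m) \<le> u @\<^sub>v w \<longleftrightarrow> 0\<^sub>v n \<le> u \<and> 0\<^sub>v m \<le> (w :: real vec)"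
proof
  assume L: "0\<^sub>v (n + m) \<le> u @\<^sub>v w"
  have "0 \<le> u $ i" if "i < n" for i
    using nonneg_vecD[OF L, of i] that assms by simp
  moreover have "0 \<le> w $ i" if "i < m" for i
    using nonneg_vecD[OF L, of "n + i"] that assms by simp
  ultimately show "0\<^sub>v n \<le> u \<and> 0\<^sub>v m \<le> w" using assms by (simp add: nonneg_vec_iff)
next
  assume "0\<^sub>v n \<le> u \<and> 0\<^sub>v m \<le> w"
  then show "0\<^sub>v (n + m) \<le> u @\<^sub>v w" using assms by (auto simp: nonneg_vec_iff)
qed

text \<open>Strict inequality in finitely many components leaves a uniform factor. The invariant of the doubling
iteration is stated with such a factor, because it then reduces to scalar arithmetic.\<close>

lemma uniform_strict_bound:
  fixes a u :: "real vec"
  assumes a: "a \<in> carrier_vec n" "pos_vec a" and u: "u \<in> carrier_vec n" and lt: "\<And>i. i < n \<Longrightarrow> u $ i < a $ i"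
  shows "\<exists>\<theta>. 0 \<le> \<theta> \<and> \<theta> < 1 \<and> u \<le> \<theta> \<cdot>\<^sub>v a"
proof -
  define \<theta> where "\<theta> = Max (insert 0 ((\<lambda>i. u $ i / a $ i) ` {..<n}))"
  have ap: "0 < a $ i" if "i < n" for i using a that by (auto simp: pos_vec_def)
  have "0 \<le> \<theta>" unfolding \<theta>_def by (intro Max_ge) auto
  moreover have "\<theta> < 1" unfolding \<theta>_def using ap lt by (subst Max_less_iff) auto
  moreover have "u $ i \<le> \<theta> * a $ i" if "i < n" for i
  proof -
    have "u $ i / a $ i \<le> \<theta>" unfolding \<theta>_def using that by (intro Max_ge) auto
    then show ?thesis using ap[OF that] by (simp add: pos_divide_le_eq)
  qed
  ultimately show ?thesis using a u by (intro exI[of _ \<theta>]) (auto simp: le_vec_iff)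
qed

section \<open>Inverses\<close>

lemma invertible_matI_kernel:
  fixes M :: "real mat"
  assumes M: "M \<in> carrier_mat k k" and ker: "\<And>x. x \<in> carrier_vec k \<Longrightarrow> M *\<^sub>v x = 0\<^sub>v k \<Longrightarrow> x = 0\<^sub>v k"
  shows "invertible_mat M"
proof -
  have "det M \<noteq> 0" using det_0_iff_vec_prod_zero_field[OF M] ker by blast
  then have "M \<in> Units (ring_mat TYPE(real) k ())" by (rule det_non_zero_imp_unit[OF M])
  then obtain B where "B * M = 1\<^sub>m k" "M * B = 1\<^sub>m k" "B \<in> carrier_mat k k"
    unfolding Units_def ring_mat_def by auto
  with M show ?thesis unfolding invertible_mat_def inverts_mat_def by (auto intro!: exI[of _ B])
qed

lemma minv_inverse:
  assumes M: "M \<in> carrier_mat k k" and inv: "invertible_mat M"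
  shows "minv M \<in> carrier_mat k k" "M * minv M = 1\<^sub>m k" "minv M * M = 1\<^sub>m k"
proof -
  obtain B where B: "M * B = 1\<^sub>m k" "B * M = 1\<^sub>m (dim_row B)"
    using inv M unfolding invertible_mat_def inverts_mat_def by auto
  have Bc: "B \<in> carrier_mat k k"
    using B M by (metis carrier_matD(2) carrier_matI index_mult_mat(3) index_one_mat(3))
  have "M \<in> Units (ring_mat TYPE(real) k ())"
    unfolding Units_def ring_mat_def using B Bc M by auto
  then obtain B' where "mat_inverse M = Some B'"
    using mat_inverse(1)[OF M, of "()"] by fastforce
  then show "minv M \<in> carrier_mat k k" "M * minv M = 1\<^sub>m k" "minv M * M = 1\<^sub>m k"
    using mat_inverse(2)[OF M] by (auto simp: minv_def)
qed

lemma minv_cancel: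
  assumes M: "M \<in> carrier_mat k k" and inv: "invertible_mat M" and x: "x \<in> carrier_vec k"
  shows "minv M *\<^sub>v (M *\<^sub>v x) = x" "M *\<^sub>v (minv M *\<^sub>v x) = x" "minv M *\<^sub>v x \<in> carrier_vec k"
proof -
  note i = minv_inverse[OF M inv]
  show "minv M *\<^sub>v (M *\<^sub>v x) = x"
    using i M x by (metis assoc_mult_mat_vec one_mult_mat_vec)
  show "M *\<^sub>v (minv M *\<^sub>v x) = x"
    using i M x by (metis assoc_mult_mat_vec one_mult_mat_vec)
  show "minv M *\<^sub>v x \<in> carrier_vec k" using i x by auto
qed

lemma one_minus_prod_action:
  assumes "X \<in> carrier_mat r c" "Y \<in> carrier_mat c r" "x \<in> carrier_vec r"
  shows "(1\<^sub>m r - X * Y) *\<^sub>v x = x - X *\<^sub>v (Y *\<^sub>v (x :: real vec))"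
  using assms by (simp add: mat_vec_simps)

lemma one_minus_prod_carrier:
  assumes "X \<in> carrier_mat r c" "Y \<in> carrier_mat c r"
  shows "(1\<^sub>m r - X * Y :: real mat) \<in> carrier_mat r r"
  using assms by auto

text \<open>If \<open>Y X y = y\<close>, then \<open>X y\<close> is fixed by \<open>X Y\<close>, so \<open>X y = 0\<close> and \<open>y = Y (X y) = 0\<close>.\<close>

lemma invertible_one_minus_prod_swap:
  assumes X: "X \<in> carrier_mat r c" and Y: "Y \<in> carrier_mat c r"
    and inv: "invertible_mat (1\<^sub>m r - X * Y :: real mat)"
  shows "invertible_mat (1\<^sub>m c - Y * X)"
proof (rule invertible_matI_kernel)
  show "1\<^sub>m c - Y * X \<in> carrier_mat c c" using X Y by auto
  fix y :: "real vec" assume y: "y \<in> carrier_vec c" "(1\<^sub>m c - Y * X) *\<^sub>v y = 0\<^sub>v c"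
  have d: "y - Y *\<^sub>v (X *\<^sub>v y) = 0\<^sub>v c" using y one_minus_prod_action[OF Y X y(1)] by simp
  have eq: "Y *\<^sub>v (X *\<^sub>v y) = y"
  proof (rule eq_vecI)
    fix i assume "i < dim_vec y"
    then show "(Y *\<^sub>v (X *\<^sub>v y)) $ i = y $ i"
      using arg_cong[OF d, of "\<lambda>u. u $ i"] y Y by (simp del: index_mult_mat_vec)
  qed (use y Y in auto)
  have Xy: "X *\<^sub>v y \<in> carrier_vec r" using X y by auto
  have "(1\<^sub>m r - X * Y) *\<^sub>v (X *\<^sub>v y) = 0\<^sub>v r"
    using one_minus_prod_action[OF X Y Xy] eq Xy by (simp add: carrier_vecD)
  then have "X *\<^sub>v y = 0\<^sub>v r"
    using minv_cancel(1)[OF one_minus_prod_carrier[OF X Y] inv Xy] minv_inverse[OF one_minus_prod_carrier[OF X Y] inv]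
    by (simp add: mat_vec_simps)
  then show "y = 0\<^sub>v c" using eq Y by (simp add: mat_vec_simps)
qed

section \<open>Z-matrices and inverse positivity\<close>

text \<open>For a square matrix this says that the off-diagonal entries are nonpositive. The formulation by
action on vectors applies without computing entries to \<open>s I - N\<close>, to \<open>I - G H\<close> and to matrices of the form
\<open>I + \<Delta> W\<close>.\<close>

definition Z_matrix :: "nat \<Rightarrow> real mat \<Rightarrow> bool" where
  "Z_matrix k X \<longleftrightarrow> X \<in> carrier_mat k k \<and>
     (\<forall>y i. 0\<^sub>v k \<le> y \<longrightarrow> i < k \<longrightarrow> y $ i = 0 \<longrightarrow> (X *\<^sub>v y) $ i \<le> 0)"

text \<open>For square matrices this is invertibility with an entrywise nonnegative inverse.\<close>

definition monotone_mat :: "nat \<Rightarrow> real mat \<Rightarrow> bool" where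
  "monotone_mat k X \<longleftrightarrow> (\<forall>x\<in>carrier_vec k. 0\<^sub>v k \<le> X *\<^sub>v x \<longrightarrow> 0\<^sub>v k \<le> x)"

lemma Z_matrixD:
  "Z_matrix k X \<Longrightarrow> 0\<^sub>v k \<le> y \<Longrightarrow> i < k \<Longrightarrow> y $ i = 0 \<Longrightarrow> (X *\<^sub>v y) $ i \<le> 0"
  "Z_matrix k X \<Longrightarrow> X \<in> carrier_mat k k"
  by (auto simp: Z_matrix_def)

lemma monotone_matD:
  "monotone_mat k X \<Longrightarrow> x \<in> carrier_vec k \<Longrightarrow> 0\<^sub>v k \<le> X *\<^sub>v x \<Longrightarrow> 0\<^sub>v k \<le> x"
  by (auto simp: monotone_mat_def)

lemma Z_matrix_offdiag:
  assumes "Z_matrix k X" "i < k" "j < k" "i \<noteq> j"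
  shows "X $$ (i, j) \<le> 0"
proof -
  have "(X *\<^sub>v unit_vec k j) $ i \<le> 0"
    by (rule Z_matrixD(1)[OF assms(1)]) (use assms in \<open>auto simp: nonneg_vec_iff unit_vec_def\<close>)
  then show ?thesis using assms Z_matrixD(2)[OF assms(1)]
    by (simp add: mat_unit_vec_index del: index_mult_mat_vec)
qed

text \<open>If \<open>X x \<ge> 0\<close> but \<open>x\<close> has a negative component, add the smallest multiple \<open>t v\<close> that makes \<open>x + t v\<close>
nonnegative. Some component \<open>i\<close> of the sum vanishes, so the Z-property bounds component \<open>i\<close> of
\<open>X (x + t v)\<close> by \<open>0\<close>. But that component is positive, as \<open>X x \<ge> 0\<close> and \<open>t X v > 0\<close>.\<close>

lemma Z_matrix_monotone:
  assumes Z: "Z_matrix k X" and v: "v \<in> carrier_vec k" "pos_vec v" and Xv: "pos_vec (X *\<^sub>v v)"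
  shows "monotone_mat k X"
  unfolding monotone_mat_def
proof (intro ballI impI)
  fix x :: "real vec" assume x: "x \<in> carrier_vec k" and Xx: "0\<^sub>v k \<le> X *\<^sub>v x"
  note X = Z_matrixD(2)[OF Z]
  show "0\<^sub>v k \<le> x"
  proof (rule ccontr)
    assume "\<not> 0\<^sub>v k \<le> x"
    then obtain l where l: "l < k" "x $ l < 0" using x by (auto simp: nonneg_vec_iff not_le)
    \<comment> \<open>the least \<open>t\<close> for which \<open>x + t v\<close> is nonnegative\<close>
    define t where "t = Max ((\<lambda>i. - x $ i / v $ i) ` {..<k})"
    have vp: "\<And>i. i < k \<Longrightarrow> 0 < v $ i" using v by (auto simp: pos_vec_def)
    have ge: "- x $ i / v $ i \<le> t" if "i < k" for i
      unfolding t_def using that by (auto intro: Max_ge)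
    have "t \<in> (\<lambda>i. - x $ i / v $ i) ` {..<k}"
      unfolding t_def using l by (intro Max_in) auto
    then obtain i where i: "i < k" "t = - x $ i / v $ i" by auto
    have t: "0 < t" using ge[OF l(1)] l vp[of l] by (smt (verit) divide_pos_pos)
    let ?y = "x + t \<cdot>\<^sub>v v"
    have "(X *\<^sub>v ?y) $ i \<le> 0"
    proof (rule Z_matrixD(1)[OF Z _ i(1)])
      show "0\<^sub>v k \<le> ?y" unfolding nonneg_vec_iff
        using ge vp v x by (auto simp: field_simps) (metis add.commute diff_ge_0_iff_ge diff_minus_eq_add mult.commute)
      show "?y $ i = 0" using i vp[of i] v x by (simp add: field_simps)
    qed
    moreover have "X *\<^sub>v ?y = X *\<^sub>v x + t \<cdot>\<^sub>v (X *\<^sub>v v)"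
      using X x v by (simp add: mat_vec_simps)
    moreover have "0 \<le> (X *\<^sub>v x) $ i" "0 < (X *\<^sub>v v) $ i"
      using Xx Xv X i(1) by (auto simp: nonneg_vec_iff pos_vec_def)
    moreover have "dim_vec (X *\<^sub>v v) = k" using X by simp
    ultimately have "(X *\<^sub>v x) $ i + t * (X *\<^sub>v v) $ i \<le> 0"
      using i(1) by (simp del: index_mult_mat_vec)
    moreover have "0 < t * (X *\<^sub>v v) $ i" by (rule mult_pos_pos[OF t]) fact
    ultimately show False using \<open>0 \<le> (X *\<^sub>v x) $ i\<close> by linarith
  qed
qed

lemma monotone_mat_invertible:
  assumes X: "X \<in> carrier_mat k k" and mono: "monotone_mat k X"
  shows "invertible_mat X"
proof (rule invertible_matI_kernel[OF X])
  fix x :: "real vec" assume x: "x \<in> carrier_vec k" "X *\<^sub>v x = 0\<^sub>v k"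
  have "X *\<^sub>v ((-1) \<cdot>\<^sub>v x) = 0\<^sub>v k" using X x by (simp add: mat_vec_simps) (auto intro: eq_vecI)
  then have "0\<^sub>v k \<le> (-1) \<cdot>\<^sub>v x" "0\<^sub>v k \<le> x"
    using monotone_matD[OF mono, of x] monotone_matD[OF mono, of "(-1) \<cdot>\<^sub>v x"] x by auto
  then show "x = 0\<^sub>v k" using x by (intro eq_vecI) (auto simp: nonneg_vec_iff intro: antisym)
qed

lemma monotone_mat_inverse_nonneg:
  assumes X: "X \<in> carrier_mat k k" and mono: "monotone_mat k X" and x: "0\<^sub>v k \<le> x"
  shows "0\<^sub>v k \<le> minv X *\<^sub>v x"
proof -
  have "x \<in> carrier_vec k" using x by (auto simp: nonneg_vec_iff intro: carrier_vecI)
  note c = minv_cancel[OF X monotone_mat_invertible[OF X mono] this]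
  show ?thesis by (rule monotone_matD[OF mono]) (use c x in simp_all)
qed

text \<open>At a zero \<open>l\<close> of \<open>y\<close> every term of \<open>(W y)\<^sub>l\<close> is nonpositive, so all of them vanish and
\<open>W\<close> has no entry from the zeros of \<open>y\<close> to its support. Listing the support first and the zeros last is
the permutation that would make \<open>W\<close> reducible. All uses of irreducibility go through this lemma; the
hypothesis concerns only the zeros of \<open>y\<close>, so that \<open>W y\<close> may have negative entries elsewhere.\<close>

lemma irreducible_Z_matrix_pos_vec:
  assumes irr: "irreducible_mat W" and Z: "Z_matrix k W"
    and y: "0\<^sub>v k \<le> y" "y \<noteq> 0\<^sub>v k"
    and Wy: "\<And>l. l < k \<Longrightarrow> y $ l = 0 \<Longrightarrow> 0 \<le> (W *\<^sub>v y) $ l"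
  shows "pos_vec y"
proof (rule ccontr)
  assume np: "\<not> pos_vec y"
  note W = Z_matrixD(2)[OF Z]
  have yd: "dim_vec y = k" "\<And>i. i < k \<Longrightarrow> 0 \<le> y $ i" using y by (auto simp: nonneg_vec_iff)
  define P where "P = {j. j < k \<and> y $ j \<noteq> 0}"
  define Z0 where "Z0 = {j. j < k \<and> y $ j = 0}"
  have zero: "W $$ (l, j) = 0" if l: "l \<in> Z0" and j: "j \<in> P" for l j
  proof -
    have l': "l < k" "y $ l = 0" using l by (auto simp: Z0_def)
    have nn: "0 \<le> - (W $$ (l, i) * y $ i)" if "i < k" for i
      using Z_matrix_offdiag[OF Z l'(1) that] l' yd(2)[OF that] by (cases "i = l") (auto simp: mult_nonpos_nonneg)
    have "0 \<le> (W *\<^sub>v y) $ l" by (rule Wy[OF l'])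
    also have "(W *\<^sub>v y) $ l = (\<Sum>i<k. W $$ (l, i) * y $ i)"
      using mat_vec_index[of l W y] W l' yd by simp
    finally have "(\<Sum>i<k. - (W $$ (l, i) * y $ i)) \<le> 0" by (simp add: sum_negf)
    moreover have "0 \<le> (\<Sum>i<k. - (W $$ (l, i) * y $ i))" using nn by (intro sum_nonneg) auto
    ultimately have "(\<Sum>i<k. - (W $$ (l, i) * y $ i)) = 0" by simp
    then have "\<forall>i\<in>{..<k}. - (W $$ (l, i) * y $ i) = 0"
      using nn by (subst (asm) sum_nonneg_eq_0_iff) auto
    then show ?thesis using j by (auto simp: P_def)
  qed
  have fin: "finite P" "finite Z0" and un: "P \<union> Z0 = {..<k}" "P \<inter> Z0 = {}"
    by (auto simp: P_def Z0_def)
  have ne: "P \<noteq> {}" "Z0 \<noteq> {}"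
    using y(2) yd np by (force simp: P_def pos_vec_def Z0_def intro!: eq_vecI)+
  define r where "r = card P"
  have cards: "card P + card Z0 = k" using card_Un_disjoint[OF fin un(2)] un(1) by simp
  have r: "0 < r" "r < k" using ne fin cards card_gt_0_iff[of P] card_gt_0_iff[of Z0] by (auto simp: r_def)
  obtain f where f: "bij_betw f {..<r} P"
    using finite_same_card_bij[of "{..<r}" P] fin by (auto simp: r_def)
  obtain g where g: "bij_betw g {r..<k} Z0"
    using finite_same_card_bij[of "{r..<k}" Z0] fin cards by (auto simp: r_def)
  \<comment> \<open>the support of \<open>y\<close> fills the first \<open>r\<close> positions, its zeros the remaining ones\<close>
  define \<pi> where "\<pi> i = (if i < r then f i else if i < k then g i else i)" for i
  have b1: "bij_betw \<pi> {..<r} P"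
    by (rule bij_betw_cong[THEN iffD1, OF _ f]) (auto simp: \<pi>_def)
  have b2: "bij_betw \<pi> {r..<k} Z0"
    by (rule bij_betw_cong[THEN iffD1, OF _ g]) (auto simp: \<pi>_def)
  have "{..<r} \<union> {r..<k} = {..<k}" using r by auto
  then have "bij_betw \<pi> {..<k} {..<k}"
    using bij_betw_combine[OF b1 b2 un(2)] un(1) by simp
  then have perm: "\<pi> permutes {..<k}"
    by (rule bij_imp_permutes) (use r in \<open>auto simp: \<pi>_def\<close>)
  have "reducible_mat W" unfolding reducible_mat_def
    by (rule exI[of _ \<pi>], rule exI[of _ r])
      (use perm r W zero bij_betwE[OF b1] bij_betwE[OF b2] in auto)
  then show False using irr by (simp add: irreducible_mat_def)
qed

text \<open>Both blocks inherit the Z-property by padding with zeros. Applied to the padded vector \<open>(0, b)\<close>, the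
Z-property also gives \<open>X1 b \<le> 0\<close>, so \<open>D a + X1 b \<ge> 0\<close> implies \<open>D a \<ge> 0\<close>; likewise for the other block.\<close>

lemma Z_matrix_principal_blocks:
  assumes Z: "Z_matrix (n + m) (four_block_mat D X1 X2 A)"
    and D: "D \<in> carrier_mat n n" and X1: "X1 \<in> carrier_mat n m" and X2: "X2 \<in> carrier_mat m n"
    and A: "A \<in> carrier_mat m m"
    and a: "a \<in> carrier_vec n" "0\<^sub>v n \<le> a" and b: "b \<in> carrier_vec m" "0\<^sub>v m \<le> b"
    and W: "0\<^sub>v (n + m) \<le> four_block_mat D X1 X2 A *\<^sub>v (a @\<^sub>v b)"
  shows "Z_matrix n D" "Z_matrix m A" "0\<^sub>v n \<le> D *\<^sub>v a" "0\<^sub>v m \<le> A *\<^sub>v b"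
proof -
  note act = four_block_mat_mult_vec[OF D X1 X2 A]
  have z: "0\<^sub>v n \<le> (0\<^sub>v n :: real vec)" "0\<^sub>v m \<le> (0\<^sub>v m :: real vec)" by auto
  have top: "(D *\<^sub>v x) $ i + (X1 *\<^sub>v y) $ i \<le> 0" if "0\<^sub>v n \<le> x" "0\<^sub>v m \<le> y" "i < n" "x $ i = 0" for x y i
  proof -
    note c = nonneg_vec_carrier[OF that(1)] nonneg_vec_carrier[OF that(2)]
    have "(four_block_mat D X1 X2 A *\<^sub>v (x @\<^sub>v y)) $ i \<le> 0"
      by (rule Z_matrixD(1)[OF Z]) (use that c nonneg_append_iff in auto)
    then show ?thesis unfolding act[OF c] using that D X1 X2 A by (simp del: index_mult_mat_vec)
  qed
  have bot: "(X2 *\<^sub>v x) $ i + (A *\<^sub>v y) $ i \<le> 0" if "0\<^sub>v n \<le> x" "0\<^sub>v m \<le> y" "i < m" "y $ i = 0" for x y i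
  proof -
    note c = nonneg_vec_carrier[OF that(1)] nonneg_vec_carrier[OF that(2)]
    have "(four_block_mat D X1 X2 A *\<^sub>v (x @\<^sub>v y)) $ (n + i) \<le> 0"
      by (rule Z_matrixD(1)[OF Z]) (use that c nonneg_append_iff in auto)
    then show ?thesis unfolding act[OF c] using that D X1 X2 A by (simp del: index_mult_mat_vec)
  qed
  have zz: "X1 *\<^sub>v 0\<^sub>v m = 0\<^sub>v n" "X2 *\<^sub>v 0\<^sub>v n = 0\<^sub>v m" "A *\<^sub>v 0\<^sub>v m = 0\<^sub>v m" "D *\<^sub>v 0\<^sub>v n = 0\<^sub>v n"
    using D X1 X2 A by (simp_all add: mat_vec_simps)
  show "Z_matrix n D" unfolding Z_matrix_def
    using D top[OF _ z(2)] zz by (simp del: index_mult_mat_vec)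
  show "Z_matrix m A" unfolding Z_matrix_def
    using A bot[OF z(1)] zz by (simp del: index_mult_mat_vec)
  have W': "0\<^sub>v n \<le> D *\<^sub>v a + X1 *\<^sub>v b" "0\<^sub>v m \<le> X2 *\<^sub>v a + A *\<^sub>v b"
    using W unfolding act[OF a(1) b(1)] using nonneg_append_iff[of _ n _ m] D A X1 X2 by auto
  have "0 \<le> (D *\<^sub>v a) $ i" if i: "i < n" for i
    using top[OF z(1) b(2) i] nonneg_vecD[OF W'(1) i] i zz D X1 by (simp del: index_mult_mat_vec)
  then show "0\<^sub>v n \<le> D *\<^sub>v a" using D by (simp add: nonneg_vec_iff del: index_mult_mat_vec)
  have "0 \<le> (A *\<^sub>v b) $ i" if i: "i < m" for i
    using bot[OF a(2) z(2) i] nonneg_vecD[OF W'(2) i] i zz A X2 by (simp del: index_mult_mat_vec)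
  then show "0\<^sub>v m \<le> A *\<^sub>v b" using A by (simp add: nonneg_vec_iff del: index_mult_mat_vec)
qed

section \<open>Positive vectors for M-matrices\<close>

lemma pow_mat_add:
  fixes P :: "real mat"
  assumes P: "P \<in> carrier_mat k k"
  shows "P ^\<^sub>m (i + j) = P ^\<^sub>m i * P ^\<^sub>m j"
proof (induction j)
  case (Suc j)
  then show ?case using P by (simp add: assoc_mult_mat[of _ k k _ k _ k])
qed (use P in simp)

text \<open>Dividing by \<open>r\<close> brings the spectral radius below \<open>1\<close>, where the Jordan form bounds all powers by a constant.\<close>

lemma real_mat_pow_bound:
  fixes N :: "real mat"
  assumes N: "N \<in> carrier_mat k k" and k: "0 < k"
    and rho: "spectral_radius (map_mat complex_of_real N) < r" and r: "0 < r"
  shows "\<exists>c. \<forall>j. \<forall>i<k. \<forall>l<k. \<bar>(N ^\<^sub>m j) $$ (i, l)\<bar> \<le> c * r ^ j"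
proof -
  let ?N = "map_mat complex_of_real N"
  let ?S = "map_mat complex_of_real ((1 / r) \<cdot>\<^sub>m N)"
  have Nc: "?N \<in> carrier_mat k k" and Sc: "?S \<in> carrier_mat k k" using N by auto
  have "spectral_radius ?S < 1"
  proof -
    from spectral_radius_mem_max(1)[OF Sc k] obtain z where z: "eigenvalue ?S z" "spectral_radius ?S = norm z"
      unfolding spectrum_def by auto
    then obtain x where x: "x \<in> carrier_vec k" "x \<noteq> 0\<^sub>v k" "?S *\<^sub>v x = z \<cdot>\<^sub>v x"
      unfolding eigenvalue_def eigenvector_def using Sc by auto
    have eq: "?N = complex_of_real r \<cdot>\<^sub>m ?S"
      using N r by (intro eq_matI) auto
    have "?N *\<^sub>v x = (of_real r * z) \<cdot>\<^sub>v x"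
      proof -
      have "?N *\<^sub>v x = complex_of_real r \<cdot>\<^sub>v (?S *\<^sub>v x)"
        unfolding eq using N x(1) by (intro eq_vecI) auto
      then show ?thesis by (simp only: x(3) smult_smult_assoc)
    qed
    then have "eigenvalue ?N (of_real r * z)"
      unfolding eigenvalue_def eigenvector_def using Nc x by (auto intro!: exI[of _ x])
    then have "norm (of_real r * z) \<le> spectral_radius ?N"
      by (intro spectral_radius_mem_max(2)[OF Nc k]) (auto simp: spectrum_def)
    also note rho
    finally have "norm z < 1" using r by (simp add: norm_mult)
    then show ?thesis using z by simp
  qed
  from spectral_radius_jnf_norm_bound_less_1_upper_triangular[OF Sc this]
  obtain c where c: "\<And>j. norm_bound (?S ^\<^sub>m j) c" by auto
  have "\<bar>(N ^\<^sub>m j) $$ (i, l)\<bar> \<le> c * r ^ j" if il: "i < k" "l < k" for i l j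
  proof -
    have S: "(1 / r) \<cdot>\<^sub>m N \<in> carrier_mat k k" using N by simp
    have pw: "((1 / r) \<cdot>\<^sub>m N) ^\<^sub>m j = (1 / r ^ j) \<cdot>\<^sub>m (N ^\<^sub>m j)" for j
    proof (induction j)
      case (Suc j)
      have "N ^\<^sub>m j \<in> carrier_mat k k" using N by simp
      then show ?case
        using Suc N by (simp add: mult_smult_distrib[of _ k k] mult_smult_assoc_mat[of _ k k])
          (auto intro!: eq_matI)
    qed (use N in \<open>auto intro!: eq_matI\<close>)
    have "?S ^\<^sub>m j = map_mat complex_of_real (((1 / r) \<cdot>\<^sub>m N) ^\<^sub>m j)"
      by (rule of_real_hom.mat_hom_pow[OF S, symmetric])
    then have "norm_bound (map_mat complex_of_real ((1 / r ^ j) \<cdot>\<^sub>m (N ^\<^sub>m j))) c"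
      using c[of j] pw by simp
    then have "norm (complex_of_real (1 / r ^ j * (N ^\<^sub>m j) $$ (i, l))) \<le> c"
      using il N unfolding norm_bound_def by auto
    then have "\<bar>1 / r ^ j * (N ^\<^sub>m j) $$ (i, l)\<bar> \<le> c" by (simp only: norm_of_real)
    then show ?thesis using r by (simp add: abs_mult field_simps)
  qed
  then show ?thesis by blast
qed

text \<open>The truncated Neumann series \<open>v = e + N e / t + \<dots> + N\<^sup>J\<^sup>-\<^sup>1 e / t\<^sup>J\<^sup>-\<^sup>1\<close> of the all-ones vector \<open>e\<close> satisfies
\<open>t v - N v = t (e - N\<^sup>J e / t\<^sup>J)\<close>. The remainder tends to \<open>0\<close> for \<open>t\<close> above the spectral radius, so
a sufficiently long partial sum suffices and no limit has to be taken.\<close>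

lemma supersolution_above_spectral_radius:
  fixes N :: "real mat"
  assumes N: "N \<in> carrier_mat k k" "0\<^sub>m k k \<le> N" and k: "0 < k"
    and rho: "spectral_radius (map_mat complex_of_real N) < t"
  shows "\<exists>v\<in>carrier_vec k. pos_vec v \<and> pos_vec (t \<cdot>\<^sub>v v - N *\<^sub>v v)"
proof -
  let ?\<rho> = "spectral_radius (map_mat complex_of_real N)"
  \<comment> \<open>strictly between the spectral radius and \<open>t\<close>, so that \<open>N\<^sup>j\<close> is of order \<open>r\<^sup>j\<close> and \<open>(r / t)\<^sup>j\<close> tends to \<open>0\<close>\<close>
  define r where "r = (?\<rho> + t) / 2"
  have "?\<rho> \<in> norm ` spectrum (map_mat complex_of_real N)"
    by (rule spectral_radius_mem_max(1)[OF _ k]) (use N in auto)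
  then have "0 \<le> ?\<rho>" by auto
  then have r: "0 < r" "?\<rho> < r" "r < t" and t: "0 < t" using rho by (auto simp: r_def)
  from real_mat_pow_bound[OF N(1) k r(2,1)] obtain c
    where c: "\<And>j i l. i < k \<Longrightarrow> l < k \<Longrightarrow> \<bar>(N ^\<^sub>m j) $$ (i, l)\<bar> \<le> c * r ^ j" by blast
  define e :: "real vec" where "e = vec k (\<lambda>_. 1)"
  have e: "e \<in> carrier_vec k" by (simp add: e_def)
  define f where "f j = (1 / t ^ j) \<cdot>\<^sub>v (N ^\<^sub>m j *\<^sub>v e)" for j
  have fc: "f j \<in> carrier_vec k" for j using mult_mat_vec_carrier[OF pow_carrier_mat[OF N(1)] e] by (simp add: f_def)
  have f0: "f 0 = e" using N e by (auto simp: f_def)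
  have Nf: "N *\<^sub>v f j = t \<cdot>\<^sub>v f (Suc j)" for j
  proof -
    have "N ^\<^sub>m Suc j = N * N ^\<^sub>m j" using pow_mat_add[OF N(1), of 1 j] N(1) by simp
    then have "N ^\<^sub>m Suc j *\<^sub>v e = N *\<^sub>v (N ^\<^sub>m j *\<^sub>v e)" using N e by (simp add: mat_vec_simps)
    then show ?thesis using N t e unfolding f_def
      by (simp add: mat_vec_simps smult_smult_assoc field_simps del: pow_mat.simps)
  qed
  have fn: "0\<^sub>v k \<le> f j" for j
  proof (induction j)
    case 0 show ?case unfolding f0 by (auto simp: e_def nonneg_vec_iff)
  next
    case (Suc j)
    have "0\<^sub>v k \<le> t \<cdot>\<^sub>v f (Suc j)" using nonneg_mat_vec[OF N(2) Suc] Nf by simp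
    then show ?case using t fc[of "Suc j"] by (auto simp: nonneg_vec_iff zero_le_mult_iff)
  qed
  have "\<exists>K. \<bar>c\<bar> * k * (r / t) ^ K < 1"
  proof -
    have "(\<lambda>K. \<bar>c\<bar> * k * (r / t) ^ K) \<longlonglongrightarrow> \<bar>c\<bar> * k * 0"
      by (intro tendsto_mult tendsto_const LIMSEQ_realpow_zero) (use r t in auto)
    then have "\<forall>\<^sub>F K in sequentially. \<bar>c\<bar> * k * (r / t) ^ K < 1"
      by (intro order_tendstoD(2)[where y = "\<bar>c\<bar> * k * 0"]) auto
    then show ?thesis using eventually_happens'[OF sequentially_bot] by blast
  qed
  then obtain K where K: "\<bar>c\<bar> * k * (r / t) ^ K < 1" by blast
  have fK: "f K $ i < 1" if i: "i < k" for i
  proof -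
    have "(N ^\<^sub>m K *\<^sub>v e) $ i = (\<Sum>l<k. (N ^\<^sub>m K) $$ (i, l))"
      using i N e by (simp add: mat_vec_index e_def del: index_mult_mat_vec)
    also have "\<dots> \<le> (\<Sum>l<k. \<bar>c\<bar> * r ^ K)"
    proof (rule sum_mono)
      fix l assume "l \<in> {..<k}"
      then have "(N ^\<^sub>m K) $$ (i, l) \<le> c * r ^ K" using c[OF i, of l K] by simp
      also have "\<dots> \<le> \<bar>c\<bar> * r ^ K" using r by (intro mult_right_mono) auto
      finally show "(N ^\<^sub>m K) $$ (i, l) \<le> \<bar>c\<bar> * r ^ K" .
    qed
    also have "\<dots> = \<bar>c\<bar> * k * r ^ K" by simp
    finally have "(1 / t ^ K) * (N ^\<^sub>m K *\<^sub>v e) $ i \<le> (1 / t ^ K) * (\<bar>c\<bar> * k * r ^ K)"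
      using t by (intro mult_left_mono) auto
    also have "\<dots> = \<bar>c\<bar> * k * (r / t) ^ K" by (simp add: power_divide)
    finally have "(1 / t ^ K) * (N ^\<^sub>m K *\<^sub>v e) $ i < 1" using K by simp
    then show ?thesis using i N e by (simp add: f_def del: index_mult_mat_vec)
  qed
  \<comment> \<open>the partial sum \<open>f 0 + \<dots> + f (J - 1)\<close>, which is positive unless it is empty\<close>
  have "\<exists>v\<in>carrier_vec k. (0 < J \<longrightarrow> e \<le> v) \<and> t \<cdot>\<^sub>v v - N *\<^sub>v v = t \<cdot>\<^sub>v (e - f J)" for J
  proof (induction J)
    case 0
    show ?case
      by (rule bexI[of _ "0\<^sub>v k"]) (use N f0 e in \<open>auto simp: mat_vec_simps intro!: eq_vecI\<close>)
  next
    case (Suc J)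
    then obtain v where v: "v \<in> carrier_vec k" "0 < J \<longrightarrow> e \<le> v"
      "t \<cdot>\<^sub>v v - N *\<^sub>v v = t \<cdot>\<^sub>v (e - f J)" by blast
    show ?case
    proof (cases "J = 0")
      case True
      then show ?thesis
        by (intro bexI[of _ e]) (use Nf[of 0] f0 e fc[of "Suc 0"] in \<open>auto intro!: eq_vecI simp: algebra_simps\<close>)
    next
      case False
      show ?thesis
      proof (intro bexI[of _ "v + f J"] conjI impI)
        show "v + f J \<in> carrier_vec k" using v fc by simp
        show "e \<le> v + f J" using v(1,2) False fn[of J] e
          by (auto simp: le_vec_iff nonneg_vec_iff intro: add_increasing2)
        have "t * v $ i - (N *\<^sub>v v) $ i = t * (e $ i - f J $ i)" if "i < k" for i
          using arg_cong[OF v(3), of "\<lambda>u. u $ i"] that v(1) e fc[of J] N by (simp del: index_mult_mat_vec)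
        then show "t \<cdot>\<^sub>v (v + f J) - N *\<^sub>v (v + f J) = t \<cdot>\<^sub>v (e - f (Suc J))"
          using v(1) fc[of J] fc[of "Suc J"] e N Nf[of J]
          by (intro eq_vecI) (auto simp: mat_vec_simps algebra_simps simp del: index_mult_mat_vec)
      qed
    qed
  qed
  from this[of "Suc K"] this[of K] obtain v where v: "v \<in> carrier_vec k" "0 < K \<longrightarrow> e \<le> v"
      "t \<cdot>\<^sub>v v - N *\<^sub>v v = t \<cdot>\<^sub>v (e - f K)" by blast
  have "K \<noteq> 0" using fK[of 0] k f0 by (cases K) (auto simp: e_def)
  then have "pos_vec v" using v(1,2) by (auto simp: le_vec_iff e_def pos_vec_def less_le_trans[OF zero_less_one])
  moreover have "pos_vec (t \<cdot>\<^sub>v v - N *\<^sub>v v)" unfolding v(3)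
    using fK t e fc[of K] by (auto simp: pos_vec_def e_def)
  ultimately show ?thesis using v(1) by blast
qed

lemma M_matrix_Z_matrix:
  assumes M: "M_matrix W" and W: "W \<in> carrier_mat k k"
  shows "Z_matrix k W"
proof -
  from M obtain l s N where N: "N \<in> carrier_mat l l" "0\<^sub>m l l \<le> N" and eq: "W = s \<cdot>\<^sub>m 1\<^sub>m l - N"
    unfolding M_matrix_def by blast
  have l: "l = k" using N(1) W eq by auto
  show ?thesis unfolding Z_matrix_def
  proof (intro conjI allI impI W)
    fix y :: "real vec" and i assume y: "0\<^sub>v k \<le> y" "i < k" "y $ i = 0"
    have dy: "dim_vec y = k" using y by (auto simp: nonneg_vec_iff)
    have "W *\<^sub>v y = s \<cdot>\<^sub>v y - N *\<^sub>v y" unfolding eq using N l dy by (simp add: mat_vec_simps)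
    moreover have "0 \<le> (N *\<^sub>v y) $ i" using nonneg_mat_vec[OF N(2), of y] y l
      by (simp add: nonneg_vec_iff del: index_mult_mat_vec)
    ultimately show "(W *\<^sub>v y) $ i \<le> 0" using y N l dy by (simp del: index_mult_mat_vec)
  qed
qed

lemma M_matrix_shift_monotone:
  assumes M: "M_matrix W" and W: "W \<in> carrier_mat k k" and k: "0 < k" and eps: "0 < \<epsilon>"
  shows "monotone_mat k (W + \<epsilon> \<cdot>\<^sub>m 1\<^sub>m k)"
proof -
  from M obtain l s N where N: "N \<in> carrier_mat l l" "0\<^sub>m l l \<le> N" and eq: "W = s \<cdot>\<^sub>m 1\<^sub>m l - N"
    and rho: "spectral_radius (map_mat complex_of_real N) \<le> s"
    unfolding M_matrix_def by blast
  have l: "l = k" using N(1) W eq by auto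
  have act: "(W + \<epsilon> \<cdot>\<^sub>m 1\<^sub>m k) *\<^sub>v y = W *\<^sub>v y + \<epsilon> \<cdot>\<^sub>v y" if "dim_vec y = k" for y
    using W that by (simp add: mat_vec_simps)
  have Z: "Z_matrix k (W + \<epsilon> \<cdot>\<^sub>m 1\<^sub>m k)"
    unfolding Z_matrix_def
  proof (intro conjI allI impI)
    fix y :: "real vec" and i assume y: "0\<^sub>v k \<le> y" "i < k" "y $ i = 0"
    then have dy: "dim_vec y = k" by (auto simp: nonneg_vec_iff)
    show "((W + \<epsilon> \<cdot>\<^sub>m 1\<^sub>m k) *\<^sub>v y) $ i \<le> 0"
      using Z_matrixD(1)[OF M_matrix_Z_matrix[OF M W] y] y W dy by (simp add: act del: index_mult_mat_vec)
  qed (use W in auto)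
  from supersolution_above_spectral_radius[OF N(1)[unfolded l] N(2)[unfolded l] k, of "s + \<epsilon>"] rho eps
  obtain v where v: "v \<in> carrier_vec k" "pos_vec v" "pos_vec ((s + \<epsilon>) \<cdot>\<^sub>v v - N *\<^sub>v v)" by auto
  have "(W + \<epsilon> \<cdot>\<^sub>m 1\<^sub>m k) *\<^sub>v v = (s + \<epsilon>) \<cdot>\<^sub>v v - N *\<^sub>v v"
    unfolding eq l using N l v(1)
    by (simp add: mat_vec_simps) (auto simp: algebra_simps intro!: eq_vecI)
  then show ?thesis using Z_matrix_monotone[OF Z v(1,2)] v(3) by simp
qed

text \<open>The candidate is \<open>x = W\<^sup>-\<^sup>1 e\<close> with \<open>e\<close> the all-ones vector. To see that \<open>x \<ge> 0\<close>, compare it with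
\<open>w = (W + \<epsilon> I)\<^sup>-\<^sup>1 e \<ge> 0\<close>: if every component of \<open>x\<close> is at most \<open>c\<close> in absolute value, then
\<open>(W + \<epsilon> I) (x - (1 - \<epsilon> c) w) = \<epsilon> (x + c e) \<ge> 0\<close>, so \<open>x \<ge> (1 - \<epsilon> c) w\<close>. A single \<open>\<epsilon>\<close> with \<open>\<epsilon> c < 1\<close>
is enough, which avoids letting \<open>\<epsilon>\<close> tend to \<open>0\<close>.\<close>

lemma invertible_M_matrix_certificate:
  assumes M: "M_matrix W" and W: "W \<in> carrier_mat k k" and k: "0 < k" and inv: "invertible_mat W"
  shows "\<exists>v\<in>carrier_vec k. pos_vec v \<and> pos_vec (W *\<^sub>v v)"
proof -
  define e :: "real vec" where "e = vec k (\<lambda>_. 1)"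
  have e: "e \<in> carrier_vec k" "0\<^sub>v k \<le> e" by (auto simp: e_def nonneg_vec_iff)
  define x where "x = minv W *\<^sub>v e"
  have x: "x \<in> carrier_vec k" "W *\<^sub>v x = e" using minv_cancel[OF W inv e(1)] by (auto simp: x_def)
  define c where "c = (\<Sum>i<k. \<bar>x $ i\<bar>)"
  have c: "\<bar>x $ i\<bar> \<le> c" if "i < k" for i unfolding c_def
    by (rule member_le_sum) (use that in auto)
  have c0: "0 \<le> c" unfolding c_def by (rule sum_nonneg) simp
  define \<epsilon> where "\<epsilon> = 1 / (c + 1)"
  have eps: "0 < \<epsilon>" "\<epsilon> * c < 1" using c0 by (auto simp: \<epsilon>_def)
  let ?W = "W + \<epsilon> \<cdot>\<^sub>m 1\<^sub>m k"
  have Wc: "?W \<in> carrier_mat k k" using W by auto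
  have mono: "monotone_mat k ?W" by (rule M_matrix_shift_monotone[OF M W k eps(1)])
  define w where "w = minv ?W *\<^sub>v e"
  have w: "w \<in> carrier_vec k" "?W *\<^sub>v w = e" "0\<^sub>v k \<le> w"
    using minv_cancel[OF Wc monotone_mat_invertible[OF Wc mono] e(1)]
      monotone_mat_inverse_nonneg[OF Wc mono e(2)] by (auto simp: w_def)
  have "?W *\<^sub>v (x - (1 - \<epsilon> * c) \<cdot>\<^sub>v w) = ?W *\<^sub>v x - (1 - \<epsilon> * c) \<cdot>\<^sub>v (?W *\<^sub>v w)"
    using Wc x w by (simp add: mat_vec_simps)
  also have "?W *\<^sub>v x = e + \<epsilon> \<cdot>\<^sub>v x" using W x by (simp add: mat_vec_simps)
  finally have "?W *\<^sub>v (x - (1 - \<epsilon> * c) \<cdot>\<^sub>v w) = (e + \<epsilon> \<cdot>\<^sub>v x) - (1 - \<epsilon> * c) \<cdot>\<^sub>v e"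
    using w by simp
  also have "\<dots> = \<epsilon> \<cdot>\<^sub>v (x + c \<cdot>\<^sub>v e)"
    using x e by (intro eq_vecI) (auto simp: algebra_simps)
  also have "0\<^sub>v k \<le> \<dots>"
  proof -
    have "0 \<le> x $ i + c" if "i < k" for i using c[OF that] by linarith
    then show ?thesis using x(1) eps(1) by (simp add: nonneg_vec_iff e_def)
  qed
  finally have image: "0\<^sub>v k \<le> ?W *\<^sub>v (x - (1 - \<epsilon> * c) \<cdot>\<^sub>v w)" .
  have "x - (1 - \<epsilon> * c) \<cdot>\<^sub>v w \<in> carrier_vec k" using x(1) w(1) by simp
  from monotone_matD[OF mono this image] have "0\<^sub>v k \<le> x - (1 - \<epsilon> * c) \<cdot>\<^sub>v w" .
  then have xn: "0 \<le> x $ i" if "i < k" for i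
    proof -
    have "0 \<le> w $ i" using w(3) that by (simp add: nonneg_vec_iff)
    then have "0 \<le> (1 - \<epsilon> * c) * w $ i" using eps by simp
    moreover have "(1 - \<epsilon> * c) * w $ i \<le> x $ i"
      using \<open>0\<^sub>v k \<le> x - _\<close> that w(1) by (simp add: nonneg_vec_iff)
    ultimately show ?thesis by linarith
  qed
  have "0 < x $ i" if i: "i < k" for i
  proof (rule ccontr)
    assume "\<not> 0 < x $ i"
    then have "x $ i = 0" using xn[OF i] by simp
    then have "(W *\<^sub>v x) $ i \<le> 0"
      by (intro Z_matrixD(1)[OF M_matrix_Z_matrix[OF M W]]) (use xn x i in \<open>auto simp: nonneg_vec_iff\<close>)
    then show False using i by (simp add: x e_def)
  qed
  then show ?thesis using x by (intro bexI[of _ x]) (auto simp: pos_vec_def e_def)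
qed

text \<open>This is the Perron vector. Let \<open>W x = 0\<close> with \<open>x \<noteq> 0\<close> and \<open>y = |x|\<close>; the signs of \<open>W\<close> give \<open>W y \<le> 0\<close>.
Suppose \<open>z = - W y\<close> is not zero. Then \<open>w = (W + I)\<^sup>-\<^sup>1 z\<close> is positive by irreducibility, and \<open>u = y + w\<close> satisfies
\<open>W u = - w < 0\<close>, hence \<open>(W + \<delta> I) u \<le> 0\<close> for a small \<open>\<delta> > 0\<close>. As \<open>W + \<delta> I\<close> is monotone, this forces
\<open>u \<le> 0\<close>, which is absurd. So \<open>W y = 0\<close>, and \<open>y > 0\<close> by irreducibility again.\<close>

lemma singular_irreducible_M_matrix_certificate:
  assumes M: "M_matrix W" and W: "W \<in> carrier_mat k k" and k: "0 < k"
    and sing: "\<not> invertible_mat W" and irr: "irreducible_mat W"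
  shows "\<exists>v\<in>carrier_vec k. pos_vec v \<and> W *\<^sub>v v = 0\<^sub>v k"
proof -
  note Z = M_matrix_Z_matrix[OF M W]
  obtain x where x: "x \<in> carrier_vec k" "x \<noteq> 0\<^sub>v k" "W *\<^sub>v x = 0\<^sub>v k"
    using sing invertible_matI_kernel[OF W] by blast
  define y where "y = vec k (\<lambda>i. \<bar>x $ i\<bar>)"
  have yc: "y \<in> carrier_vec k" "0\<^sub>v k \<le> y" by (auto simp: y_def nonneg_vec_iff)
  have "y \<noteq> 0\<^sub>v k"
  proof
    assume "y = 0\<^sub>v k"
    then have "x $ i = 0" if "i < k" for i using that by (metis abs_eq_0 index_vec index_zero_vec(1) y_def)
    then have "x = 0\<^sub>v k" using x(1) by (intro eq_vecI) auto
    then show False using x(2) by contradiction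
  qed
  have Wy: "(W *\<^sub>v y) $ i \<le> 0" if i: "i < k" for i
  proof -
    have "(W *\<^sub>v y) $ i = (\<Sum>j<k. W $$ (i, j) * \<bar>x $ j\<bar>)"
      using i W yc by (simp add: mat_vec_index y_def del: index_mult_mat_vec)
    \<comment> \<open>equality for \<open>j = i\<close>; for \<open>j \<noteq> i\<close> the nonpositive factor reverses \<open>sgn (x\<^sub>i) x\<^sub>j \<le> |x\<^sub>j|\<close>\<close>
    also have "\<dots> \<le> (\<Sum>j<k. W $$ (i, j) * (sgn (x $ i) * x $ j))"
    proof (rule sum_mono)
      fix j assume "j \<in> {..<k}"
      then have j: "j < k" by simp
      show "W $$ (i, j) * \<bar>x $ j\<bar> \<le> W $$ (i, j) * (sgn (x $ i) * x $ j)"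
      proof (cases "j = i")
        case True
        then show ?thesis by (simp add: sgn_if)
      next
        case False
        have "sgn (x $ i) * x $ j \<le> \<bar>x $ j\<bar>" by (auto simp: sgn_if)
        then show ?thesis using Z_matrix_offdiag[OF Z i j] False by (intro mult_left_mono_neg) auto
      qed
    qed
    also have "\<dots> = sgn (x $ i) * (\<Sum>j<k. W $$ (i, j) * x $ j)"
      by (simp add: sum_distrib_left mult_ac)
    also have "(\<Sum>j<k. W $$ (i, j) * x $ j) = (W *\<^sub>v x) $ i"
      using i W x(1) by (simp add: mat_vec_index del: index_mult_mat_vec)
    finally show ?thesis using x(3) i by simp
  qed
  have "W *\<^sub>v y = 0\<^sub>v k"
  proof (rule ccontr)
    assume nz: "W *\<^sub>v y \<noteq> 0\<^sub>v k"
    define z where "z = (-1) \<cdot>\<^sub>v (W *\<^sub>v y)"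
    have z: "z \<in> carrier_vec k" "0\<^sub>v k \<le> z" "z \<noteq> 0\<^sub>v k"
    proof -
      show "z \<in> carrier_vec k" using W by (auto simp: z_def intro: carrier_vecI)
      show "0\<^sub>v k \<le> z" using Wy W by (auto simp: z_def nonneg_vec_iff simp del: index_mult_mat_vec)
      show "z \<noteq> 0\<^sub>v k"
      proof
        assume z0: "z = 0\<^sub>v k"
        have "(W *\<^sub>v y) $ i = 0" if "i < k" for i
          using arg_cong[OF z0, of "\<lambda>u. u $ i"] that W by (simp add: z_def del: index_mult_mat_vec)
        then have "W *\<^sub>v y = 0\<^sub>v k" using W by (intro eq_vecI) (simp_all del: index_mult_mat_vec)
        then show False using nz by contradiction
      qed
    qed
    let ?W = "W + 1 \<cdot>\<^sub>m 1\<^sub>m k"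
    have Wc: "?W \<in> carrier_mat k k" using W by auto
    have act: "?W *\<^sub>v u = W *\<^sub>v u + u" if "u \<in> carrier_vec k" for u
      using W that by (simp add: mat_vec_simps)
    have mono: "monotone_mat k ?W" by (rule M_matrix_shift_monotone[OF M W k]) simp
    note inv = monotone_mat_invertible[OF Wc mono]
    define w where "w = minv ?W *\<^sub>v z"
    have w: "w \<in> carrier_vec k" "0\<^sub>v k \<le> w" and Ww: "W *\<^sub>v w + w = z"
      using minv_cancel[OF Wc inv z(1)] monotone_mat_inverse_nonneg[OF Wc mono z(2)] act
      by (auto simp: w_def)
    have "pos_vec w"
    proof (rule irreducible_Z_matrix_pos_vec[OF irr Z w(2)])
      show "w \<noteq> 0\<^sub>v k" using Ww z(3) W by (auto simp: mat_vec_simps)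
      fix l assume "l < k" "w $ l = 0"
      then show "0 \<le> (W *\<^sub>v w) $ l"
        using arg_cong[OF Ww, of "\<lambda>u. u $ l"] z(2) w W by (auto simp: nonneg_vec_iff simp del: index_mult_mat_vec)
    qed
    define u where "u = y + w"
    have u: "u \<in> carrier_vec k" using yc w by (simp add: u_def)
    have Wu: "(W *\<^sub>v u) $ i = - w $ i" if i: "i < k" for i
      using arg_cong[OF Ww, of "\<lambda>a. a $ i"] i yc w W unfolding u_def z_def
      by (simp add: mat_vec_simps del: index_mult_mat_vec)
    have up: "0 < u $ i" if "i < k" for i
      using that yc w \<open>pos_vec w\<close> by (auto simp: u_def nonneg_vec_iff pos_vec_def add_nonneg_pos)
    define \<delta> where "\<delta> = Min ((\<lambda>i. w $ i / u $ i) ` {..<k})"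
    have d: "0 < \<delta>" unfolding \<delta>_def using k up w \<open>pos_vec w\<close>
      by (subst Min_gr_iff) (auto simp: pos_vec_def)
    have "\<delta> \<le> w $ i / u $ i" if "i < k" for i unfolding \<delta>_def using that by (intro Min_le) auto
    then have du: "\<delta> * u $ i \<le> w $ i" if "i < k" for i using that up by (simp add: pos_le_divide_eq)
    have "0\<^sub>v k \<le> (W + \<delta> \<cdot>\<^sub>m 1\<^sub>m k) *\<^sub>v ((-1) \<cdot>\<^sub>v u)"
      using W u Wu du unfolding nonneg_vec_iff by (auto simp: mat_vec_simps simp del: index_mult_mat_vec)
    moreover have "(-1) \<cdot>\<^sub>v u \<in> carrier_vec k" using u by simp
    ultimately have "0\<^sub>v k \<le> (-1) \<cdot>\<^sub>v u"
      by (rule monotone_matD[OF M_matrix_shift_monotone[OF M W k d], rotated])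
    then show False using up[OF k] k u by (auto simp: nonneg_vec_iff)
  qed
  moreover have "pos_vec y"
    by (rule irreducible_Z_matrix_pos_vec[OF irr Z yc(2) \<open>y \<noteq> 0\<^sub>v k\<close>]) (simp add: calculation)
  ultimately show ?thesis using yc by blast
qed

lemma M_matrix_certificate:
  assumes M: "M_matrix W" and W: "W \<in> carrier_mat k k" and k: "0 < k"
    and alt: "invertible_mat W \<or> \<not> invertible_mat W \<and> irreducible_mat W"
  shows "\<exists>v\<in>carrier_vec k. pos_vec v \<and> 0\<^sub>v k \<le> W *\<^sub>v v \<and> (pos_vec (W *\<^sub>v v) \<or> irreducible_mat W)"
  using alt
proof
  assume "invertible_mat W"
  from invertible_M_matrix_certificate[OF M W k this] obtain v
    where v: "v \<in> carrier_vec k" "pos_vec v" "pos_vec (W *\<^sub>v v)" by blast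
  then have "0\<^sub>v k \<le> W *\<^sub>v v" using W by (auto simp: pos_vec_def nonneg_vec_iff less_imp_le)
  with v show ?thesis by blast
next
  assume "\<not> invertible_mat W \<and> irreducible_mat W"
  then show ?thesis using singular_irreducible_M_matrix_certificate[OF M W k] by fastforce
qed

section \<open>Doubling as series connection of two-ports\<close>

text \<open>Two copies of the two-port \<open>E, G, H, F\<close> in series: the first maps \<open>(x0, y1)\<close> to \<open>(x1, y0)\<close>, the second
\<open>(x1, y2)\<close> to \<open>(x2, y1)\<close>. Elimination of the junction signals \<open>x1\<close> and \<open>y1\<close> yields the doubled quadruple as
the map from \<open>(x0, y2)\<close> to \<open>(x2, y0)\<close>. This turns every statement about one doubling step into a
statement about two consecutive applications of the old two-port.\<close>

lemma doubling_composition: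
  fixes E G H F :: "real mat"
  assumes E: "E \<in> carrier_mat n n" and G: "G \<in> carrier_mat n m"
    and H: "H \<in> carrier_mat m n" and F: "F \<in> carrier_mat m m"
    and inv: "invertible_mat (1\<^sub>m n - G * H)"
    and x0: "x0 \<in> carrier_vec n" and y2: "y2 \<in> carrier_vec m"
    and x1: "x1 = E *\<^sub>v x0 + G *\<^sub>v y1" and y1: "y1 = H *\<^sub>v x1 + F *\<^sub>v y2"
  shows "E *\<^sub>v x1 + G *\<^sub>v y2 =
      (E * minv (1\<^sub>m n - G * H) * E) *\<^sub>v x0 + (G + E * minv (1\<^sub>m n - G * H) * G * F) *\<^sub>v y2"
    and "H *\<^sub>v x0 + F *\<^sub>v y1 =
      (H + F * minv (1\<^sub>m m - H * G) * H * E) *\<^sub>v x0 + (F * minv (1\<^sub>m m - H * G) * F) *\<^sub>v y2"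
    and "x1 = minv (1\<^sub>m n - G * H) *\<^sub>v (E *\<^sub>v x0 + G *\<^sub>v (F *\<^sub>v y2))"
proof -
  note inv' = invertible_one_minus_prod_swap[OF G H inv]
  let ?M = "minv (1\<^sub>m n - G * H)" and ?N = "minv (1\<^sub>m m - H * G)"
  note Mc = minv_inverse(1)[OF one_minus_prod_carrier[OF G H] inv]
  note Nc = minv_inverse(1)[OF one_minus_prod_carrier[OF H G] inv']
  have c: "x1 \<in> carrier_vec n" unfolding x1 using E G by simp
  have d: "y1 \<in> carrier_vec m" unfolding y1 using H F by simp
  note c = c d
  have "x1 = E *\<^sub>v x0 + (G *\<^sub>v (H *\<^sub>v x1) + G *\<^sub>v (F *\<^sub>v y2))"
    by (subst x1, subst y1) (use E G H F c y2 in \<open>simp add: mat_vec_simps\<close>)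
  from vec_shift[OF this, of n] have "(1\<^sub>m n - G * H) *\<^sub>v x1 = E *\<^sub>v x0 + G *\<^sub>v (F *\<^sub>v y2)"
    using one_minus_prod_action[OF G H c(1)] E G H F c x0 y2
    by (metis mult_mat_vec_carrier)
  then show x1': "x1 = ?M *\<^sub>v (E *\<^sub>v x0 + G *\<^sub>v (F *\<^sub>v y2))"
    using minv_cancel(1)[OF one_minus_prod_carrier[OF G H] inv c(1)] by simp
  have "y1 = F *\<^sub>v y2 + (H *\<^sub>v (G *\<^sub>v y1) + H *\<^sub>v (E *\<^sub>v x0))"
    by (subst y1, subst x1) (use E G H F c x0 y2 in \<open>auto intro!: eq_vecI simp add: mat_vec_simps simp del: index_mult_mat_vec\<close>)
  from vec_shift[OF this, of m] have "(1\<^sub>m m - H * G) *\<^sub>v y1 = F *\<^sub>v y2 + H *\<^sub>v (E *\<^sub>v x0)"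
    using one_minus_prod_action[OF H G c(2)] E G H F c x0 y2
    by (metis mult_mat_vec_carrier)
  then have y1': "y1 = ?N *\<^sub>v (F *\<^sub>v y2 + H *\<^sub>v (E *\<^sub>v x0))"
    using minv_cancel(1)[OF one_minus_prod_carrier[OF H G] inv' c(2)] by simp
  show "E *\<^sub>v x1 + G *\<^sub>v y2 = (E * ?M * E) *\<^sub>v x0 + (G + E * ?M * G * F) *\<^sub>v y2"
    unfolding x1' using E G H F x0 y2 Mc
    by (auto intro!: eq_vecI simp add: mat_vec_simps simp del: index_mult_mat_vec)
  show "H *\<^sub>v x0 + F *\<^sub>v y1 = (H + F * ?N * H * E) *\<^sub>v x0 + (F * ?N * F) *\<^sub>v y2"
    unfolding y1' using E G H F x0 y2 Nc
    by (auto intro!: eq_vecI simp add: mat_vec_simps simp del: index_mult_mat_vec)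
qed

lemma doubling_interface_exists:
  fixes E G H F :: "real mat"
  assumes E: "E \<in> carrier_mat n n" and G: "G \<in> carrier_mat n m"
    and H: "H \<in> carrier_mat m n" and F: "F \<in> carrier_mat m m"
    and inv: "invertible_mat (1\<^sub>m n - G * H)"
    and x0: "x0 \<in> carrier_vec n" and y2: "y2 \<in> carrier_vec m"
  defines "x1 \<equiv> minv (1\<^sub>m n - G * H) *\<^sub>v (E *\<^sub>v x0 + G *\<^sub>v (F *\<^sub>v y2))"
  shows "x1 \<in> carrier_vec n" "x1 = E *\<^sub>v x0 + G *\<^sub>v (H *\<^sub>v x1 + F *\<^sub>v y2)"
proof -
  have rc: "E *\<^sub>v x0 + G *\<^sub>v (F *\<^sub>v y2) \<in> carrier_vec n" using G E by auto
  note m = minv_cancel[OF one_minus_prod_carrier[OF G H] inv rc]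
  show c: "x1 \<in> carrier_vec n" unfolding x1_def by (rule m(3))
  have eq: "x1 - G *\<^sub>v (H *\<^sub>v x1) = E *\<^sub>v x0 + G *\<^sub>v (F *\<^sub>v y2)"
    using m(2) one_minus_prod_action[OF G H c] unfolding x1_def[symmetric] by simp
  have "x1 $ i = (E *\<^sub>v x0 + G *\<^sub>v (H *\<^sub>v x1 + F *\<^sub>v y2)) $ i" if "i < n" for i
    using arg_cong[OF eq, of "\<lambda>u. u $ i"] that E G H F c x0 y2
    by (simp add: mat_vec_simps del: index_mult_mat_vec)
  then show "x1 = E *\<^sub>v x0 + G *\<^sub>v (H *\<^sub>v x1 + F *\<^sub>v y2)"
    using c E G by (intro eq_vecI) auto
qed

section \<open>An invariant that keeps the doubling step well defined\<close>

text \<open>The two-port is nonnegative, does not increase the reference vector \<open>(a, b)\<close>, and loses a fixed fraction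
in the passage from \<open>b\<close> to the \<open>a\<close>-side. The last condition excludes the critical case
\<open>G H a = a\<close>, in which \<open>I - G H\<close> is singular; without it only \<open>G H a \<le> a\<close> would follow.\<close>

definition dissipative :: "real vec \<Rightarrow> real vec \<Rightarrow> real mat \<Rightarrow> real mat \<Rightarrow> real mat \<Rightarrow> real mat \<Rightarrow> bool" where
  "dissipative a b E G H F \<longleftrightarrow>
     (\<forall>x y. 0\<^sub>v (dim_vec a) \<le> x \<longrightarrow> 0\<^sub>v (dim_vec b) \<le> y \<longrightarrow>
        0\<^sub>v (dim_vec a) \<le> E *\<^sub>v x + G *\<^sub>v y \<and> 0\<^sub>v (dim_vec b) \<le> H *\<^sub>v x + F *\<^sub>v y) \<and>
     E *\<^sub>v a + G *\<^sub>v b \<le> a \<and> H *\<^sub>v a + F *\<^sub>v b \<le> b \<and>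
     (\<exists>\<theta>. 0 \<le> \<theta> \<and> \<theta> < 1 \<and> G *\<^sub>v b \<le> \<theta> \<cdot>\<^sub>v a)"

lemma dissipative_blocks_nonneg:
  assumes dis: "dissipative a b E G H F"
    and c: "E \<in> carrier_mat n n" "G \<in> carrier_mat n m" "H \<in> carrier_mat m n" "F \<in> carrier_mat m m"
    and ab: "a \<in> carrier_vec n" "b \<in> carrier_vec m"
  shows "0\<^sub>v n \<le> x \<Longrightarrow> 0\<^sub>v n \<le> E *\<^sub>v x" "0\<^sub>v m \<le> y \<Longrightarrow> 0\<^sub>v n \<le> G *\<^sub>v y"
    "0\<^sub>v n \<le> x \<Longrightarrow> 0\<^sub>v m \<le> H *\<^sub>v x" "0\<^sub>v m \<le> y \<Longrightarrow> 0\<^sub>v m \<le> F *\<^sub>v y"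
proof -
  have j: "0\<^sub>v n \<le> E *\<^sub>v x + G *\<^sub>v y" "0\<^sub>v m \<le> H *\<^sub>v x + F *\<^sub>v y" if "0\<^sub>v n \<le> x" "0\<^sub>v m \<le> y" for x y
    using dis that ab unfolding dissipative_def by auto
  have z: "0\<^sub>v n \<le> (0\<^sub>v n :: real vec)" "0\<^sub>v m \<le> (0\<^sub>v m :: real vec)" by auto
  have x: "0\<^sub>v n \<le> E *\<^sub>v x" "0\<^sub>v m \<le> H *\<^sub>v x" if "0\<^sub>v n \<le> x" for x
    using j[OF that z(2)] c by (simp_all add: mat_vec_simps right_zero_vec[OF mat_vec_carrier[OF c(1)]]
      right_zero_vec[OF mat_vec_carrier[OF c(3)]])
  have y: "0\<^sub>v n \<le> G *\<^sub>v y" "0\<^sub>v m \<le> F *\<^sub>v y" if "0\<^sub>v m \<le> y" for y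
    using j[OF z(1) that] c by (simp_all add: mat_vec_simps left_zero_vec[OF mat_vec_carrier[OF c(2)]]
      left_zero_vec[OF mat_vec_carrier[OF c(4)]])
  show "0\<^sub>v n \<le> x \<Longrightarrow> 0\<^sub>v n \<le> E *\<^sub>v x" "0\<^sub>v m \<le> y \<Longrightarrow> 0\<^sub>v n \<le> G *\<^sub>v y"
    "0\<^sub>v n \<le> x \<Longrightarrow> 0\<^sub>v m \<le> H *\<^sub>v x" "0\<^sub>v m \<le> y \<Longrightarrow> 0\<^sub>v m \<le> F *\<^sub>v y"
    using x y by auto
qed

text \<open>\<open>H a \<le> b\<close> and \<open>G b \<le> \<theta> a\<close> give \<open>G H a \<le> \<theta> a < a\<close>, so \<open>a\<close> witnesses inverse positivity.\<close>

lemma dissipative_monotone: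
  assumes dis: "dissipative a b E G H F"
    and c: "E \<in> carrier_mat n n" "G \<in> carrier_mat n m" "H \<in> carrier_mat m n" "F \<in> carrier_mat m m"
    and ab: "a \<in> carrier_vec n" "b \<in> carrier_vec m" "pos_vec a" "pos_vec b"
  shows "monotone_mat n (1\<^sub>m n - G * H)"
proof (rule Z_matrix_monotone[OF _ ab(1,3)])
  note nn = dissipative_blocks_nonneg[OF dis c ab(1,2)]
  show "Z_matrix n (1\<^sub>m n - G * H)" unfolding Z_matrix_def
  proof (intro conjI allI impI one_minus_prod_carrier[OF c(2,3)])
    fix y :: "real vec" and i assume y: "0\<^sub>v n \<le> y" "i < n" "y $ i = 0"
    have "0 \<le> (G *\<^sub>v (H *\<^sub>v y)) $ i" using nonneg_vecD[OF nn(2)[OF nn(3)[OF y(1)]] y(2)] .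
    then show "((1\<^sub>m n - G * H) *\<^sub>v y) $ i \<le> 0"
      using y c nonneg_vec_carrier[OF y(1)]
      by (simp add: one_minus_prod_action[OF c(2,3)] del: index_mult_mat_vec)
  qed
  have a: "0\<^sub>v n \<le> a" "0\<^sub>v m \<le> b" using ab by (auto simp: pos_vec_def nonneg_vec_iff less_imp_le)
  obtain \<theta> where th: "0 \<le> \<theta>" "\<theta> < 1" "G *\<^sub>v b \<le> \<theta> \<cdot>\<^sub>v a" using dis unfolding dissipative_def by blast
  have "H *\<^sub>v a \<le> b"
  proof -
    have "H *\<^sub>v a + F *\<^sub>v b \<le> b" using dis unfolding dissipative_def by blast
    from le_vecD[OF this] have "(H *\<^sub>v a) $ i + (F *\<^sub>v b) $ i \<le> b $ i" if "i < m" for i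
      using that ab c by (simp del: index_mult_mat_vec)
    moreover have "0 \<le> (F *\<^sub>v b) $ i" if "i < m" for i
      using nonneg_vecD[OF nn(4)[OF a(2)] that] .
    ultimately have "(H *\<^sub>v a) $ i \<le> b $ i" if "i < m" for i
      using that by (smt (verit))
    then show ?thesis using ab c by (simp add: le_vec_iff del: index_mult_mat_vec)
  qed
  from nonneg_mat_vec_mono[OF c(2) nn(2) this ab(2)]
  have "G *\<^sub>v (H *\<^sub>v a) \<le> \<theta> \<cdot>\<^sub>v a" using th(3) by (rule order_trans)
  then have le: "(G *\<^sub>v (H *\<^sub>v a)) $ i \<le> \<theta> * a $ i" if "i < n" for i
    using le_vecD[of _ "\<theta> \<cdot>\<^sub>v a" i] that ab by (simp del: index_mult_mat_vec)
  have "(G *\<^sub>v (H *\<^sub>v a)) $ i < a $ i" if "i < n" for i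
  proof -
    have "0 < a $ i" using ab that by (auto simp: pos_vec_def)
    then have "\<theta> * a $ i < a $ i" using th(2) by simp
    then show ?thesis using le[OF that] by linarith
  qed
  then show "pos_vec ((1\<^sub>m n - G * H) *\<^sub>v a)"
    using c ab by (simp add: one_minus_prod_action[OF c(2,3)] pos_vec_def del: index_mult_mat_vec)
qed

text \<open>All three properties are read off the series connection. Let \<open>x1\<close> and \<open>y1\<close> be the signals at the junction.
With input \<open>(a, b)\<close> they satisfy \<open>x1 \<le> a\<close> and \<open>y1 \<le> b\<close>, so the outputs do not exceed \<open>(a, b)\<close>
either. With input \<open>(0, b)\<close> one has \<open>x1 = G y1 \<le> G b \<le> \<theta> a\<close>, and the new value of \<open>G b\<close> is
\<open>E x1 + G b \<le> \<theta> E a + G b \<le> \<theta> (a - G b) + G b = \<theta> a + (1 - \<theta>) G b\<close>, which is at most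
\<open>(1 - (1 - \<theta>)\<^sup>2) a\<close>. The fraction deteriorates but stays below \<open>1\<close>.\<close>

lemma dissipative_doubling:
  fixes E G H F :: "real mat"
  assumes dis: "dissipative a b E G H F"
    and c: "E \<in> carrier_mat n n" "G \<in> carrier_mat n m" "H \<in> carrier_mat m n" "F \<in> carrier_mat m m"
    and ab: "a \<in> carrier_vec n" "b \<in> carrier_vec m" "pos_vec a" "pos_vec b"
  shows "dissipative a b (E * minv (1\<^sub>m n - G * H) * E) (G + E * minv (1\<^sub>m n - G * H) * G * F)
    (H + F * minv (1\<^sub>m m - H * G) * H * E) (F * minv (1\<^sub>m m - H * G) * F)"
    (is "dissipative a b ?E ?G ?H ?F")
proof -
  note nn = dissipative_blocks_nonneg[OF dis c ab(1,2)]
  note mono = dissipative_monotone[OF dis c ab]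
  note inv = monotone_mat_invertible[OF one_minus_prod_carrier[OF c(2,3)] mono]
  have Emono: "E *\<^sub>v u \<le> E *\<^sub>v v" and Hmono: "H *\<^sub>v u \<le> H *\<^sub>v v"
    if "u \<le> v" "v \<in> carrier_vec n" for u v
    by (rule nonneg_mat_vec_mono[OF c(1) nn(1) that], assumption)
      (rule nonneg_mat_vec_mono[OF c(3) nn(3) that], assumption)
  have Gmono: "G *\<^sub>v u \<le> G *\<^sub>v v" and Fmono: "F *\<^sub>v u \<le> F *\<^sub>v v"
    if "u \<le> v" "v \<in> carrier_vec m" for u v
    by (rule nonneg_mat_vec_mono[OF c(2) nn(2) that], assumption)
      (rule nonneg_mat_vec_mono[OF c(4) nn(4) that], assumption)
  have a: "0\<^sub>v n \<le> a" "0\<^sub>v m \<le> b" using ab by (auto simp: pos_vec_def nonneg_vec_iff less_imp_le)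
  have Ea: "E *\<^sub>v a + G *\<^sub>v b \<le> a" and Hb: "H *\<^sub>v a + F *\<^sub>v b \<le> b"
    using dis unfolding dissipative_def by auto
  obtain \<theta> where th: "0 \<le> \<theta>" "\<theta> < 1" "G *\<^sub>v b \<le> \<theta> \<cdot>\<^sub>v a" using dis unfolding dissipative_def by blast
  have add_nn: "0\<^sub>v k \<le> u + w" if "0\<^sub>v k \<le> u" "0\<^sub>v k \<le> w" for k and u w :: "real vec"
    using that by (auto simp: nonneg_vec_iff)
  have add_mono: "u + w \<le> u' + w'" if "u \<le> u'" "w \<le> w'" "dim_vec u' = dim_vec w'" for u w u' w' :: "real vec"
    using that by (auto simp: less_eq_vec_def intro!: add_mono)
  \<comment> \<open>the junction signal \<open>x1\<close> for inputs \<open>x\<close> and \<open>y\<close>; the other one is \<open>H x1 + F y\<close>\<close>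
  define X where "X x y = minv (1\<^sub>m n - G * H) *\<^sub>v (E *\<^sub>v x + G *\<^sub>v (F *\<^sub>v y))" for x y
  have X: "X x y \<in> carrier_vec n" "X x y = E *\<^sub>v x + G *\<^sub>v (H *\<^sub>v X x y + F *\<^sub>v y)"
    "E *\<^sub>v X x y + G *\<^sub>v y = ?E *\<^sub>v x + ?G *\<^sub>v y"
    "H *\<^sub>v x + F *\<^sub>v (H *\<^sub>v X x y + F *\<^sub>v y) = ?H *\<^sub>v x + ?F *\<^sub>v y"
    if "x \<in> carrier_vec n" "y \<in> carrier_vec m" for x y
  proof -
    note i = doubling_interface_exists[OF c inv that, folded X_def]
    note ii = doubling_composition[OF c inv that i(2) refl]
    show "X x y \<in> carrier_vec n" "X x y = E *\<^sub>v x + G *\<^sub>v (H *\<^sub>v X x y + F *\<^sub>v y)"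
      "E *\<^sub>v X x y + G *\<^sub>v y = ?E *\<^sub>v x + ?G *\<^sub>v y"
      "H *\<^sub>v x + F *\<^sub>v (H *\<^sub>v X x y + F *\<^sub>v y) = ?H *\<^sub>v x + ?F *\<^sub>v y"
      by (fact i ii(1,2))+
  qed
  have Xnn: "0\<^sub>v n \<le> X x y" if "0\<^sub>v n \<le> x" "0\<^sub>v m \<le> y" for x y
    unfolding X_def by (intro monotone_mat_inverse_nonneg[OF one_minus_prod_carrier[OF c(2,3)] mono]
      add_nn nn that)
  have nonneg: "0\<^sub>v n \<le> ?E *\<^sub>v x + ?G *\<^sub>v y \<and> 0\<^sub>v m \<le> ?H *\<^sub>v x + ?F *\<^sub>v y"
    if "0\<^sub>v n \<le> x" "0\<^sub>v m \<le> y" for x y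
    unfolding X(3,4)[OF nonneg_vec_carrier[OF that(1)] nonneg_vec_carrier[OF that(2)], symmetric]
    by (intro conjI add_nn nn Xnn that)
  let ?x = "X a b"
  have xa: "?x \<le> a"
  proof -
    have "G *\<^sub>v (H *\<^sub>v a + F *\<^sub>v b) \<le> G *\<^sub>v b" by (rule Gmono[OF Hb ab(2)])
    from le_vecD[OF this]
    have "(G *\<^sub>v (H *\<^sub>v a)) $ i + (G *\<^sub>v (F *\<^sub>v b)) $ i \<le> (G *\<^sub>v b) $ i" if "i < n" for i
      using that c ab
      by (simp add: mat_vec_simps del: index_mult_mat_vec)
    moreover have "(E *\<^sub>v a) $ i + (G *\<^sub>v b) $ i \<le> a $ i" if "i < n" for i
      using le_vecD[OF Ea, of i] that c ab by (simp del: index_mult_mat_vec)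
    ultimately have e: "0 \<le> a $ i - (G *\<^sub>v (H *\<^sub>v a)) $ i - ((E *\<^sub>v a) $ i + (G *\<^sub>v (F *\<^sub>v b)) $ i)" if "i < n" for i
      using that by (smt (verit))
    have "(1\<^sub>m n - G * H) *\<^sub>v ?x = E *\<^sub>v a + G *\<^sub>v (F *\<^sub>v b)"
      unfolding X_def
      by (rule minv_cancel(2)[OF one_minus_prod_carrier[OF c(2,3)] inv]) (use c in auto)
    then have "(1\<^sub>m n - G * H) *\<^sub>v (a - ?x) = (a - G *\<^sub>v (H *\<^sub>v a)) - (E *\<^sub>v a + G *\<^sub>v (F *\<^sub>v b))"
      using one_minus_prod_action[OF c(2,3) ab(1)]
        mult_minus_distrib_mat_vec[OF one_minus_prod_carrier[OF c(2,3)] ab(1) X(1)[OF ab(1,2)]] by simp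
    also have "0\<^sub>v n \<le> \<dots>" unfolding nonneg_vec_iff
      using e c ab by (simp del: index_mult_mat_vec)
    finally have image: "0\<^sub>v n \<le> (1\<^sub>m n - G * H) *\<^sub>v (a - ?x)" .
    have "0\<^sub>v n \<le> a - ?x"
      by (rule monotone_matD[OF mono minus_carrier_vec[OF ab(1) X(1)[OF ab(1,2)]] image])
    then show ?thesis using nonneg_diff_iff X(1)[OF ab(1,2)] ab by blast
  qed
  have ya: "H *\<^sub>v ?x + F *\<^sub>v b \<le> b"
    by (rule order_trans[OF add_mono[OF Hmono[OF xa ab(1)] order_refl] Hb]) (use c in auto)
  have A: "?E *\<^sub>v a + ?G *\<^sub>v b \<le> a"
    unfolding X(3)[OF ab(1,2), symmetric]
    by (rule order_trans[OF add_mono[OF Emono[OF xa ab(1)] order_refl] Ea]) (use c in auto)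
  have B: "?H *\<^sub>v a + ?F *\<^sub>v b \<le> b"
    unfolding X(4)[OF ab(1,2), symmetric]
    by (rule order_trans[OF add_mono[OF order_refl Fmono[OF ya ab(2)]] Hb]) (use c in auto)
  let ?z = "X (0\<^sub>v n) b"
  have z: "?z \<in> carrier_vec n" by (rule X(1)) (use ab in auto)
  have zn: "0\<^sub>v n \<le> ?z" by (rule Xnn) (use a in auto)
  \<comment> \<open>by linearity, the input \<open>(0, b)\<close> produces a smaller junction signal than \<open>(a, b)\<close>\<close>
  have zle: "?z \<le> ?x"
  proof -
    have "0\<^sub>v n \<le> minv (1\<^sub>m n - G * H) *\<^sub>v (E *\<^sub>v a)"
      by (rule monotone_mat_inverse_nonneg[OF one_minus_prod_carrier[OF c(2,3)] mono nn(1)[OF a(1)]])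
    moreover have "?x = minv (1\<^sub>m n - G * H) *\<^sub>v (E *\<^sub>v a) + ?z"
      unfolding X_def using c ab minv_inverse(1)[OF one_minus_prod_carrier[OF c(2,3)] inv]
      by (simp add: mat_vec_simps)
    ultimately show ?thesis using z by (auto simp: less_eq_vec_def simp del: index_mult_mat_vec)
  qed
  have Gz: "(G *\<^sub>v b) $ i \<le> \<theta> * a $ i" if "i < n" for i
    using le_vecD[OF th(3), of i] that ab by (simp del: index_mult_mat_vec)
  have "?z \<le> \<theta> \<cdot>\<^sub>v a"
  proof -
    have "H *\<^sub>v ?z + F *\<^sub>v b \<le> b"
      by (rule order_trans[OF add_mono[OF Hmono[OF order_trans[OF zle xa] ab(1)] order_refl] Hb]) (use c in auto)
    from Gmono[OF this ab(2)] th(3) have "G *\<^sub>v (H *\<^sub>v ?z + F *\<^sub>v b) \<le> \<theta> \<cdot>\<^sub>v a" by (rule order_trans)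
    moreover have "?z = G *\<^sub>v (H *\<^sub>v ?z + F *\<^sub>v b)"
      by (subst X(2)) (use c ab z in \<open>auto simp: mat_vec_simps\<close>)
    ultimately show ?thesis by simp
  qed
  from Emono[OF this] have Ez: "(E *\<^sub>v ?z) $ i \<le> \<theta> * (E *\<^sub>v a) $ i" if "i < n" for i
    using le_vecD[of "E *\<^sub>v ?z" "E *\<^sub>v (\<theta> \<cdot>\<^sub>v a)" i] that ab c by (simp add: mat_vec_simps del: index_mult_mat_vec)
  have "?G *\<^sub>v b \<le> (1 - (1 - \<theta>) * (1 - \<theta>)) \<cdot>\<^sub>v a"
  proof -
    have "?G *\<^sub>v b = ?E *\<^sub>v 0\<^sub>v n + ?G *\<^sub>v b" using c ab minv_inverse(1)[OF one_minus_prod_carrier[OF c(2,3)] inv]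
      by (simp add: mat_vec_simps)
    also have "\<dots> = E *\<^sub>v ?z + G *\<^sub>v b" by (rule X(3)[symmetric]) (use ab in auto)
    finally have eq: "?G *\<^sub>v b = E *\<^sub>v ?z + G *\<^sub>v b" .
    have "(E *\<^sub>v ?z) $ i + (G *\<^sub>v b) $ i \<le> (1 - (1 - \<theta>) * (1 - \<theta>)) * a $ i" if i: "i < n" for i
    proof -
      have "(E *\<^sub>v a) $ i + (G *\<^sub>v b) $ i \<le> a $ i"
        using le_vecD[OF Ea, of i] i c ab by (simp del: index_mult_mat_vec)
      then have "\<theta> * (E *\<^sub>v a) $ i \<le> \<theta> * (a $ i - (G *\<^sub>v b) $ i)"
        using th by (intro mult_left_mono) auto
      moreover have "(1 - \<theta>) * (G *\<^sub>v b) $ i \<le> (1 - \<theta>) * (\<theta> * a $ i)"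
        using th Gz[OF i] by (intro mult_left_mono) auto
      ultimately show ?thesis using Ez[OF i] by (simp add: algebra_simps)
    qed
    then show ?thesis unfolding eq le_vec_iff using c ab by (simp del: index_mult_mat_vec)
  qed
  moreover have "0 \<le> 1 - (1 - \<theta>) * (1 - \<theta>)" "1 - (1 - \<theta>) * (1 - \<theta>) < 1"
    using th by (auto intro: mult_le_one)
  ultimately have "\<exists>\<theta>. 0 \<le> \<theta> \<and> \<theta> < 1 \<and> ?G *\<^sub>v b \<le> \<theta> \<cdot>\<^sub>v a" by blast
  then show ?thesis unfolding dissipative_def carrier_vecD[OF ab(1)] carrier_vecD[OF ab(2)]
    using A B nonneg by blast
qed

section \<open>Realization by a feedback loop\<close>

text \<open>The first conjunct states that any solution of the loop with inputs \<open>x, y\<close> produces the outputs of the two-port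
\<open>E, G, H, F\<close>; the second that the loop without input has only the zero solution. In this form two loops
compose by substitution, without the inverses in the closed formulas; the second conjunct amounts to invertibility of
\<open>I - Z Y\<close> and of \<open>I - Y Z\<close>.\<close>

definition realizes :: "nat \<Rightarrow> nat \<Rightarrow> nat \<Rightarrow> nat \<Rightarrow> real \<Rightarrow> real mat \<Rightarrow> real mat \<Rightarrow> real mat \<Rightarrow> real mat \<Rightarrow>
    real mat \<Rightarrow> real mat \<Rightarrow> real mat \<Rightarrow> real mat \<Rightarrow> real mat \<Rightarrow> real mat \<Rightarrow> real mat \<Rightarrow> real mat \<Rightarrow> bool" where
  "realizes n m p q \<gamma> \<A> \<D> U V W Q Y Z E G H F \<longleftrightarrow>
     (\<forall>x\<in>carrier_vec n. \<forall>y\<in>carrier_vec m. \<forall>a\<in>carrier_vec q. \<forall>b\<in>carrier_vec p.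
        a = Z *\<^sub>v b + transpose_mat V *\<^sub>v y \<longrightarrow> b = Y *\<^sub>v a + transpose_mat Q *\<^sub>v x \<longrightarrow>
        \<D> *\<^sub>v x + \<gamma> \<cdot>\<^sub>v (W *\<^sub>v a) = E *\<^sub>v x + G *\<^sub>v y \<and>
        \<A> *\<^sub>v y + \<gamma> \<cdot>\<^sub>v (U *\<^sub>v b) = H *\<^sub>v x + F *\<^sub>v y) \<and>
     (\<forall>a\<in>carrier_vec q. \<forall>b\<in>carrier_vec p. a = Z *\<^sub>v b \<longrightarrow> b = Y *\<^sub>v a \<longrightarrow> a = 0\<^sub>v q \<and> b = 0\<^sub>v p)"

lemma realizes_response:
  assumes "realizes n m p q \<gamma> \<A> \<D> U V W Q Y Z E G H F"
    and "x \<in> carrier_vec n" "y \<in> carrier_vec m" "a \<in> carrier_vec q" "b \<in> carrier_vec p"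
    and "a = Z *\<^sub>v b + transpose_mat V *\<^sub>v y" "b = Y *\<^sub>v a + transpose_mat Q *\<^sub>v x"
  shows "\<D> *\<^sub>v x + \<gamma> \<cdot>\<^sub>v (W *\<^sub>v a) = E *\<^sub>v x + G *\<^sub>v y" "\<A> *\<^sub>v y + \<gamma> \<cdot>\<^sub>v (U *\<^sub>v b) = H *\<^sub>v x + F *\<^sub>v y"
  using assms unfolding realizes_def by blast+

lemma realizes_unforced:
  assumes "realizes n m p q \<gamma> \<A> \<D> U V W Q Y Z E G H F"
    and "a \<in> carrier_vec q" "b \<in> carrier_vec p" "a = Z *\<^sub>v b" "b = Y *\<^sub>v a"
  shows "a = 0\<^sub>v q" "b = 0\<^sub>v p"
  using assms unfolding realizes_def by blast+

text \<open>Exchanging the two directions of travel. It lets every formula be proved for one direction only.\<close>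

lemma realizes_swap:
  assumes c: "E \<in> carrier_mat n n" "G \<in> carrier_mat n m" "H \<in> carrier_mat m n" "F \<in> carrier_mat m m"
    and r: "realizes n m p q \<gamma> \<A> \<D> U V W Q Y Z E G H F"
  shows "realizes m n q p \<gamma> \<D> \<A> W Q U V Z Y F H G E"
proof -
  have comm: "E *\<^sub>v x + G *\<^sub>v y = G *\<^sub>v y + E *\<^sub>v x" "H *\<^sub>v x + F *\<^sub>v y = F *\<^sub>v y + H *\<^sub>v x" for x y
    using comm_add_vec[OF mat_vec_carrier[OF c(1)] mat_vec_carrier[OF c(2)]]
      comm_add_vec[OF mat_vec_carrier[OF c(3)] mat_vec_carrier[OF c(4)]] by blast+
  show ?thesis using r unfolding realizes_def comm by blast
qed

text \<open>For given inputs the loop is solved by \<open>a = (I - Z Y)\<^sup>-\<^sup>1 (Z Q\<^sup>T x + V\<^sup>T y)\<close> and \<open>b = Y a + Q\<^sup>T x\<close>.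
Comparing outputs for \<open>y = 0\<close> and for \<open>x = 0\<close> gives \<open>E\<close> and \<open>G\<close>.\<close>

lemma realizes_formulas_half:
  assumes r: "realizes n m p q \<gamma> \<A> \<D> U V W Q Y Z E G H F"
    and c: "E \<in> carrier_mat n n" "G \<in> carrier_mat n m"
    and k: "\<D> \<in> carrier_mat n n" "V \<in> carrier_mat m q" "W \<in> carrier_mat n q" "Q \<in> carrier_mat n p"
      "Y \<in> carrier_mat p q" "Z \<in> carrier_mat q p"
  shows "invertible_mat (1\<^sub>m q - Z * Y)"
    and "E = \<D> + \<gamma> \<cdot>\<^sub>m (W * minv (1\<^sub>m q - Z * Y) * Z * transpose_mat Q)"
    and "G = \<gamma> \<cdot>\<^sub>m (W * minv (1\<^sub>m q - Z * Y) * transpose_mat V)"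
proof -
  note Xc = one_minus_prod_carrier[OF k(6,5)]
  show inv: "invertible_mat (1\<^sub>m q - Z * Y)"
  proof (rule invertible_matI_kernel[OF Xc])
    fix a :: "real vec" assume a: "a \<in> carrier_vec q" "(1\<^sub>m q - Z * Y) *\<^sub>v a = 0\<^sub>v q"
    then have d: "a - Z *\<^sub>v (Y *\<^sub>v a) = 0\<^sub>v q" by (simp add: one_minus_prod_action[OF k(6,5)])
    have "a = Z *\<^sub>v (Y *\<^sub>v a)"
    proof (rule eq_vecI)
      fix i assume "i < dim_vec (Z *\<^sub>v (Y *\<^sub>v a))"
      then show "a $ i = (Z *\<^sub>v (Y *\<^sub>v a)) $ i"
        using arg_cong[OF d, of "\<lambda>u. u $ i"] a k by (simp del: index_mult_mat_vec)
    qed (use a k in auto)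
    then show "a = 0\<^sub>v q" using realizes_unforced(1)[OF r a(1) _ _ refl] k by simp
  qed
  let ?M = "minv (1\<^sub>m q - Z * Y)"
  note Mc = minv_inverse(1)[OF Xc inv]
  have resp: "\<D> *\<^sub>v x + \<gamma> \<cdot>\<^sub>v (W *\<^sub>v (?M *\<^sub>v (Z *\<^sub>v (transpose_mat Q *\<^sub>v x) + transpose_mat V *\<^sub>v y))) = E *\<^sub>v x + G *\<^sub>v y"
    if x: "x \<in> carrier_vec n" and y: "y \<in> carrier_vec m" for x y
  proof -
    define f where "f = Z *\<^sub>v (transpose_mat Q *\<^sub>v x) + transpose_mat V *\<^sub>v y"
    have f: "f \<in> carrier_vec q" unfolding f_def using k y x by (auto intro!: carrier_vecI)
    define a where "a = ?M *\<^sub>v f"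
    have a: "a \<in> carrier_vec q" "(1\<^sub>m q - Z * Y) *\<^sub>v a = f"
      using minv_cancel[OF Xc inv f] by (auto simp: a_def)
    have eq: "a - Z *\<^sub>v (Y *\<^sub>v a) = f" using a by (simp add: one_minus_prod_action[OF k(6,5)])
    have "a = Z *\<^sub>v (Y *\<^sub>v a + transpose_mat Q *\<^sub>v x) + transpose_mat V *\<^sub>v y"
    proof (rule eq_vecI)
      fix i assume "i < dim_vec (Z *\<^sub>v (Y *\<^sub>v a + transpose_mat Q *\<^sub>v x) + transpose_mat V *\<^sub>v y)"
      then have i: "i < q" using k by simp
      then show "a $ i = (Z *\<^sub>v (Y *\<^sub>v a + transpose_mat Q *\<^sub>v x) + transpose_mat V *\<^sub>v y) $ i"
        using arg_cong[OF eq, of "\<lambda>u. u $ i"] a(1) k x y unfolding f_def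
        by (simp add: mat_vec_simps del: index_mult_mat_vec)
    qed (use a k in auto)
    from realizes_response(1)[OF r x y a(1) _ this refl] show ?thesis
      using k unfolding a_def f_def by simp
  qed
  show "E = \<D> + \<gamma> \<cdot>\<^sub>m (W * ?M * Z * transpose_mat Q)"
  proof (rule eq_mat_by_action[OF c(1)])
    fix x :: "real vec" assume x: "x \<in> carrier_vec n"
    have "transpose_mat V *\<^sub>v 0\<^sub>v m = 0\<^sub>v q" "G *\<^sub>v 0\<^sub>v m = 0\<^sub>v n"
      using k c by (auto simp: mat_vec_simps)
    then have "\<D> *\<^sub>v x + \<gamma> \<cdot>\<^sub>v (W *\<^sub>v (?M *\<^sub>v (Z *\<^sub>v (transpose_mat Q *\<^sub>v x)))) = E *\<^sub>v x"
      using resp[OF x zero_carrier_vec] k c Mc x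
        right_zero_vec[OF mat_vec_carrier[OF c(1)]] right_zero_vec[OF mat_vec_carrier[OF k(6)]] by simp
    then show "E *\<^sub>v x = (\<D> + \<gamma> \<cdot>\<^sub>m (W * ?M * Z * transpose_mat Q)) *\<^sub>v x"
      using k c Mc x by (simp add: mat_vec_simps)
  qed (use k Mc in auto)
  show "G = \<gamma> \<cdot>\<^sub>m (W * ?M * transpose_mat V)"
  proof (rule eq_mat_by_action[OF c(2)])
    fix y :: "real vec" assume y: "y \<in> carrier_vec m"
    have z: "transpose_mat Q *\<^sub>v 0\<^sub>v n = 0\<^sub>v p" "E *\<^sub>v 0\<^sub>v n = 0\<^sub>v n" "\<D> *\<^sub>v 0\<^sub>v n = 0\<^sub>v n" "Z *\<^sub>v 0\<^sub>v p = 0\<^sub>v q"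
      using k c by (auto simp: mat_vec_simps)
    have "\<gamma> \<cdot>\<^sub>v (W *\<^sub>v (?M *\<^sub>v (transpose_mat V *\<^sub>v y))) = G *\<^sub>v y"
      using resp[OF zero_carrier_vec y] k c Mc y z
        left_zero_vec[OF mat_vec_carrier[OF c(2)]] left_zero_vec[OF mat_vec_carrier[of "transpose_mat V" q m]]
        left_zero_vec[OF smult_carrier_vec[THEN iffD2, OF mat_vec_carrier[OF k(3)]]]
      by simp
    then show "G *\<^sub>v y = (\<gamma> \<cdot>\<^sub>m (W * ?M * transpose_mat V)) *\<^sub>v y"
      using k c Mc y by (simp add: mat_vec_simps)
  qed (use k Mc in auto)
qed

text \<open>Let \<open>(a1, b1)\<close> and \<open>(a2, b2)\<close> be the internal signals of the first and the second loop. The junction signals are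
\<open>y1 = \<A> y + \<gamma> U b2\<close> and \<open>x1 = \<D> x + \<gamma> W a1\<close>. Substituting them in the loop equations of \<open>a1\<close> and of \<open>b2\<close> produces
the couplings \<open>\<gamma> V\<^sup>T U\<close> and \<open>\<gamma> Q\<^sup>T W\<close>. The internal vectors of the combined loop are
\<open>(a2, a1)\<close> and \<open>(b1, b2)\<close>; the opposite orders are the reason why \<open>Y\<close> and \<open>Z\<close> stand on the antidiagonal.\<close>

lemma realizes_doubling:
  fixes E G H F :: "real mat"
  assumes r: "realizes n m p q \<gamma> \<A> \<D> U V W Q Y Z E G H F"
    and c: "E \<in> carrier_mat n n" "G \<in> carrier_mat n m" "H \<in> carrier_mat m n" "F \<in> carrier_mat m m"
    and inv: "invertible_mat (1\<^sub>m n - G * H)"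
    and k: "\<A> \<in> carrier_mat m m" "\<D> \<in> carrier_mat n n" "U \<in> carrier_mat m p" "V \<in> carrier_mat m q"
      "W \<in> carrier_mat n q" "Q \<in> carrier_mat n p" "Y \<in> carrier_mat p q" "Z \<in> carrier_mat q p"
    and U': "\<And>b1 b2. b1 \<in> carrier_vec p \<Longrightarrow> b2 \<in> carrier_vec p \<Longrightarrow>
      U' *\<^sub>v (b1 @\<^sub>v b2) = U *\<^sub>v b1 + \<A> *\<^sub>v (U *\<^sub>v b2)"
    and W': "\<And>a1 a2. a1 \<in> carrier_vec q \<Longrightarrow> a2 \<in> carrier_vec q \<Longrightarrow>
      W' *\<^sub>v (a1 @\<^sub>v a2) = W *\<^sub>v a1 + \<D> *\<^sub>v (W *\<^sub>v a2)"
    and V': "\<And>y. y \<in> carrier_vec m \<Longrightarrow>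
      transpose_mat V' *\<^sub>v y = (transpose_mat V *\<^sub>v y) @\<^sub>v (transpose_mat V *\<^sub>v (\<A> *\<^sub>v y))"
    and Q': "\<And>x. x \<in> carrier_vec n \<Longrightarrow>
      transpose_mat Q' *\<^sub>v x = (transpose_mat Q *\<^sub>v x) @\<^sub>v (transpose_mat Q *\<^sub>v (\<D> *\<^sub>v x))"
  shows "realizes n m (p + p) (q + q) \<gamma> (\<A> * \<A>) (\<D> * \<D>) U' V' W' Q'
    (four_block_mat (0\<^sub>m p q) Y Y (\<gamma> \<cdot>\<^sub>m (transpose_mat Q * W)))
    (four_block_mat (0\<^sub>m q p) Z Z (\<gamma> \<cdot>\<^sub>m (transpose_mat V * U)))
    (E * minv (1\<^sub>m n - G * H) * E) (G + E * minv (1\<^sub>m n - G * H) * G * F)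
    (H + F * minv (1\<^sub>m m - H * G) * H * E) (F * minv (1\<^sub>m m - H * G) * F)"
    (is "realizes n m (p + p) (q + q) \<gamma> (\<A> * \<A>) (\<D> * \<D>) U' V' W' Q' ?Y ?Z ?E ?G ?H ?F")
proof -
  have carr: "transpose_mat V \<in> carrier_mat q m" "transpose_mat Q \<in> carrier_mat p n" using k by auto
  have links: "a2 = Z *\<^sub>v b2 + transpose_mat V *\<^sub>v y"
      "a1 = Z *\<^sub>v b1 + transpose_mat V *\<^sub>v (\<A> *\<^sub>v y + \<gamma> \<cdot>\<^sub>v (U *\<^sub>v b2))"
      "b1 = Y *\<^sub>v a1 + transpose_mat Q *\<^sub>v x"
      "b2 = Y *\<^sub>v a2 + transpose_mat Q *\<^sub>v (\<D> *\<^sub>v x + \<gamma> \<cdot>\<^sub>v (W *\<^sub>v a1))"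
    if v: "x \<in> carrier_vec n" "y \<in> carrier_vec m" "a1 \<in> carrier_vec q" "a2 \<in> carrier_vec q"
        "b1 \<in> carrier_vec p" "b2 \<in> carrier_vec p"
      and A: "a2 @\<^sub>v a1 = ?Z *\<^sub>v (b1 @\<^sub>v b2) + transpose_mat V' *\<^sub>v y"
      and B: "b1 @\<^sub>v b2 = ?Y *\<^sub>v (a2 @\<^sub>v a1) + transpose_mat Q' *\<^sub>v x" for x y a1 a2 b1 b2
  proof -
    have S: "\<gamma> \<cdot>\<^sub>m (transpose_mat V * U) \<in> carrier_mat q p" and T: "\<gamma> \<cdot>\<^sub>m (transpose_mat Q * W) \<in> carrier_mat p q"
      using k by auto
    have "?Z *\<^sub>v (b1 @\<^sub>v b2) + transpose_mat V' *\<^sub>v y =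
      (0\<^sub>m q p *\<^sub>v b1 + Z *\<^sub>v b2 + transpose_mat V *\<^sub>v y) @\<^sub>v
      (Z *\<^sub>v b1 + (\<gamma> \<cdot>\<^sub>m (transpose_mat V * U)) *\<^sub>v b2 + transpose_mat V *\<^sub>v (\<A> *\<^sub>v y))"
      unfolding four_block_mat_mult_vec[OF zero_carrier_mat k(8) k(8) S v(5,6)] V'[OF v(2)]
      by (rule append_vec_add[of _ q _ _ q]) (use k in \<open>auto intro!: carrier_vecI\<close>)
    also have "0\<^sub>m q p *\<^sub>v b1 + Z *\<^sub>v b2 = Z *\<^sub>v b2"
      using k v left_zero_vec[OF mat_vec_carrier[OF k(8)]] by (simp add: mat_vec_simps)
    finally have A': "a2 @\<^sub>v a1 = (Z *\<^sub>v b2 + transpose_mat V *\<^sub>v y) @\<^sub>v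
      (Z *\<^sub>v b1 + (\<gamma> \<cdot>\<^sub>m (transpose_mat V * U)) *\<^sub>v b2 + transpose_mat V *\<^sub>v (\<A> *\<^sub>v y))"
      using A by simp
    have "Z *\<^sub>v b2 + transpose_mat V *\<^sub>v y \<in> carrier_vec q" using k carr by auto
    from A'[unfolded append_vec_eq[OF v(4) this]]
    have a: "a2 = Z *\<^sub>v b2 + transpose_mat V *\<^sub>v y"
      "a1 = Z *\<^sub>v b1 + (\<gamma> \<cdot>\<^sub>m (transpose_mat V * U)) *\<^sub>v b2 + transpose_mat V *\<^sub>v (\<A> *\<^sub>v y)" by auto
    have "?Y *\<^sub>v (a2 @\<^sub>v a1) + transpose_mat Q' *\<^sub>v x =
      (0\<^sub>m p q *\<^sub>v a2 + Y *\<^sub>v a1 + transpose_mat Q *\<^sub>v x) @\<^sub>v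
      (Y *\<^sub>v a2 + (\<gamma> \<cdot>\<^sub>m (transpose_mat Q * W)) *\<^sub>v a1 + transpose_mat Q *\<^sub>v (\<D> *\<^sub>v x))"
      unfolding four_block_mat_mult_vec[OF zero_carrier_mat k(7) k(7) T v(4,3)] Q'[OF v(1)]
      by (rule append_vec_add[of _ p _ _ p]) (use k in \<open>auto intro!: carrier_vecI\<close>)
    also have "0\<^sub>m p q *\<^sub>v a2 + Y *\<^sub>v a1 = Y *\<^sub>v a1"
      using k v left_zero_vec[OF mat_vec_carrier[OF k(7)]] by (simp add: mat_vec_simps)
    finally have B': "b1 @\<^sub>v b2 = (Y *\<^sub>v a1 + transpose_mat Q *\<^sub>v x) @\<^sub>v
      (Y *\<^sub>v a2 + (\<gamma> \<cdot>\<^sub>m (transpose_mat Q * W)) *\<^sub>v a1 + transpose_mat Q *\<^sub>v (\<D> *\<^sub>v x))"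
      using B by simp
    have "Y *\<^sub>v a1 + transpose_mat Q *\<^sub>v x \<in> carrier_vec p" using k carr by auto
    from B'[unfolded append_vec_eq[OF v(5) this]]
    have b: "b1 = Y *\<^sub>v a1 + transpose_mat Q *\<^sub>v x"
      "b2 = Y *\<^sub>v a2 + (\<gamma> \<cdot>\<^sub>m (transpose_mat Q * W)) *\<^sub>v a1 + transpose_mat Q *\<^sub>v (\<D> *\<^sub>v x)" by auto
    show "a2 = Z *\<^sub>v b2 + transpose_mat V *\<^sub>v y" "b1 = Y *\<^sub>v a1 + transpose_mat Q *\<^sub>v x" by (fact a b)+
    show "a1 = Z *\<^sub>v b1 + transpose_mat V *\<^sub>v (\<A> *\<^sub>v y + \<gamma> \<cdot>\<^sub>v (U *\<^sub>v b2))"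
      by (rule trans[OF a(2)], rule eq_vecI)
        (use k v in \<open>simp_all add: mat_vec_simps del: index_mult_mat_vec\<close>)
    show "b2 = Y *\<^sub>v a2 + transpose_mat Q *\<^sub>v (\<D> *\<^sub>v x + \<gamma> \<cdot>\<^sub>v (W *\<^sub>v a1))"
      by (rule trans[OF b(2)], rule eq_vecI)
        (use k v in \<open>simp_all add: mat_vec_simps del: index_mult_mat_vec\<close>)
  qed
  show ?thesis unfolding realizes_def
  proof (intro conjI ballI impI)
    fix x y a' b' assume v: "x \<in> carrier_vec n" "y \<in> carrier_vec m"
      and a': "a' \<in> carrier_vec (q + q)" and b': "b' \<in> carrier_vec (p + p)"
      and A: "a' = ?Z *\<^sub>v b' + transpose_mat V' *\<^sub>v y" and B: "b' = ?Y *\<^sub>v a' + transpose_mat Q' *\<^sub>v x"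
    obtain a2 a1 where a: "a2 \<in> carrier_vec q" "a1 \<in> carrier_vec q" "a' = a2 @\<^sub>v a1" using split_vec[OF a'] by blast
    obtain b1 b2 where b: "b1 \<in> carrier_vec p" "b2 \<in> carrier_vec p" "b' = b1 @\<^sub>v b2" using split_vec[OF b'] by blast
    define y1 where "y1 = \<A> *\<^sub>v y + \<gamma> \<cdot>\<^sub>v (U *\<^sub>v b2)"
    define x1 where "x1 = \<D> *\<^sub>v x + \<gamma> \<cdot>\<^sub>v (W *\<^sub>v a1)"
    have xy: "x1 \<in> carrier_vec n" "y1 \<in> carrier_vec m" unfolding x1_def y1_def using k by auto
    note L = links[OF v a(2,1) b(1,2) A[unfolded a b] B[unfolded a b], folded x1_def y1_def]
    note R1 = realizes_response[OF r v(1) xy(2) a(2) b(1) L(2,3), folded x1_def]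
    note R2 = realizes_response[OF r xy(1) v(2) a(1) b(2) L(1,4), folded y1_def]
    note D = doubling_composition[OF c inv v R1(1) R2(2)]
    show "(\<D> * \<D>) *\<^sub>v x + \<gamma> \<cdot>\<^sub>v (W' *\<^sub>v a') = ?E *\<^sub>v x + ?G *\<^sub>v y"
    proof -
      have "(\<D> * \<D>) *\<^sub>v x + \<gamma> \<cdot>\<^sub>v (W' *\<^sub>v a') = \<D> *\<^sub>v x1 + \<gamma> \<cdot>\<^sub>v (W *\<^sub>v a2)"
        unfolding a(3) W'[OF a(1,2)] x1_def using k v a
        by (intro eq_vecI) (simp_all add: mat_vec_simps algebra_simps del: index_mult_mat_vec)
      then show ?thesis using D(1) R2(1) by simp
    qed
    show "(\<A> * \<A>) *\<^sub>v y + \<gamma> \<cdot>\<^sub>v (U' *\<^sub>v b') = ?H *\<^sub>v x + ?F *\<^sub>v y"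
    proof -
      have "(\<A> * \<A>) *\<^sub>v y + \<gamma> \<cdot>\<^sub>v (U' *\<^sub>v b') = \<A> *\<^sub>v y1 + \<gamma> \<cdot>\<^sub>v (U *\<^sub>v b1)"
        unfolding b(3) U'[OF b(1,2)] y1_def using k v b
        by (intro eq_vecI) (simp_all add: mat_vec_simps algebra_simps del: index_mult_mat_vec)
      then show ?thesis using D(2) R1(2) by simp
    qed
  next
    fix a' b' assume a': "a' \<in> carrier_vec (q + q)" and b': "b' \<in> carrier_vec (p + p)"
      and A: "a' = ?Z *\<^sub>v b'" and B: "b' = ?Y *\<^sub>v a'"
    obtain a2 a1 where a: "a2 \<in> carrier_vec q" "a1 \<in> carrier_vec q" "a' = a2 @\<^sub>v a1" using split_vec[OF a'] by blast
    obtain b1 b2 where b: "b1 \<in> carrier_vec p" "b2 \<in> carrier_vec p" "b' = b1 @\<^sub>v b2" using split_vec[OF b'] by blast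
    have z: "(0\<^sub>v n :: real vec) \<in> carrier_vec n" "(0\<^sub>v m :: real vec) \<in> carrier_vec m" by auto
    have tz: "transpose_mat V *\<^sub>v 0\<^sub>v m = 0\<^sub>v q" "transpose_mat Q *\<^sub>v 0\<^sub>v n = 0\<^sub>v p" "\<A> *\<^sub>v 0\<^sub>v m = 0\<^sub>v m"
      "\<D> *\<^sub>v 0\<^sub>v n = 0\<^sub>v n" "E *\<^sub>v 0\<^sub>v n = 0\<^sub>v n" "F *\<^sub>v 0\<^sub>v m = 0\<^sub>v m" "G *\<^sub>v 0\<^sub>v m = 0\<^sub>v n" "H *\<^sub>v 0\<^sub>v n = 0\<^sub>v m"
      using k c by (simp_all add: mat_vec_simps)
    have app: "(0\<^sub>v l :: real vec) @\<^sub>v 0\<^sub>v l = 0\<^sub>v (l + l)" for l by (intro eq_vecI) auto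
    have A0: "a2 @\<^sub>v a1 = ?Z *\<^sub>v (b1 @\<^sub>v b2) + transpose_mat V' *\<^sub>v 0\<^sub>v m"
      unfolding V'[OF z(2)] tz app using A a b a' by (metis right_zero_vec)
    have B0: "b1 @\<^sub>v b2 = ?Y *\<^sub>v (a2 @\<^sub>v a1) + transpose_mat Q' *\<^sub>v 0\<^sub>v n"
      unfolding Q'[OF z(1)] tz app using B a b b' by (metis right_zero_vec)
    define y1 where "y1 = \<A> *\<^sub>v 0\<^sub>v m + \<gamma> \<cdot>\<^sub>v (U *\<^sub>v b2)"
    define x1 where "x1 = \<D> *\<^sub>v 0\<^sub>v n + \<gamma> \<cdot>\<^sub>v (W *\<^sub>v a1)"
    have xy: "x1 \<in> carrier_vec n" "y1 \<in> carrier_vec m" unfolding x1_def y1_def using k by auto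
    note L = links[OF z a(2,1) b(1,2) A0 B0, folded x1_def y1_def]
    note R1 = realizes_response[OF r z(1) xy(2) a(2) b(1) L(2,3), folded x1_def]
    note R2 = realizes_response[OF r xy(1) z(2) a(1) b(2) L(1,4), folded y1_def]
    have "x1 = 0\<^sub>v n"
      using doubling_composition(3)[OF c inv z R1(1) R2(2)] minv_inverse(1)[OF one_minus_prod_carrier[OF c(2,3)] inv]
      by (simp add: tz mat_vec_simps)
    moreover from this have "y1 = 0\<^sub>v m" using R2(2) by (simp add: tz)
    ultimately have L': "a1 = Z *\<^sub>v b1" "b1 = Y *\<^sub>v a1" "a2 = Z *\<^sub>v b2" "b2 = Y *\<^sub>v a2"
      using L right_zero_vec[OF mat_vec_carrier[OF k(8)]] right_zero_vec[OF mat_vec_carrier[OF k(7)]]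
      by (simp_all add: tz)
    show "a' = 0\<^sub>v (q + q)" "b' = 0\<^sub>v (p + p)"
      using realizes_unforced[OF r a(2) b(1) L'(1,2)] realizes_unforced[OF r a(1) b(2) L'(3,4)] a(3) b(3) app
      by simp_all
  qed
qed

section \<open>Positivity of the initial two-port\<close>

text \<open>The matrix \<open>I + W diag(\<delta>)\<close>. Both matrices of the initial step have this form.\<close>

definition col_scaled :: "nat \<Rightarrow> real mat \<Rightarrow> (nat \<Rightarrow> real) \<Rightarrow> real mat" where
  "col_scaled k W \<delta> = mat k k (\<lambda>(i, j). (if i = j then 1 else 0) + W $$ (i, j) * \<delta> j)"

lemma col_scaled_carrier [simp]: "col_scaled k W \<delta> \<in> carrier_mat k k"
  by (simp add: col_scaled_def)

lemma dim_col_scaled [simp]: "dim_row (col_scaled k W \<delta>) = k" "dim_col (col_scaled k W \<delta>) = k"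
  by (simp_all add: col_scaled_def)

lemma col_scaled_action:
  assumes "W \<in> carrier_mat k k" "x \<in> carrier_vec k" "i < k"
  shows "(col_scaled k W \<delta> *\<^sub>v x) $ i = x $ i + (W *\<^sub>v vec k (\<lambda>j. \<delta> j * x $ j)) $ i"
proof -
  have "(col_scaled k W \<delta> *\<^sub>v x) $ i = (\<Sum>j<k. col_scaled k W \<delta> $$ (i, j) * x $ j)"
    using assms by (simp add: mat_vec_index del: index_mult_mat_vec)
  also have "\<dots> = (\<Sum>j<k. (if i = j then x $ j else 0) + W $$ (i, j) * (\<delta> j * x $ j))"
    using assms by (intro sum.cong) (auto simp: col_scaled_def algebra_simps)
  also have "\<dots> = x $ i + (\<Sum>j<k. W $$ (i, j) * (\<delta> j * x $ j))"
    using assms by (simp add: sum.distrib)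
  finally show ?thesis using assms by (simp add: mat_vec_index del: index_mult_mat_vec)
qed

text \<open>Some \<open>\<delta>\<^sub>i\<close> may vanish, and \<open>v\<close> need not be a witness for \<open>I + W \<Delta>\<close> itself. It is one for \<open>I + \<Delta> W\<close>, and
the two are related by \<open>(I + \<Delta> W) \<Delta> = \<Delta> (I + W \<Delta>)\<close>. So \<open>(I + W \<Delta>) x \<ge> 0\<close> implies that \<open>y = \<Delta> x\<close> is
nonnegative. This settles the components with \<open>\<delta>\<^sub>i > 0\<close>; where \<open>\<delta>\<^sub>i = 0\<close>, also \<open>y\<^sub>i = 0\<close> and
\<open>x\<^sub>i \<ge> - (W y)\<^sub>i \<ge> 0\<close> by the Z-property.\<close>

lemma col_scaled_monotone:
  assumes Z: "Z_matrix k W" and v: "v \<in> carrier_vec k" "pos_vec v" and Wv: "0\<^sub>v k \<le> W *\<^sub>v v"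
    and d: "\<And>i. i < k \<Longrightarrow> 0 \<le> \<delta> i"
  shows "monotone_mat k (col_scaled k W \<delta>)"
proof -
  note W = Z_matrixD(2)[OF Z]
  define X where "X = mat k k (\<lambda>(i, j). (if i = j then 1 else 0) + \<delta> i * W $$ (i, j))"
  have Xc: "X \<in> carrier_mat k k" by (simp add: X_def)
  have X: "(X *\<^sub>v x) $ i = x $ i + \<delta> i * (W *\<^sub>v x) $ i" if "x \<in> carrier_vec k" "i < k" for x i
  proof -
    have "(X *\<^sub>v x) $ i = (\<Sum>j<k. X $$ (i, j) * x $ j)"
      using that Xc by (simp add: mat_vec_index del: index_mult_mat_vec)
    also have "\<dots> = (\<Sum>j<k. (if i = j then x $ j else 0) + \<delta> i * (W $$ (i, j) * x $ j))"
      using that by (intro sum.cong) (auto simp: X_def algebra_simps)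
    also have "\<dots> = x $ i + \<delta> i * (\<Sum>j<k. W $$ (i, j) * x $ j)"
      using that by (simp add: sum.distrib sum_distrib_left)
    finally show ?thesis using that W by (simp add: mat_vec_index del: index_mult_mat_vec)
  qed
  have "Z_matrix k X" unfolding Z_matrix_def
  proof (intro conjI allI impI Xc)
    fix y :: "real vec" and i assume y: "0\<^sub>v k \<le> y" "i < k" "y $ i = 0"
    show "(X *\<^sub>v y) $ i \<le> 0"
      using X[OF nonneg_vec_carrier[OF y(1)] y(2)] Z_matrixD(1)[OF Z y] d[OF y(2)] y(3)
      by (simp add: mult_nonneg_nonpos del: index_mult_mat_vec)
  qed
  moreover have "pos_vec (X *\<^sub>v v)"
    using X[OF v(1)] v d nonneg_vecD[OF Wv] Xc
    by (auto simp: pos_vec_def intro!: add_pos_nonneg mult_nonneg_nonneg simp del: index_mult_mat_vec)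
  ultimately have mono: "monotone_mat k X" by (rule Z_matrix_monotone[OF _ v])
  show ?thesis unfolding monotone_mat_def
  proof (intro ballI impI)
    fix x :: "real vec" assume x: "x \<in> carrier_vec k" and Px: "0\<^sub>v k \<le> col_scaled k W \<delta> *\<^sub>v x"
    define y where "y = vec k (\<lambda>j. \<delta> j * x $ j)"
    have y: "y \<in> carrier_vec k" by (simp add: y_def)
    have P: "(col_scaled k W \<delta> *\<^sub>v x) $ i = x $ i + (W *\<^sub>v y) $ i" if "i < k" for i
      unfolding y_def by (rule col_scaled_action[OF W x that])
    have P0: "0 \<le> x $ i + (W *\<^sub>v y) $ i" if "i < k" for i
      using nonneg_vecD[OF Px that] P[OF that] by simp
    have "(X *\<^sub>v y) $ i = \<delta> i * (x $ i + (W *\<^sub>v y) $ i)" if "i < k" for i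
      using X[OF y that] that by (simp add: y_def algebra_simps del: index_mult_mat_vec)
    then have image: "0\<^sub>v k \<le> X *\<^sub>v y"
      using P0 d Xc unfolding nonneg_vec_iff by (auto simp del: index_mult_mat_vec)
    have yn: "0\<^sub>v k \<le> y" by (rule monotone_matD[OF mono y image])
    have "0 \<le> x $ i" if i: "i < k" for i
    proof (cases "\<delta> i = 0")
      case True
      then have "y $ i = 0" using i by (simp add: y_def)
      then show ?thesis using Z_matrixD(1)[OF Z yn i] P0[OF i] by linarith
    next
      case False
      then have "0 < \<delta> i" using d[OF i] by simp
      moreover have "0 \<le> \<delta> i * x $ i" using nonneg_vecD[OF yn i] i by (simp add: y_def)
      ultimately show ?thesis by (simp add: zero_le_mult_iff)
    qed
    then show "0\<^sub>v k \<le> x" using x by (simp add: nonneg_vec_iff)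
  qed
qed

text \<open>The bounds on the diagonal and the Z-property make the right factor \<open>I - W \<Delta>'\<close> nonnegative, which gives nonnegativity of \<open>M\<close>. The
other two claims follow from \<open>(I + W \<Delta>) (v - M v) = \<gamma> W v\<close>, where \<open>\<Delta> + \<Delta>' = \<gamma> I\<close>.\<close>

lemma cayley_transform_bounds:
  assumes Z: "Z_matrix k W" and v: "v \<in> carrier_vec k" "pos_vec v" and Wv: "0\<^sub>v k \<le> W *\<^sub>v v"
    and d: "\<And>i. i < k \<Longrightarrow> 0 \<le> \<delta> i" "\<And>i. i < k \<Longrightarrow> 0 \<le> \<delta>' i" "\<And>i. i < k \<Longrightarrow> \<delta> i + \<delta>' i = \<gamma>"
    and diag: "\<And>i. i < k \<Longrightarrow> \<delta>' i * W $$ (i, i) \<le> 1" and gam: "0 < \<gamma>"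
    and M: "M \<in> carrier_mat k k" "col_scaled k W \<delta> * M = col_scaled k W (\<lambda>i. - \<delta>' i)"
  shows "0\<^sub>v k \<le> x \<Longrightarrow> 0\<^sub>v k \<le> M *\<^sub>v x"
    and "M *\<^sub>v v \<le> v"
    and "pos_vec (W *\<^sub>v v) \<Longrightarrow> i < k \<Longrightarrow> (M *\<^sub>v v) $ i < v $ i"
proof -
  note W = Z_matrixD(2)[OF Z]
  have mono: "monotone_mat k (col_scaled k W \<delta>)"
    by (rule col_scaled_monotone[OF Z v Wv]) (rule d(1))
  let ?P = "col_scaled k W \<delta>" and ?R = "col_scaled k W (\<lambda>i. - \<delta>' i)"
  have PM: "?P *\<^sub>v (M *\<^sub>v x) = ?R *\<^sub>v x" if "x \<in> carrier_vec k" for x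
    unfolding M(2)[symmetric] using that M(1) by (simp add: mat_vec_simps)
  show "0\<^sub>v k \<le> M *\<^sub>v x" if x: "0\<^sub>v k \<le> x" for x
  proof (rule monotone_matD[OF mono mat_vec_carrier[OF M(1)]])
    have "0 \<le> ?R $$ (i, j)" if "i < k" "j < k" for i j
      using that d(2)[of j] diag[of i] Z_matrix_offdiag[OF Z that]
      by (cases "i = j") (auto simp: col_scaled_def mult.commute mult_nonneg_nonpos)
    then have "0\<^sub>m k k \<le> ?R" by (auto simp: less_eq_mat_def)
    then show "0\<^sub>v k \<le> ?P *\<^sub>v (M *\<^sub>v x)"
      unfolding PM[OF nonneg_vec_carrier[OF x]] by (rule nonneg_mat_vec[OF _ x])
  qed
  define u where "u = v - M *\<^sub>v v"
  have u: "u \<in> carrier_vec k" unfolding u_def using M v by simp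
  have Pu: "(?P *\<^sub>v u) $ i = \<gamma> * (W *\<^sub>v v) $ i" if i: "i < k" for i
  proof -
    have "(?P *\<^sub>v u) $ i = (?P *\<^sub>v v) $ i - (?R *\<^sub>v v) $ i"
      unfolding u_def PM[OF v(1), symmetric] using M v i by (simp add: mat_vec_simps del: index_mult_mat_vec)
    also have "\<dots> = (W *\<^sub>v vec k (\<lambda>j. \<delta> j * v $ j)) $ i - (W *\<^sub>v vec k (\<lambda>j. - \<delta>' j * v $ j)) $ i"
      by (simp add: col_scaled_action[OF W v(1) i])
    also have "\<dots> = (\<Sum>j<k. W $$ (i, j) * ((\<delta> j + \<delta>' j) * v $ j))"
      using W i by (simp add: mat_vec_index sum_subtractf[symmetric] algebra_simps del: index_mult_mat_vec)
    also have "\<dots> = (\<Sum>j<k. \<gamma> * (W $$ (i, j) * v $ j))"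
      by (rule sum.cong) (auto simp: d(3))
    also have "\<dots> = \<gamma> * (W *\<^sub>v v) $ i"
      using W i v by (simp add: mat_vec_index sum_distrib_left del: index_mult_mat_vec)
    finally show ?thesis .
  qed
  have un: "0\<^sub>v k \<le> u"
    by (rule monotone_matD[OF mono u])
      (use Pu nonneg_vecD[OF Wv] gam in \<open>simp add: nonneg_vec_iff del: index_mult_mat_vec\<close>)
  then show "M *\<^sub>v v \<le> v" unfolding u_def using nonneg_diff_iff[OF mat_vec_carrier[OF M(1)] v(1)] by simp
  show "(M *\<^sub>v v) $ i < v $ i" if pos: "pos_vec (W *\<^sub>v v)" and i: "i < k" for i
  proof (rule ccontr)
    assume "\<not> (M *\<^sub>v v) $ i < v $ i"
    then have ui: "u $ i = 0" using nonneg_vecD[OF un i] i v M by (simp add: u_def del: index_mult_mat_vec)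
    have "0\<^sub>v k \<le> vec k (\<lambda>j. \<delta> j * u $ j)" using nonneg_vecD[OF un] d(1) by (simp add: nonneg_vec_iff)
    from Z_matrixD(1)[OF Z this i] have "(W *\<^sub>v vec k (\<lambda>j. \<delta> j * u $ j)) $ i \<le> 0" using ui i by simp
    then have "(?P *\<^sub>v u) $ i \<le> 0" using col_scaled_action[OF W u i, of \<delta>] ui by simp
    moreover have "0 < \<gamma> * (W *\<^sub>v v) $ i" using pos i W gam by (simp add: pos_vec_def del: index_mult_mat_vec)
    ultimately show False using Pu[OF i] by simp
  qed
qed

text \<open>For the two-port this says \<open>E a > 0\<close>. Put \<open>u = (a, 0)\<close> and \<open>h = M u \<ge> 0\<close>, and suppose \<open>h\<^sub>i = 0\<close>. The defining system
reads \<open>W y = u - h\<close> with \<open>y = \<Delta> h + \<Delta>' u \<ge> 0\<close>, so \<open>(W y)\<^sub>i = v\<^sub>i > 0\<close> while \<open>y\<^sub>i = \<beta> v\<^sub>i\<close>. If \<open>\<beta> = 0\<close>,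
this contradicts the Z-property. Otherwise \<open>y\<close> is positive on the first block, its zeros lie where \<open>W y = 0\<close>, and irreducibility
makes \<open>y\<close> positive. Now replace component \<open>i\<close> of \<open>y\<close> by \<open>0\<close>: since \<open>\<beta> W\<^sub>i\<^sub>i \<le> 1\<close>, the new vector
\<open>w\<close> still has \<open>(W w)\<^sub>i \<ge> 0\<close>. Irreducibility then makes \<open>w\<close> positive, contradicting \<open>w\<^sub>i = 0\<close>.\<close>

lemma irreducible_cayley_transform_pos:
  assumes irr: "irreducible_mat W" and Z: "Z_matrix k W"
    and v: "v \<in> carrier_vec k" "pos_vec v" and Wv: "0\<^sub>v k \<le> W *\<^sub>v v"
    and ab: "0 \<le> \<alpha>" "0 \<le> \<beta>" "0 < \<alpha> + \<beta>" and n: "n < k"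
    and diag: "\<And>i. i < k \<Longrightarrow> (if i < n then \<beta> else \<alpha>) * W $$ (i, i) \<le> 1"
    and M: "M \<in> carrier_mat k k"
      "col_scaled k W (\<lambda>i. if i < n then \<alpha> else \<beta>) * M = col_scaled k W (\<lambda>i. - (if i < n then \<beta> else \<alpha>))"
    and i: "i < n"
  shows "0 < (M *\<^sub>v vec k (\<lambda>j. if j < n then v $ j else 0)) $ i"
proof (rule ccontr)
  let ?\<delta> = "\<lambda>i. if i < n then \<alpha> else \<beta>" and ?\<delta>' = "\<lambda>i. if i < n then \<beta> else \<alpha>"
  note W = Z_matrixD(2)[OF Z]
  define u where "u = vec k (\<lambda>j. if j < n then v $ j else 0)"
  define h where "h = M *\<^sub>v u"
  have vp: "0 < v $ j" if "j < k" for j using v that by (auto simp: pos_vec_def)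
  have u: "u \<in> carrier_vec k" "0\<^sub>v k \<le> u" using vp by (auto simp: u_def nonneg_vec_iff less_imp_le)
  have h: "0\<^sub>v k \<le> h" unfolding h_def
    by (rule cayley_transform_bounds(1)[OF Z v Wv _ _ _ diag ab(3) M u(2)]) (use ab in auto)
  note hc = nonneg_vec_carrier[OF h]
  assume "\<not> 0 < (M *\<^sub>v vec k (\<lambda>j. if j < n then v $ j else 0)) $ i"
  then have hi: "h $ i = 0" using nonneg_vecD[OF h, of i] i n by (simp add: h_def u_def)
  have ik: "i < k" using i n by simp
  define y where "y = vec k (\<lambda>j. ?\<delta> j * h $ j + ?\<delta>' j * u $ j)"
  have y: "y \<in> carrier_vec k" "0\<^sub>v k \<le> y"
    using nonneg_vecD[OF h] nonneg_vecD[OF u(2)] ab by (auto simp: y_def nonneg_vec_iff)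
  have Wy: "(W *\<^sub>v y) $ l = u $ l - h $ l" if l: "l < k" for l
  proof -
    have "col_scaled k W ?\<delta> *\<^sub>v h = col_scaled k W (\<lambda>i. - ?\<delta>' i) *\<^sub>v u"
      unfolding h_def M(2)[symmetric] using u M(1) by (simp add: mat_vec_simps)
    then have "h $ l + (W *\<^sub>v vec k (\<lambda>j. ?\<delta> j * h $ j)) $ l = u $ l + (W *\<^sub>v vec k (\<lambda>j. - ?\<delta>' j * u $ j)) $ l"
      by (simp only: col_scaled_action[OF W hc l, symmetric] col_scaled_action[OF W u(1) l, symmetric])
    moreover have "(W *\<^sub>v y) $ l = (W *\<^sub>v vec k (\<lambda>j. ?\<delta> j * h $ j)) $ l - (W *\<^sub>v vec k (\<lambda>j. - ?\<delta>' j * u $ j)) $ l"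
      using W l by (simp add: y_def mat_vec_index sum_subtractf[symmetric] algebra_simps del: index_mult_mat_vec)
    ultimately show ?thesis by linarith
  qed
  have yi: "y $ i = \<beta> * v $ i" using hi i ik by (simp add: y_def u_def)
  have Wyi: "(W *\<^sub>v y) $ i = v $ i" using Wy[OF ik] hi i ik by (simp add: u_def)
  have b: "0 < \<beta>"
  proof (rule ccontr)
    assume "\<not> 0 < \<beta>"
    then have "y $ i = 0" using ab yi by simp
    from Z_matrixD(1)[OF Z y(2) ik this] show False using Wyi vp[OF ik] by simp
  qed
  have yfst: "0 < y $ l" if "l < n" for l
    using that n nonneg_vecD[OF h, of l] vp[of l] ab b by (simp add: y_def u_def add_nonneg_pos)
  have "pos_vec y"
  proof (rule irreducible_Z_matrix_pos_vec[OF irr Z y(2)])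
    show "y \<noteq> 0\<^sub>v k" using yfst[OF i] ik by auto
    fix l assume l: "l < k" "y $ l = 0"
    then have "\<not> l < n" using yfst[of l] by auto
    then have "h $ l = 0" "u $ l = 0" using l b by (auto simp: y_def u_def)
    then show "0 \<le> (W *\<^sub>v y) $ l" using Wy[OF l(1)] by simp
  qed
  then have ypos: "0 < y $ l" if "l < k" for l using that y by (auto simp: pos_vec_def)
  define w where "w = vec k (\<lambda>j. if j = i then 0 else y $ j)"
  have "pos_vec w"
  proof (rule irreducible_Z_matrix_pos_vec[OF irr Z])
    show "0\<^sub>v k \<le> w" using ypos by (auto simp: w_def nonneg_vec_iff less_imp_le)
    show "w \<noteq> 0\<^sub>v k"
    proof
      assume "w = 0\<^sub>v k"
      then have "w $ n = 0" using n by simp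
      then show False using n i ypos[OF n] by (simp add: w_def)
    qed
    fix l assume l: "l < k" "w $ l = 0"
    then have "l = i" using ypos[of l] by (auto simp: w_def split: if_splits)
    have "(W *\<^sub>v w) $ i = (\<Sum>j<k. W $$ (i, j) * y $ j - (if j = i then W $$ (i, i) * y $ i else 0))"
      using ik W by (simp add: mat_vec_index w_def del: index_mult_mat_vec) (auto intro!: sum.cong)
    also have "\<dots> = (W *\<^sub>v y) $ i - W $$ (i, i) * y $ i"
      using ik W y by (simp add: mat_vec_index sum_subtractf del: index_mult_mat_vec)
    also have "\<dots> = (1 - \<beta> * W $$ (i, i)) * v $ i" unfolding Wyi yi by (simp add: algebra_simps)
    also have "0 \<le> \<dots>" using diag[OF ik] i vp[OF ik] by simp
    finally show "0 \<le> (W *\<^sub>v w) $ l" using \<open>l = i\<close> by simp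
  qed
  then show False using ik by (auto simp: pos_vec_def w_def)
qed

text \<open>The alternative between \<open>W v > 0\<close> and irreducibility is what yields the strict bound \<open>G b < a\<close>. If \<open>W v > 0\<close>, then \<open>E a + G b < a\<close>; if \<open>W\<close> is
irreducible, then \<open>E a + G b \<le> a\<close> and \<open>E a > 0\<close>.\<close>

lemma initial_dissipative:
  fixes W :: "real mat"
  assumes Z: "Z_matrix (n + m) W" and a: "a \<in> carrier_vec n" and b: "b \<in> carrier_vec m"
    and pos: "pos_vec (a @\<^sub>v b)" and Wv: "0\<^sub>v (n + m) \<le> W *\<^sub>v (a @\<^sub>v b)"
    and strict: "pos_vec (W *\<^sub>v (a @\<^sub>v b)) \<or> irreducible_mat W" and m: "0 < m"
    and ab: "0 \<le> \<alpha>" "0 \<le> \<beta>" "0 < \<alpha> + \<beta>"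
    and diag: "\<And>i. i < n + m \<Longrightarrow> (if i < n then \<beta> else \<alpha>) * W $$ (i, i) \<le> 1"
    and c: "E \<in> carrier_mat n n" "G \<in> carrier_mat n m" "H \<in> carrier_mat m n" "F \<in> carrier_mat m m"
    and M: "col_scaled (n + m) W (\<lambda>i. if i < n then \<alpha> else \<beta>) * four_block_mat E G H F =
      col_scaled (n + m) W (\<lambda>i. - (if i < n then \<beta> else \<alpha>))"
  shows "dissipative a b E G H F"
proof -
  note act = four_block_mat_mult_vec[OF c]
  have v: "a @\<^sub>v b \<in> carrier_vec (n + m)" using a b by simp
  have Mc: "four_block_mat E G H F \<in> carrier_mat (n + m) (n + m)" using c by simp
  note bounds = cayley_transform_bounds[OF Z v pos Wv _ _ _ diag ab(3) Mc M]
  have nn: "0\<^sub>v (n + m) \<le> four_block_mat E G H F *\<^sub>v x" if "0\<^sub>v (n + m) \<le> x" for x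
    by (rule bounds(1)[OF _ _ _ _ that]) (use ab in auto)
  have ablk: "0\<^sub>v n \<le> E *\<^sub>v x + G *\<^sub>v y \<and> 0\<^sub>v m \<le> H *\<^sub>v x + F *\<^sub>v y" if "0\<^sub>v n \<le> x" "0\<^sub>v m \<le> y" for x y
  proof -
    note cc = nonneg_vec_carrier[OF that(1)] nonneg_vec_carrier[OF that(2)]
    have "0\<^sub>v (n + m) \<le> (E *\<^sub>v x + G *\<^sub>v y) @\<^sub>v (H *\<^sub>v x + F *\<^sub>v y)"
      unfolding act[OF cc, symmetric] using nonneg_append_iff[OF cc] that nn by simp
    then show ?thesis by (subst (asm) nonneg_append_iff) (use c in auto)
  qed
  have Mv: "four_block_mat E G H F *\<^sub>v (a @\<^sub>v b) \<le> a @\<^sub>v b"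
    by (rule bounds(2)) (use ab in auto)
  note Mv = Mv[unfolded act[OF a b]]
  have E1: "(E *\<^sub>v a) $ i + (G *\<^sub>v b) $ i \<le> a $ i" if "i < n" for i
    using le_vecD[OF Mv, of i] that a b c by (simp del: index_mult_mat_vec)
  have H1: "(H *\<^sub>v a) $ i + (F *\<^sub>v b) $ i \<le> b $ i" if "i < m" for i
    using le_vecD[OF Mv, of "n + i"] that a b c by (simp del: index_mult_mat_vec)
  have ap: "0 < a $ i" if "i < n" for i
    using pos a b that unfolding pos_vec_def by (auto dest: spec[of _ i])
  have bp: "0 < b $ i" if "i < m" for i
    using pos a b that unfolding pos_vec_def by (auto dest: spec[of _ "n + i"])
  have an: "0\<^sub>v n \<le> a" "0\<^sub>v m \<le> (0\<^sub>v m :: real vec)" using ap a by (auto simp: nonneg_vec_iff less_imp_le)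
  have z0: "G *\<^sub>v 0\<^sub>v m = 0\<^sub>v n" "F *\<^sub>v 0\<^sub>v m = 0\<^sub>v m" using c by (simp_all add: mat_vec_simps)
  have En: "0 \<le> (E *\<^sub>v a) $ i" if "i < n" for i
    using nonneg_vecD[OF conjunct1[OF ablk[OF an]] that] that c by (simp add: z0 del: index_mult_mat_vec)
  have "(G *\<^sub>v b) $ i < a $ i" if i: "i < n" for i
    using strict
  proof
    assume "pos_vec (W *\<^sub>v (a @\<^sub>v b))"
    then have "(four_block_mat E G H F *\<^sub>v (a @\<^sub>v b)) $ i < (a @\<^sub>v b) $ i"
      by (intro bounds(3)) (use ab i in auto)
    then have "(E *\<^sub>v a) $ i + (G *\<^sub>v b) $ i < a $ i"
      unfolding act[OF a b] using i a b c by (simp del: index_mult_mat_vec)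
    then show ?thesis using En[OF i] by linarith
  next
    assume irr: "irreducible_mat W"
    have eq: "vec (n + m) (\<lambda>j. if j < n then (a @\<^sub>v b) $ j else 0) = a @\<^sub>v 0\<^sub>v m"
      using a b by (intro eq_vecI) auto
    have "0 < (four_block_mat E G H F *\<^sub>v (a @\<^sub>v 0\<^sub>v m)) $ i"
      unfolding eq[symmetric]
      by (rule irreducible_cayley_transform_pos[OF irr Z v pos Wv ab _ diag Mc M i]) (use m in auto)
    then have "0 < (E *\<^sub>v a) $ i"
      unfolding act[OF a zero_carrier_vec] z0 using i a c by (simp del: index_mult_mat_vec)
    then show ?thesis using E1[OF i] by linarith
  qed
  from uniform_strict_bound[OF a _ _ this]
  have "\<exists>\<theta>. 0 \<le> \<theta> \<and> \<theta> < 1 \<and> G *\<^sub>v b \<le> \<theta> \<cdot>\<^sub>v a"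
    using ap a c by (auto simp: pos_vec_def)
  moreover have "E *\<^sub>v a + G *\<^sub>v b \<le> a" "H *\<^sub>v a + F *\<^sub>v b \<le> b"
    using E1 H1 a b c by (auto simp: le_vec_iff simp del: index_mult_mat_vec)
  ultimately show ?thesis
    unfolding dissipative_def carrier_vecD[OF a] carrier_vecD[OF b] using ablk by blast
qed

section \<open>Realization of the initial two-port\<close>

lemma shift_mat_carrier [simp]: "M \<in> carrier_mat k k \<Longrightarrow> shift_mat t M \<in> carrier_mat k k"
  by (simp add: shift_mat_def)

lemma dim_shift_mat [simp]: "dim_row (shift_mat t M) = dim_row M" "dim_col (shift_mat t M) = dim_row M"
  by (simp_all add: shift_mat_def)

lemma shift_mat_action:
  "M \<in> carrier_mat k k \<Longrightarrow> x \<in> carrier_vec k \<Longrightarrow> shift_mat t M *\<^sub>v x = t \<cdot>\<^sub>v (M *\<^sub>v x) + x"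
  by (simp add: shift_mat_def mat_vec_simps)

lemma shift_mat_col_scaled:
  "M \<in> carrier_mat k k \<Longrightarrow> shift_mat t M = col_scaled k M (\<lambda>_. t)"
  by (auto intro!: eq_matI simp: col_scaled_def shift_mat_def)

lemma initial_matrices_col_scaled:
  assumes A: "A \<in> carrier_mat m m" and B: "B \<in> carrier_mat m n"
    and C: "C \<in> carrier_mat n m" and D: "D \<in> carrier_mat n n"
  defines "W \<equiv> four_block_mat D (- C) (- B) A"
  shows "four_block_mat (shift_mat \<alpha> D) (- (\<beta> \<cdot>\<^sub>m C)) (- (\<alpha> \<cdot>\<^sub>m B)) (shift_mat \<beta> A) =
      col_scaled (n + m) W (\<lambda>i. if i < n then \<alpha> else \<beta>)"
    and "four_block_mat (shift_mat (- \<beta>) D) (\<alpha> \<cdot>\<^sub>m C) (\<beta> \<cdot>\<^sub>m B) (shift_mat (- \<alpha>) A) =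
      col_scaled (n + m) W (\<lambda>i. - (if i < n then \<beta> else \<alpha>))"
  using A B C D unfolding W_def
  by (auto intro!: eq_matI simp: col_scaled_def shift_mat_def)

text \<open>For \<open>f i = 0\<close> the inverse is \<open>0\<close> and for negative \<open>f i\<close> it is negative; the product bound holds there as well.\<close>

lemma le_Min_inverse:
  fixes f :: "nat \<Rightarrow> real"
  assumes t: "0 \<le> t" "t \<le> Min ((\<lambda>i. inverse (f i)) ` {..<k})" and i: "i < k"
  shows "t * f i \<le> 1"
proof (cases "0 < f i")
  case True
  have "t \<le> inverse (f i)" using t(2) i by (metis (no_types, lifting) Min_le finite_imageI finite_lessThan imageI lessThan_iff order_trans)
  then show ?thesis using True by (simp add: field_simps)
next
  case False
  then have "t * f i \<le> 0" using t(1) by (simp add: mult_nonneg_nonpos)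
  then show ?thesis by simp
qed

text \<open>One direction of the initial loop. The first conclusion rests on
\<open>(\<alpha> + \<beta>) A\<^sub>\<beta>\<^sup>-\<^sup>1 = \<beta> A\<^sub>\<beta>\<^sup>-\<^sup>1 A\<^sub>-\<^sub>\<alpha> + \<alpha> I\<close>, a consequence of \<open>\<beta> A\<^sub>-\<^sub>\<alpha> + \<alpha> A\<^sub>\<beta> = (\<alpha> + \<beta>) I\<close>. It recovers the internal
signal from input \<open>y\<close> and output \<open>z\<close> alone, so that the second conclusion, once \<open>b\<close> is recovered in the same way from the
opposite direction, becomes one row of the initial linear system.\<close>

lemma cayley_feedback:
  fixes A L R :: "real mat"
  assumes A: "A \<in> carrier_mat m m" and inv: "invertible_mat (shift_mat \<beta> A)"
    and L: "L \<in> carrier_mat m p" and R: "R \<in> carrier_mat m q"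
    and y: "y \<in> carrier_vec m" and b: "b \<in> carrier_vec p"
  defines "N \<equiv> minv (shift_mat \<beta> A)"
  assumes a: "a = (\<beta> \<cdot>\<^sub>m (transpose_mat R * N * L)) *\<^sub>v b + transpose_mat (transpose_mat N * R) *\<^sub>v y"
    and out: "z = (N * shift_mat (- \<alpha>) A) *\<^sub>v y + (\<alpha> + \<beta>) \<cdot>\<^sub>v ((N * L) *\<^sub>v b)"
  shows "(\<alpha> + \<beta>) \<cdot>\<^sub>v a = transpose_mat R *\<^sub>v (\<beta> \<cdot>\<^sub>v z + \<alpha> \<cdot>\<^sub>v y)"
    and "shift_mat \<beta> A *\<^sub>v z = shift_mat (- \<alpha>) A *\<^sub>v y + (\<alpha> + \<beta>) \<cdot>\<^sub>v (L *\<^sub>v b)"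
proof -
  have S: "shift_mat \<beta> A \<in> carrier_mat m m" using A by simp
  note Nc = minv_inverse(1)[OF S inv, folded N_def]
  note canc = minv_cancel[OF S inv, folded N_def]
  have tr: "transpose_mat (transpose_mat N * R) = transpose_mat R * N"
    using Nc R by (simp add: transpose_mult[of _ m m])
  show "shift_mat \<beta> A *\<^sub>v z = shift_mat (- \<alpha>) A *\<^sub>v y + (\<alpha> + \<beta>) \<cdot>\<^sub>v (L *\<^sub>v b)"
    unfolding out using Nc S A L y b canc(2)[of "shift_mat (- \<alpha>) A *\<^sub>v y"] canc(2)[of "L *\<^sub>v b"]
      carrier_matD[OF A] mat_vec_carrier[OF shift_mat_carrier[OF A]] mat_vec_carrier[OF L]
    by (simp add: mat_vec_simps)
  have key: "(\<alpha> + \<beta>) \<cdot>\<^sub>v (N *\<^sub>v y) = \<beta> \<cdot>\<^sub>v (N *\<^sub>v (shift_mat (- \<alpha>) A *\<^sub>v y)) + \<alpha> \<cdot>\<^sub>v y"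
  proof -
    have "N *\<^sub>v (\<beta> \<cdot>\<^sub>v (shift_mat (- \<alpha>) A *\<^sub>v y) + \<alpha> \<cdot>\<^sub>v (shift_mat \<beta> A *\<^sub>v y)) = N *\<^sub>v ((\<alpha> + \<beta>) \<cdot>\<^sub>v y)"
      using A y by (intro arg_cong[of _ _ "\<lambda>u. N *\<^sub>v u"] eq_vecI)
        (simp_all add: shift_mat_action[OF A y] algebra_simps del: index_mult_mat_vec)
    moreover have "N *\<^sub>v (\<beta> \<cdot>\<^sub>v (shift_mat (- \<alpha>) A *\<^sub>v y) + \<alpha> \<cdot>\<^sub>v (shift_mat \<beta> A *\<^sub>v y)) =
      \<beta> \<cdot>\<^sub>v (N *\<^sub>v (shift_mat (- \<alpha>) A *\<^sub>v y)) + \<alpha> \<cdot>\<^sub>v y"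
      using Nc A S y canc(1)[OF y] carrier_matD(1)[OF shift_mat_carrier[OF A]] by (simp add: mat_vec_simps)
    moreover have "N *\<^sub>v ((\<alpha> + \<beta>) \<cdot>\<^sub>v y) = (\<alpha> + \<beta>) \<cdot>\<^sub>v (N *\<^sub>v y)" using Nc y by (simp add: mat_vec_simps)
    ultimately show ?thesis by simp
  qed
  have "\<beta> \<cdot>\<^sub>v z + \<alpha> \<cdot>\<^sub>v y = (\<alpha> + \<beta>) \<cdot>\<^sub>v (\<beta> \<cdot>\<^sub>v (N *\<^sub>v (L *\<^sub>v b)) + N *\<^sub>v y)"
  proof (rule eq_vecI)
    fix i assume "i < dim_vec ((\<alpha> + \<beta>) \<cdot>\<^sub>v (\<beta> \<cdot>\<^sub>v (N *\<^sub>v (L *\<^sub>v b)) + N *\<^sub>v y))"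
    then have i: "i < m" using Nc by simp
    have "(\<alpha> + \<beta>) * (N *\<^sub>v y) $ i = \<beta> * (N *\<^sub>v (shift_mat (- \<alpha>) A *\<^sub>v y)) $ i + \<alpha> * y $ i"
      using arg_cong[OF key, of "\<lambda>u. u $ i"] i Nc y by (simp del: index_mult_mat_vec)
    then show "(\<beta> \<cdot>\<^sub>v z + \<alpha> \<cdot>\<^sub>v y) $ i = ((\<alpha> + \<beta>) \<cdot>\<^sub>v (\<beta> \<cdot>\<^sub>v (N *\<^sub>v (L *\<^sub>v b)) + N *\<^sub>v y)) $ i"
      unfolding out using i Nc A L y b carrier_matD[OF shift_mat_carrier[OF A]]
      by (simp add: mat_vec_simps algebra_simps del: index_mult_mat_vec)
  qed (use Nc y in auto)
  then show "(\<alpha> + \<beta>) \<cdot>\<^sub>v a = transpose_mat R *\<^sub>v (\<beta> \<cdot>\<^sub>v z + \<alpha> \<cdot>\<^sub>v y)"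
    unfolding a tr using Nc L R y b
    by (simp add: mat_vec_simps)
qed

text \<open>By \<open>cayley_feedback\<close> in both directions the outputs of the loop solve the linear system that determines
the outputs of the initial two-port, and the solution is unique. For zero input the outputs therefore vanish, and by the
first conclusion of that lemma the internal signals are then zero too.\<close>

lemma realizes_initial:
  fixes A B C D :: "real mat"
  assumes A: "A \<in> carrier_mat m m" and D: "D \<in> carrier_mat n n"
    and Bl: "Bl \<in> carrier_mat m p" and Br: "Br \<in> carrier_mat n p"
    and Cl: "Cl \<in> carrier_mat n q" and Cr: "Cr \<in> carrier_mat m q"
    and B: "B = Bl * transpose_mat Br" and C: "C = Cl * transpose_mat Cr"
    and gam: "\<alpha> + \<beta> \<noteq> 0"
    and invA: "invertible_mat (shift_mat \<beta> A)" and invD: "invertible_mat (shift_mat \<alpha> D)"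
    and inj: "\<And>x x' y y'. x \<in> carrier_vec n \<Longrightarrow> x' \<in> carrier_vec n \<Longrightarrow> y \<in> carrier_vec m \<Longrightarrow> y' \<in> carrier_vec m \<Longrightarrow>
      shift_mat \<alpha> D *\<^sub>v x - \<beta> \<cdot>\<^sub>v (C *\<^sub>v y) = shift_mat \<alpha> D *\<^sub>v x' - \<beta> \<cdot>\<^sub>v (C *\<^sub>v y') \<Longrightarrow>
      shift_mat \<beta> A *\<^sub>v y - \<alpha> \<cdot>\<^sub>v (B *\<^sub>v x) = shift_mat \<beta> A *\<^sub>v y' - \<alpha> \<cdot>\<^sub>v (B *\<^sub>v x') \<Longrightarrow> x = x' \<and> y = y'"
    and c: "E \<in> carrier_mat n n" "G \<in> carrier_mat n m" "H \<in> carrier_mat m n" "F \<in> carrier_mat m m"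
    and sol: "\<And>x y. x \<in> carrier_vec n \<Longrightarrow> y \<in> carrier_vec m \<Longrightarrow>
      shift_mat \<alpha> D *\<^sub>v (E *\<^sub>v x + G *\<^sub>v y) - \<beta> \<cdot>\<^sub>v (C *\<^sub>v (H *\<^sub>v x + F *\<^sub>v y)) =
        shift_mat (- \<beta>) D *\<^sub>v x + \<alpha> \<cdot>\<^sub>v (C *\<^sub>v y) \<and>
      shift_mat \<beta> A *\<^sub>v (H *\<^sub>v x + F *\<^sub>v y) - \<alpha> \<cdot>\<^sub>v (B *\<^sub>v (E *\<^sub>v x + G *\<^sub>v y)) =
        shift_mat (- \<alpha>) A *\<^sub>v y + \<beta> \<cdot>\<^sub>v (B *\<^sub>v x)"
  shows "realizes n m p q (\<alpha> + \<beta>)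
    (minv (shift_mat \<beta> A) * shift_mat (- \<alpha>) A) (minv (shift_mat \<alpha> D) * shift_mat (- \<beta>) D)
    (minv (shift_mat \<beta> A) * Bl) (transpose_mat (minv (shift_mat \<beta> A)) * Cr)
    (minv (shift_mat \<alpha> D) * Cl) (transpose_mat (minv (shift_mat \<alpha> D)) * Br)
    (\<alpha> \<cdot>\<^sub>m (transpose_mat Br * minv (shift_mat \<alpha> D) * Cl))
    (\<beta> \<cdot>\<^sub>m (transpose_mat Cr * minv (shift_mat \<beta> A) * Bl)) E G H F"
    (is "realizes n m p q _ ?A ?D ?U ?V ?W ?Q ?Y ?Z E G H F")
proof -
  note NA = minv_inverse(1)[OF shift_mat_carrier[OF A] invA]
  note ND = minv_inverse(1)[OF shift_mat_carrier[OF D] invD]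
  have Bc: "B \<in> carrier_mat m n" and Cc: "C \<in> carrier_mat n m" unfolding B C using Bl Br Cl Cr by auto
  have eqs: "(\<alpha> + \<beta>) \<cdot>\<^sub>v a = transpose_mat Cr *\<^sub>v (\<beta> \<cdot>\<^sub>v z + \<alpha> \<cdot>\<^sub>v y)"
      "(\<alpha> + \<beta>) \<cdot>\<^sub>v b = transpose_mat Br *\<^sub>v (\<alpha> \<cdot>\<^sub>v w + \<beta> \<cdot>\<^sub>v x)"
      "w = E *\<^sub>v x + G *\<^sub>v y" "z = H *\<^sub>v x + F *\<^sub>v y"
    if v: "x \<in> carrier_vec n" "y \<in> carrier_vec m" "a \<in> carrier_vec q" "b \<in> carrier_vec p"
      and a: "a = ?Z *\<^sub>v b + transpose_mat ?V *\<^sub>v y" and b: "b = ?Y *\<^sub>v a + transpose_mat ?Q *\<^sub>v x"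
      and w: "w = ?D *\<^sub>v x + (\<alpha> + \<beta>) \<cdot>\<^sub>v (?W *\<^sub>v a)" and z: "z = ?A *\<^sub>v y + (\<alpha> + \<beta>) \<cdot>\<^sub>v (?U *\<^sub>v b)"
    for x y a b w z
  proof -
    note e1 = cayley_feedback[OF A invA Bl Cr v(2,4) a z]
    have w': "w = ?D *\<^sub>v x + (\<beta> + \<alpha>) \<cdot>\<^sub>v (?W *\<^sub>v a)" using w by (simp add: add.commute)
    note e2 = cayley_feedback[OF D invD Cl Br v(1,3) b w']
    have wz: "w \<in> carrier_vec n" "z \<in> carrier_vec m" unfolding w z using NA ND by (auto intro!: carrier_vecI)
    show g1: "(\<alpha> + \<beta>) \<cdot>\<^sub>v a = transpose_mat Cr *\<^sub>v (\<beta> \<cdot>\<^sub>v z + \<alpha> \<cdot>\<^sub>v y)" by (rule e1(1))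
    show g2: "(\<alpha> + \<beta>) \<cdot>\<^sub>v b = transpose_mat Br *\<^sub>v (\<alpha> \<cdot>\<^sub>v w + \<beta> \<cdot>\<^sub>v x)" using e2(1) by (simp add: add.commute)
    have "(\<alpha> + \<beta>) \<cdot>\<^sub>v (Cl *\<^sub>v a) = Cl *\<^sub>v ((\<alpha> + \<beta>) \<cdot>\<^sub>v a)" using Cl v by (simp add: mat_vec_simps)
    also have "\<dots> = \<beta> \<cdot>\<^sub>v (C *\<^sub>v z) + \<alpha> \<cdot>\<^sub>v (C *\<^sub>v y)" unfolding g1 C using Cl Cr wz v by (simp add: mat_vec_simps)
    finally have "shift_mat \<alpha> D *\<^sub>v w = shift_mat (- \<beta>) D *\<^sub>v x + (\<beta> \<cdot>\<^sub>v (C *\<^sub>v z) + \<alpha> \<cdot>\<^sub>v (C *\<^sub>v y))"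
      using e2(2) by (simp add: add.commute)
    from vec_shift[OF this, of n]
    have r1: "shift_mat \<alpha> D *\<^sub>v w - \<beta> \<cdot>\<^sub>v (C *\<^sub>v z) = shift_mat (- \<beta>) D *\<^sub>v x + \<alpha> \<cdot>\<^sub>v (C *\<^sub>v y)"
      using Cc mat_vec_carrier[OF shift_mat_carrier[OF D]] by auto
    have "(\<alpha> + \<beta>) \<cdot>\<^sub>v (Bl *\<^sub>v b) = Bl *\<^sub>v ((\<alpha> + \<beta>) \<cdot>\<^sub>v b)" using Bl v by (simp add: mat_vec_simps)
    also have "\<dots> = \<alpha> \<cdot>\<^sub>v (B *\<^sub>v w) + \<beta> \<cdot>\<^sub>v (B *\<^sub>v x)" unfolding g2 B using Bl Br wz v by (simp add: mat_vec_simps)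
    finally have "shift_mat \<beta> A *\<^sub>v z = shift_mat (- \<alpha>) A *\<^sub>v y + (\<alpha> \<cdot>\<^sub>v (B *\<^sub>v w) + \<beta> \<cdot>\<^sub>v (B *\<^sub>v x))"
      using e1(2) by simp
    from vec_shift[OF this, of m]
    have r2: "shift_mat \<beta> A *\<^sub>v z - \<alpha> \<cdot>\<^sub>v (B *\<^sub>v w) = shift_mat (- \<alpha>) A *\<^sub>v y + \<beta> \<cdot>\<^sub>v (B *\<^sub>v x)"
      using Bc mat_vec_carrier[OF shift_mat_carrier[OF A]] by auto
    have ec: "E *\<^sub>v x + G *\<^sub>v y \<in> carrier_vec n" "H *\<^sub>v x + F *\<^sub>v y \<in> carrier_vec m" using c by auto
    show "w = E *\<^sub>v x + G *\<^sub>v y" "z = H *\<^sub>v x + F *\<^sub>v y"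
      using inj[OF wz(1) ec(1) wz(2) ec(2)] sol[OF v(1,2)] r1 r2 by auto
  qed
  show ?thesis unfolding realizes_def
  proof (intro conjI ballI impI)
    fix x y a b assume v: "x \<in> carrier_vec n" "y \<in> carrier_vec m" "a \<in> carrier_vec q" "b \<in> carrier_vec p"
      and ab: "a = ?Z *\<^sub>v b + transpose_mat ?V *\<^sub>v y" "b = ?Y *\<^sub>v a + transpose_mat ?Q *\<^sub>v x"
    show "?D *\<^sub>v x + (\<alpha> + \<beta>) \<cdot>\<^sub>v (?W *\<^sub>v a) = E *\<^sub>v x + G *\<^sub>v y"
      by (rule eqs(3)[OF v ab refl refl])
    show "?A *\<^sub>v y + (\<alpha> + \<beta>) \<cdot>\<^sub>v (?U *\<^sub>v b) = H *\<^sub>v x + F *\<^sub>v y"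
      by (rule eqs(4)[OF v ab refl refl])
  next
    fix a b assume v: "a \<in> carrier_vec q" "b \<in> carrier_vec p" and ab: "a = ?Z *\<^sub>v b" "b = ?Y *\<^sub>v a"
    have z: "(0\<^sub>v n :: real vec) \<in> carrier_vec n" "(0\<^sub>v m :: real vec) \<in> carrier_vec m" by auto
    have tz: "transpose_mat ?V *\<^sub>v 0\<^sub>v m = 0\<^sub>v q" "transpose_mat ?Q *\<^sub>v 0\<^sub>v n = 0\<^sub>v p"
      "transpose_mat Cr *\<^sub>v 0\<^sub>v m = 0\<^sub>v q" "transpose_mat Br *\<^sub>v 0\<^sub>v n = 0\<^sub>v p"
      using NA ND Cr Br by (simp_all add: mat_vec_simps)
    have cz: "E *\<^sub>v 0\<^sub>v n + G *\<^sub>v 0\<^sub>v m = 0\<^sub>v n" "H *\<^sub>v 0\<^sub>v n + F *\<^sub>v 0\<^sub>v m = 0\<^sub>v m"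
      using c by (simp_all add: mat_vec_simps)
    have ab': "a = ?Z *\<^sub>v b + transpose_mat ?V *\<^sub>v 0\<^sub>v m" "b = ?Y *\<^sub>v a + transpose_mat ?Q *\<^sub>v 0\<^sub>v n"
      unfolding tz using ab v by (metis right_zero_vec)+
    note e = eqs[OF z v ab' refl refl]
    have t: "\<beta> \<cdot>\<^sub>v 0\<^sub>v m + \<alpha> \<cdot>\<^sub>v 0\<^sub>v m = 0\<^sub>v m" "\<alpha> \<cdot>\<^sub>v 0\<^sub>v n + \<beta> \<cdot>\<^sub>v 0\<^sub>v n = 0\<^sub>v n"
      by (auto intro!: eq_vecI)
    show "a = 0\<^sub>v q" by (rule smult_vec_cancel[OF gam v(1)]) (use e(1)[unfolded e(4) cz t tz] in simp)
    show "b = 0\<^sub>v p" by (rule smult_vec_cancel[OF gam v(2)]) (use e(2)[unfolded e(3) cz t tz] in simp)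
  qed
qed

section \<open>Block rows of iterates\<close>

lemma transpose_pow_mat:
  fixes P :: "real mat"
  assumes P: "P \<in> carrier_mat k k"
  shows "transpose_mat P ^\<^sub>m i = transpose_mat (P ^\<^sub>m i)"
proof (induction i)
  case (Suc i)
  have "P ^\<^sub>m Suc i = P * P ^\<^sub>m i" using pow_mat_add[OF P, of 1 i] P by simp
  then show ?case using Suc P by (simp add: transpose_mult[of _ k k _ k] del: pow_mat.simps(2)) simp
qed (use P in simp)

text \<open>For this reason the second half of a block row of length \<open>2 K\<close> is \<open>P\<^sup>K\<close> times the first half.\<close>

lemma iterate_shift:
  fixes P :: "real mat"
  assumes P: "P \<in> carrier_mat r r" and X: "\<And>j. X j \<in> carrier_mat r c" and step: "\<And>j. X (Suc j) = P * X j"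
  shows "X (K + j) = P ^\<^sub>m K * X j"
proof (induction K)
  case (Suc K)
  have "P ^\<^sub>m Suc K = P * P ^\<^sub>m K" using pow_mat_add[OF P, of 1 K] P by simp
  then show ?case using Suc step[of "K + j"] P X[of j] by (simp add: assoc_mult_mat[of _ r r _ r _ c] del: pow_mat.simps(2))
qed (use X P left_mult_one_mat[OF X] in simp)

lemma block_row_carrier [simp]: "block_row r c K X \<in> carrier_mat r (K * c)"
  by (simp add: block_row_def)

lemma dim_block_row [simp]: "dim_row (block_row r c K X) = r" "dim_col (block_row r c K X) = K * c"
  by (simp_all add: block_row_def)

lemma block_row_index:
  assumes "i < r" "j < K * c"
  shows "block_row r c K X $$ (i, j) = X (j div c) $$ (i, j mod c)"
  using assms by (simp add: block_row_def)

lemma block_row_index_add: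
  assumes "i < r" "j < L * c"
  shows "block_row r c (K + L) X $$ (i, K * c + j) = block_row r c L (\<lambda>l. X (K + l)) $$ (i, j)"
proof -
  have "0 < c" using assms(2) by (cases c) auto
  then show ?thesis using assms by (simp add: block_row_index algebra_simps div_mult_self4)
qed

lemma block_row_append_action:
  assumes a: "a \<in> carrier_vec (K * c)" and b: "b \<in> carrier_vec (L * c)"
  shows "block_row r c (K + L) X *\<^sub>v (a @\<^sub>v b) =
    block_row r c K X *\<^sub>v a + block_row r c L (\<lambda>l. X (K + l)) *\<^sub>v b"
proof (rule eq_vecI)
  fix i assume "i < dim_vec (block_row r c K X *\<^sub>v a + block_row r c L (\<lambda>l. X (K + l)) *\<^sub>v b)"
  then have i: "i < r" by simp
  have row: "row (block_row r c (K + L) X) i =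
      row (block_row r c K X) i @\<^sub>v row (block_row r c L (\<lambda>l. X (K + l))) i"
  proof (rule eq_vecI)
    fix j assume "j < dim_vec (row (block_row r c K X) i @\<^sub>v row (block_row r c L (\<lambda>l. X (K + l))) i)"
    then have j: "j < K * c + L * c" by simp
    show "row (block_row r c (K + L) X) i $ j =
      (row (block_row r c K X) i @\<^sub>v row (block_row r c L (\<lambda>l. X (K + l))) i) $ j"
    proof (cases "j < K * c")
      case True
      then show ?thesis using i j by (simp add: block_row_index algebra_simps)
    next
      case False
      then show ?thesis using i j block_row_index_add[OF i, of "j - K * c" L c K X]
        by (simp add: algebra_simps)
    qed
  qed (simp add: algebra_simps)
  show "(block_row r c (K + L) X *\<^sub>v (a @\<^sub>v b)) $ i =
    (block_row r c K X *\<^sub>v a + block_row r c L (\<lambda>l. X (K + l)) *\<^sub>v b) $ i"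
    using i a b by (simp add: row scalar_prod_append[of _ "K * c" _ "L * c"])
qed simp

lemma transpose_block_row_action:
  assumes y: "y \<in> carrier_vec r"
  shows "transpose_mat (block_row r c (K + L) X) *\<^sub>v y =
    (transpose_mat (block_row r c K X) *\<^sub>v y) @\<^sub>v (transpose_mat (block_row r c L (\<lambda>l. X (K + l))) *\<^sub>v y)"
    (is "?l = ?u @\<^sub>v ?w")
proof (rule eq_vecI)
  fix j assume "j < dim_vec (?u @\<^sub>v ?w)"
  then have j: "j < K * c + L * c" by simp
  show "?l $ j = (?u @\<^sub>v ?w) $ j"
  proof (cases "j < K * c")
    case True
    then have "col (block_row r c (K + L) X) j = col (block_row r c K X) j"
      using j by (intro eq_vecI) (auto simp: block_row_index algebra_simps)
    then show ?thesis using True j by (simp add: algebra_simps)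
  next
    case False
    then have "col (block_row r c (K + L) X) j = col (block_row r c L (\<lambda>l. X (K + l))) (j - K * c)"
      using j block_row_index_add[of _ r "j - K * c" L c K X] by (intro eq_vecI) (auto simp: algebra_simps)
    then show ?thesis using False j by (simp add: algebra_simps)
  qed
qed (simp add: algebra_simps)

lemma block_row_mult_left:
  assumes P: "P \<in> carrier_mat r r" and X: "\<And>j. X j \<in> carrier_mat r c"
  shows "block_row r c K (\<lambda>j. P * X j) = P * block_row r c K X"
proof (rule eq_matI)
  fix i j assume "i < dim_row (P * block_row r c K X)" "j < dim_col (P * block_row r c K X)"
  then have i: "i < r" and j: "j < K * c" using P by auto
  then have "0 < c" by (cases c) auto
  then have m: "j mod c < c" by simp
  have "col (block_row r c K X) j = col (X (j div c)) (j mod c)"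
    using j m X[of "j div c"] by (intro eq_vecI) (auto simp: block_row_index)
  then show "block_row r c K (\<lambda>j. P * X j) $$ (i, j) = (P * block_row r c K X) $$ (i, j)"
    using i j m P X[of "j div c"] by (simp add: block_row_index)
qed (use P in auto)

lemma block_row_single: "X 0 \<in> carrier_mat r c \<Longrightarrow> block_row r c 1 X = X 0"
  by (intro eq_matI) (auto simp: block_row_index)

lemma block_row_iterate_action:
  fixes P :: "real mat"
  assumes P: "P \<in> carrier_mat r r" and X: "\<And>j. X j \<in> carrier_mat r c" and step: "\<And>j. X (Suc j) = P * X j"
    and a: "a \<in> carrier_vec (K * c)" and b: "b \<in> carrier_vec (K * c)"
  shows "block_row r c (K + K) X *\<^sub>v (a @\<^sub>v b) =
    block_row r c K X *\<^sub>v a + P ^\<^sub>m K *\<^sub>v (block_row r c K X *\<^sub>v b)"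
  unfolding block_row_append_action[OF a b] iterate_shift[of P r X c, OF P X step]
    block_row_mult_left[of _ r X c, OF pow_carrier_mat[OF P] X]
  using P b by (simp add: mat_vec_simps)

lemma transpose_block_row_iterate_action:
  fixes P :: "real mat"
  assumes P: "P \<in> carrier_mat r r" and X: "\<And>j. X j \<in> carrier_mat r c"
    and step: "\<And>j. X (Suc j) = transpose_mat P * X j" and y: "y \<in> carrier_vec r"
  shows "transpose_mat (block_row r c (K + K) X) *\<^sub>v y =
    (transpose_mat (block_row r c K X) *\<^sub>v y) @\<^sub>v (transpose_mat (block_row r c K X) *\<^sub>v (P ^\<^sub>m K *\<^sub>v y))"
proof -
  have Pt: "transpose_mat P \<in> carrier_mat r r" using P by simp
  have "block_row r c K (\<lambda>l. X (K + l)) = transpose_mat (P ^\<^sub>m K) * block_row r c K X"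
    unfolding iterate_shift[of "transpose_mat P" r X c, OF Pt X step] transpose_pow_mat[OF P]
    by (rule block_row_mult_left) (use P X in auto)
  then show ?thesis unfolding transpose_block_row_action[OF y] using P y
    by (simp add: transpose_mult[of _ r r _ "K * c"] mat_vec_simps)
qed

section \<open>The doubling formulas\<close>

theorem theorem2p1:
  fixes m n p q :: nat
    and A B C D Bl Br Cl Cr :: "real mat"
    and \<alpha> \<beta> \<gamma> :: real
    and Aab Dab :: "real mat"
    and E F G H :: "nat \<Rightarrow> real mat"
    and U V W Q Uc Vc Wc Qc Y Z T S :: "nat \<Rightarrow> real mat"
  assumes dims: "0 < m" "0 < n"
    and A: "A \<in> carrier_mat m m" and B: "B \<in> carrier_mat m n"
    and C: "C \<in> carrier_mat n m" and D: "D \<in> carrier_mat n n"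
    and M_mat: "M_matrix (four_block_mat D (- C) (- B) A)"
    and nonsing_or_irred: "invertible_mat (four_block_mat D (- C) (- B) A) \<or>
      (\<not> invertible_mat (four_block_mat D (- C) (- B) A) \<and>
       irreducible_mat (four_block_mat D (- C) (- B) A))"
    and Bl: "Bl \<in> carrier_mat m p" "0\<^sub>m m p \<le> Bl" "vec_space.rank m Bl = p"
    and Br: "Br \<in> carrier_mat n p" "0\<^sub>m n p \<le> Br" "vec_space.rank n Br = p"
    and Cl: "Cl \<in> carrier_mat n q" "0\<^sub>m n q \<le> Cl" "vec_space.rank n Cl = q"
    and Cr: "Cr \<in> carrier_mat m q" "0\<^sub>m m q \<le> Cr" "vec_space.rank m Cr = q"
    and B_factor: "B = Bl * transpose_mat Br"
    and C_factor: "C = Cl * transpose_mat Cr"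
    and alpha: "0 \<le> \<alpha>" "\<alpha> \<le> Min ((\<lambda>i. inverse (A $$ (i, i))) ` {..<m})"
    and beta: "0 \<le> \<beta>" "\<beta> \<le> Min ((\<lambda>j. inverse (D $$ (j, j))) ` {..<n})"
    and alpha_beta: "0 < max \<alpha> \<beta>"
    and gamma: "\<gamma> = \<alpha> + \<beta>"
    and init: "split_block
        (minv (four_block_mat (shift_mat \<alpha> D) (- (\<beta> \<cdot>\<^sub>m C)) (- (\<alpha> \<cdot>\<^sub>m B)) (shift_mat \<beta> A)) *
         four_block_mat (shift_mat (- \<beta>) D) (\<alpha> \<cdot>\<^sub>m C) (\<beta> \<cdot>\<^sub>m B) (shift_mat (- \<alpha>) A))
        n n = (E 0, G 0, H 0, F 0)"
    and F_Suc: "\<And>k. F (Suc k) = F k * minv (1\<^sub>m m - H k * G k) * F k"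
    and E_Suc: "\<And>k. E (Suc k) = E k * minv (1\<^sub>m n - G k * H k) * E k"
    and H_Suc: "\<And>k. H (Suc k) = H k + F k * minv (1\<^sub>m m - H k * G k) * H k * E k"
    and G_Suc: "\<And>k. G (Suc k) = G k + E k * minv (1\<^sub>m n - G k * H k) * G k * F k"
    and Aab: "Aab = minv (shift_mat \<beta> A) * shift_mat (- \<alpha>) A"
    and Dab: "Dab = minv (shift_mat \<alpha> D) * shift_mat (- \<beta>) D"
    and U_0: "U 0 = minv (shift_mat \<beta> A) * Bl"
    and V_0: "V 0 = transpose_mat (minv (shift_mat \<beta> A)) * Cr"
    and W_0: "W 0 = minv (shift_mat \<alpha> D) * Cl"
    and Q_0: "Q 0 = transpose_mat (minv (shift_mat \<alpha> D)) * Br"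
    and U_Suc: "\<And>j. U (Suc j) = Aab * U j"
    and V_Suc: "\<And>j. V (Suc j) = transpose_mat Aab * V j"
    and W_Suc: "\<And>j. W (Suc j) = Dab * W j"
    and Q_Suc: "\<And>j. Q (Suc j) = transpose_mat Dab * Q j"
    and Uc: "\<And>k. Uc k = block_row m p (2 ^ k) U"
    and Vc: "\<And>k. Vc k = block_row m q (2 ^ k) V"
    and Wc: "\<And>k. Wc k = block_row n q (2 ^ k) W"
    and Qc: "\<And>k. Qc k = block_row n p (2 ^ k) Q"
    and T: "\<And>k. T k = transpose_mat (Qc k) * Wc k"
    and S: "\<And>k. S k = transpose_mat (Vc k) * Uc k"
    and Y_0: "Y 0 = \<alpha> \<cdot>\<^sub>m (transpose_mat Br * minv (shift_mat \<alpha> D) * Cl)"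
    and Z_0: "Z 0 = \<beta> \<cdot>\<^sub>m (transpose_mat Cr * minv (shift_mat \<beta> A) * Bl)"
    and Y_Suc: "\<And>k. Y (Suc k) =
      four_block_mat (0\<^sub>m (2 ^ k * p) (2 ^ k * q)) (Y k) (Y k) (\<gamma> \<cdot>\<^sub>m T k)"
    and Z_Suc: "\<And>k. Z (Suc k) =
      four_block_mat (0\<^sub>m (2 ^ k * q) (2 ^ k * p)) (Z k) (Z k) (\<gamma> \<cdot>\<^sub>m S k)"
  shows "\<forall>k\<ge>1.
    invertible_mat (1\<^sub>m (2 ^ k * p) - Y k * Z k) \<and>
    invertible_mat (1\<^sub>m (2 ^ k * q) - Z k * Y k) \<and>
    F k = Aab ^\<^sub>m (2 ^ k) +
      \<gamma> \<cdot>\<^sub>m (Uc k * minv (1\<^sub>m (2 ^ k * p) - Y k * Z k) * Y k * transpose_mat (Vc k)) \<and>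
    E k = Dab ^\<^sub>m (2 ^ k) +
      \<gamma> \<cdot>\<^sub>m (Wc k * minv (1\<^sub>m (2 ^ k * q) - Z k * Y k) * Z k * transpose_mat (Qc k)) \<and>
    H k = \<gamma> \<cdot>\<^sub>m (Uc k * minv (1\<^sub>m (2 ^ k * p) - Y k * Z k) * transpose_mat (Qc k)) \<and>
    G k = \<gamma> \<cdot>\<^sub>m (Wc k * minv (1\<^sub>m (2 ^ k * q) - Z k * Y k) * transpose_mat (Vc k))"
proof -
  let ?W = "four_block_mat D (- C) (- B) A"
  let ?N\<^sub>A = "minv (shift_mat \<beta> A)" and ?N\<^sub>D = "minv (shift_mat \<alpha> D)"
  let ?P = "four_block_mat (shift_mat \<alpha> D) (- (\<beta> \<cdot>\<^sub>m C)) (- (\<alpha> \<cdot>\<^sub>m B)) (shift_mat \<beta> A)"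
  let ?R = "four_block_mat (shift_mat (- \<beta>) D) (\<alpha> \<cdot>\<^sub>m C) (\<beta> \<cdot>\<^sub>m B) (shift_mat (- \<alpha>) A)"
  have W: "?W \<in> carrier_mat (n + m) (n + m)" using A D by simp
  have Cm: "- C \<in> carrier_mat n m" and Bm: "- B \<in> carrier_mat m n" using B C by auto
  have nm: "0 < n + m" using dims by simp
  have ab: "0 \<le> \<alpha>" "0 \<le> \<beta>" "0 < \<alpha> + \<beta>" using alpha(1) beta(1) alpha_beta by auto
  obtain v where v: "v \<in> carrier_vec (n + m)" "pos_vec v" "0\<^sub>v (n + m) \<le> ?W *\<^sub>v v"
    "pos_vec (?W *\<^sub>v v) \<or> irreducible_mat ?W"
    using M_matrix_certificate[OF M_mat W nm nonsing_or_irred] by blast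
  obtain a b where a: "a \<in> carrier_vec n" and b: "b \<in> carrier_vec m" and vab: "v = a @\<^sub>v b"
    using split_vec[OF v(1)] by blast
  note v = v[unfolded vab]
  have a_pos: "pos_vec a" unfolding pos_vec_def
  proof (intro allI impI)
    fix i assume "i < dim_vec a"
    then show "0 < a $ i" using v(2) a b unfolding pos_vec_def by (auto dest: spec[of _ i])
  qed
  have b_pos: "pos_vec b" unfolding pos_vec_def
  proof (intro allI impI)
    fix i assume "i < dim_vec b"
    then show "0 < b $ i" using v(2) a b unfolding pos_vec_def by (auto dest: spec[of _ "n + i"])
  qed
  have a_nn: "0\<^sub>v n \<le> a" and b_nn: "0\<^sub>v m \<le> b"
    using a b a_pos b_pos by (auto simp: pos_vec_def nonneg_vec_iff less_imp_le)
  note Z = M_matrix_Z_matrix[OF M_mat W]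
  note blocks = Z_matrix_principal_blocks[OF Z D Cm Bm A a a_nn b b_nn v(3)]
  have inv_A: "invertible_mat (shift_mat \<beta> A)"
    unfolding shift_mat_col_scaled[OF A]
    by (rule monotone_mat_invertible[OF col_scaled_carrier
          col_scaled_monotone[OF blocks(2) b b_pos blocks(4)]]) (use ab in simp)
  have inv_D: "invertible_mat (shift_mat \<alpha> D)"
    unfolding shift_mat_col_scaled[OF D]
    by (rule monotone_mat_invertible[OF col_scaled_carrier
          col_scaled_monotone[OF blocks(1) a a_pos blocks(3)]]) (use ab in simp)
  have Pc: "?P \<in> carrier_mat (n + m) (n + m)" and Rc: "?R \<in> carrier_mat (n + m) (n + m)"
    unfolding initial_matrices_col_scaled[OF A B C D] by simp_all
  have inv_P: "invertible_mat ?P"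
    unfolding initial_matrices_col_scaled[OF A B C D]
    by (rule monotone_mat_invertible[OF col_scaled_carrier col_scaled_monotone[OF Z v(1) v(2,3)]])
      (use ab in auto)
  note Pinv = minv_inverse[OF Pc inv_P]
  have dimM: "dim_row (minv ?P * ?R) = n + m" "dim_col (minv ?P * ?R) = n + m" using Pinv Rc by auto
  note sb = split_block[OF init dimM]
  have PM: "?P * four_block_mat (E 0) (G 0) (H 0) (F 0) = ?R"
    unfolding sb(5)[symmetric] assoc_mult_mat[OF Pc Pinv(1) Rc, symmetric] Pinv(2)
    by (rule left_mult_one_mat[OF Rc])
  have Sc: "shift_mat \<alpha> D \<in> carrier_mat n n" "- (\<beta> \<cdot>\<^sub>m C) \<in> carrier_mat n m"
      "- (\<alpha> \<cdot>\<^sub>m B) \<in> carrier_mat m n" "shift_mat \<beta> A \<in> carrier_mat m m"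
      "shift_mat (- \<beta>) D \<in> carrier_mat n n" "\<alpha> \<cdot>\<^sub>m C \<in> carrier_mat n m"
      "\<beta> \<cdot>\<^sub>m B \<in> carrier_mat m n" "shift_mat (- \<alpha>) A \<in> carrier_mat m m"
    using A B C D by auto
  have P_act: "?P *\<^sub>v (x @\<^sub>v y) = (shift_mat \<alpha> D *\<^sub>v x - \<beta> \<cdot>\<^sub>v (C *\<^sub>v y)) @\<^sub>v (shift_mat \<beta> A *\<^sub>v y - \<alpha> \<cdot>\<^sub>v (B *\<^sub>v x))"
    if "x \<in> carrier_vec n" "y \<in> carrier_vec m" for x y
  proof -
    have "shift_mat \<alpha> D *\<^sub>v x + - (\<beta> \<cdot>\<^sub>m C) *\<^sub>v y = shift_mat \<alpha> D *\<^sub>v x - \<beta> \<cdot>\<^sub>v (C *\<^sub>v y)"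
      using that C D by (intro eq_vecI) (simp_all add: mat_vec_simps del: index_mult_mat_vec)
    moreover have "- (\<alpha> \<cdot>\<^sub>m B) *\<^sub>v x + shift_mat \<beta> A *\<^sub>v y = shift_mat \<beta> A *\<^sub>v y - \<alpha> \<cdot>\<^sub>v (B *\<^sub>v x)"
      using that A B by (intro eq_vecI) (simp_all add: mat_vec_simps del: index_mult_mat_vec)
    ultimately show ?thesis using four_block_mat_mult_vec[OF Sc(1-4) that] by simp
  qed
  have inj: "x = x' \<and> y = y'"
    if c: "x \<in> carrier_vec n" "x' \<in> carrier_vec n" "y \<in> carrier_vec m" "y' \<in> carrier_vec m"
      and e: "shift_mat \<alpha> D *\<^sub>v x - \<beta> \<cdot>\<^sub>v (C *\<^sub>v y) = shift_mat \<alpha> D *\<^sub>v x' - \<beta> \<cdot>\<^sub>v (C *\<^sub>v y')"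
        "shift_mat \<beta> A *\<^sub>v y - \<alpha> \<cdot>\<^sub>v (B *\<^sub>v x) = shift_mat \<beta> A *\<^sub>v y' - \<alpha> \<cdot>\<^sub>v (B *\<^sub>v x')" for x x' y y'
  proof -
    have "?P *\<^sub>v (x @\<^sub>v y) = ?P *\<^sub>v (x' @\<^sub>v y')" using P_act c e by simp
    then have "x @\<^sub>v y = x' @\<^sub>v y'"
      using minv_cancel(1)[OF Pc inv_P append_carrier_vec[OF c(1,3)]]
        minv_cancel(1)[OF Pc inv_P append_carrier_vec[OF c(2,4)]] by metis
    then show ?thesis using append_vec_eq[OF c(1,2)] by simp
  qed
  \<comment> \<open>the two block rows of \<open>P M\<^sub>0 = R\<close>, applied to a vector\<close>
  have sol: "shift_mat \<alpha> D *\<^sub>v (E 0 *\<^sub>v x + G 0 *\<^sub>v y) - \<beta> \<cdot>\<^sub>v (C *\<^sub>v (H 0 *\<^sub>v x + F 0 *\<^sub>v y)) =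
        shift_mat (- \<beta>) D *\<^sub>v x + \<alpha> \<cdot>\<^sub>v (C *\<^sub>v y) \<and>
      shift_mat \<beta> A *\<^sub>v (H 0 *\<^sub>v x + F 0 *\<^sub>v y) - \<alpha> \<cdot>\<^sub>v (B *\<^sub>v (E 0 *\<^sub>v x + G 0 *\<^sub>v y)) =
        shift_mat (- \<alpha>) A *\<^sub>v y + \<beta> \<cdot>\<^sub>v (B *\<^sub>v x)"
    if c: "x \<in> carrier_vec n" "y \<in> carrier_vec m" for x y
  proof -
    have o: "E 0 *\<^sub>v x + G 0 *\<^sub>v y \<in> carrier_vec n" "H 0 *\<^sub>v x + F 0 *\<^sub>v y \<in> carrier_vec m"
      using sb by auto
    have "?P *\<^sub>v (four_block_mat (E 0) (G 0) (H 0) (F 0) *\<^sub>v (x @\<^sub>v y)) = ?R *\<^sub>v (x @\<^sub>v y)"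
      unfolding PM[symmetric]
      by (rule assoc_mult_mat_vec[OF Pc four_block_carrier_mat[OF sb(1,4)] append_carrier_vec[OF c], symmetric])
    then have "(shift_mat \<alpha> D *\<^sub>v (E 0 *\<^sub>v x + G 0 *\<^sub>v y) - \<beta> \<cdot>\<^sub>v (C *\<^sub>v (H 0 *\<^sub>v x + F 0 *\<^sub>v y))) @\<^sub>v
      (shift_mat \<beta> A *\<^sub>v (H 0 *\<^sub>v x + F 0 *\<^sub>v y) - \<alpha> \<cdot>\<^sub>v (B *\<^sub>v (E 0 *\<^sub>v x + G 0 *\<^sub>v y))) =
      (shift_mat (- \<beta>) D *\<^sub>v x + (\<alpha> \<cdot>\<^sub>m C) *\<^sub>v y) @\<^sub>v ((\<beta> \<cdot>\<^sub>m B) *\<^sub>v x + shift_mat (- \<alpha>) A *\<^sub>v y)"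
      unfolding four_block_mat_mult_vec[OF sb(1-4) c] P_act[OF o] four_block_mat_mult_vec[OF Sc(5-8) c] .
    moreover have "shift_mat \<alpha> D *\<^sub>v (E 0 *\<^sub>v x + G 0 *\<^sub>v y) - \<beta> \<cdot>\<^sub>v (C *\<^sub>v (H 0 *\<^sub>v x + F 0 *\<^sub>v y)) \<in> carrier_vec n"
      "shift_mat (- \<beta>) D *\<^sub>v x + (\<alpha> \<cdot>\<^sub>m C) *\<^sub>v y \<in> carrier_vec n"
      using C D by (auto intro!: carrier_vecI)
    moreover have "(\<beta> \<cdot>\<^sub>m B) *\<^sub>v x + shift_mat (- \<alpha>) A *\<^sub>v y = shift_mat (- \<alpha>) A *\<^sub>v y + \<beta> \<cdot>\<^sub>v (B *\<^sub>v x)"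
      using A B c by (intro eq_vecI) (simp_all add: mat_vec_simps del: index_mult_mat_vec)
    moreover have "(\<alpha> \<cdot>\<^sub>m C) *\<^sub>v y = \<alpha> \<cdot>\<^sub>v (C *\<^sub>v y)" using C c by (simp add: mat_vec_simps)
    ultimately show ?thesis by (simp add: append_vec_eq[of _ n])
  qed
  have N: "?N\<^sub>A \<in> carrier_mat m m" "?N\<^sub>D \<in> carrier_mat n n"
    using minv_inverse(1)[OF Sc(4) inv_A] minv_inverse(1)[OF Sc(1) inv_D] by auto
  have AD: "Aab \<in> carrier_mat m m" "Dab \<in> carrier_mat n n"
    unfolding Aab Dab using N Sc by auto
  have Uj: "U j \<in> carrier_mat m p" for j
    by (induction j) (use U_0 U_Suc N Bl(1) AD in auto)
  have Vj: "V j \<in> carrier_mat m q" for j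
    by (induction j) (use V_0 V_Suc N Cr(1) AD in auto)
  have Wj: "W j \<in> carrier_mat n q" for j
    by (induction j) (use W_0 W_Suc N Cl(1) AD in auto)
  have Qj: "Q j \<in> carrier_mat n p" for j
    by (induction j) (use Q_0 Q_Suc N Br(1) AD in auto)
  have K: "Uc k \<in> carrier_mat m (2 ^ k * p)" "Vc k \<in> carrier_mat m (2 ^ k * q)"
    "Wc k \<in> carrier_mat n (2 ^ k * q)" "Qc k \<in> carrier_mat n (2 ^ k * p)" for k
    by (simp_all add: Uc Vc Wc Qc)
  have dbl: "(2::nat) ^ Suc k = 2 ^ k + 2 ^ k" "((2::nat) ^ k + 2 ^ k) * r = 2 ^ k * r + 2 ^ k * r"
    for k r :: nat by (simp_all add: add_mult_distrib)
  have YZ: "Y k \<in> carrier_mat (2 ^ k * p) (2 ^ k * q)" "Z k \<in> carrier_mat (2 ^ k * q) (2 ^ k * p)" for k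
  proof (induction k)
    case 0
    show "Y 0 \<in> carrier_mat (2 ^ 0 * p) (2 ^ 0 * q)" "Z 0 \<in> carrier_mat (2 ^ 0 * q) (2 ^ 0 * p)"
      unfolding Y_0 Z_0 using N Bl Br Cl Cr by auto
  next
    case (Suc k)
    have TS: "\<gamma> \<cdot>\<^sub>m T k \<in> carrier_mat (2 ^ k * p) (2 ^ k * q)" "\<gamma> \<cdot>\<^sub>m S k \<in> carrier_mat (2 ^ k * q) (2 ^ k * p)"
      unfolding S T using K[of k] by auto
    show "Y (Suc k) \<in> carrier_mat (2 ^ Suc k * p) (2 ^ Suc k * q)"
      unfolding Y_Suc dbl by (rule four_block_carrier_mat[OF zero_carrier_mat TS(1)])
    show "Z (Suc k) \<in> carrier_mat (2 ^ Suc k * q) (2 ^ Suc k * p)"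
      unfolding Z_Suc dbl by (rule four_block_carrier_mat[OF zero_carrier_mat TS(2)])
  qed
  have diag: "(if i < n then \<beta> else \<alpha>) * ?W $$ (i, i) \<le> 1" if "i < n + m" for i
    using le_Min_inverse[OF beta, of i] le_Min_inverse[OF alpha, of "i - n"] that A D by auto
  \<comment> \<open>The realization carries the formulas; dissipativity supplies the inverse needed for the next step.\<close>
  have inv: "E k \<in> carrier_mat n n \<and> G k \<in> carrier_mat n m \<and> H k \<in> carrier_mat m n \<and> F k \<in> carrier_mat m m \<and>
      dissipative a b (E k) (G k) (H k) (F k) \<and>
      realizes n m (2 ^ k * p) (2 ^ k * q) \<gamma> (Aab ^\<^sub>m (2 ^ k)) (Dab ^\<^sub>m (2 ^ k))
        (Uc k) (Vc k) (Wc k) (Qc k) (Y k) (Z k) (E k) (G k) (H k) (F k)" for k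
  proof (induction k)
    case 0
    have "dissipative a b (E 0) (G 0) (H 0) (F 0)"
      by (rule initial_dissipative[OF Z a b v(2-4) dims(1) ab diag sb(1-4)
          PM[unfolded initial_matrices_col_scaled[OF A B C D]]])
    moreover have "realizes n m p q \<gamma> Aab Dab (U 0) (V 0) (W 0) (Q 0) (Y 0) (Z 0) (E 0) (G 0) (H 0) (F 0)"
      unfolding gamma Aab Dab U_0 V_0 W_0 Q_0 Y_0 Z_0
      by (rule realizes_initial[OF A D Bl(1) Br(1) Cl(1) Cr(1) B_factor C_factor _ inv_A inv_D inj sb(1-4) sol])
        (use ab in auto)
    moreover have "Uc 0 = U 0" "Vc 0 = V 0" "Wc 0 = W 0" "Qc 0 = Q 0"
      using block_row_single[of U, OF Uj] block_row_single[of V, OF Vj]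
        block_row_single[of W, OF Wj] block_row_single[of Q, OF Qj] by (simp_all add: Uc Vc Wc Qc)
    moreover have "Aab ^\<^sub>m (2 ^ 0) = Aab" "Dab ^\<^sub>m (2 ^ 0) = Dab" using AD by simp_all
    ultimately show ?case using sb(1-4) by simp
  next
    case (Suc k)
    then have c: "E k \<in> carrier_mat n n" "G k \<in> carrier_mat n m" "H k \<in> carrier_mat m n" "F k \<in> carrier_mat m m"
      and dis: "dissipative a b (E k) (G k) (H k) (F k)"
      and rea: "realizes n m (2 ^ k * p) (2 ^ k * q) \<gamma> (Aab ^\<^sub>m (2 ^ k)) (Dab ^\<^sub>m (2 ^ k))
        (Uc k) (Vc k) (Wc k) (Qc k) (Y k) (Z k) (E k) (G k) (H k) (F k)" by auto
    note inv = monotone_mat_invertible[OF one_minus_prod_carrier[OF c(2,3)] dissipative_monotone[OF dis c a b a_pos b_pos]]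
    have "dissipative a b (E (Suc k)) (G (Suc k)) (H (Suc k)) (F (Suc k))"
      unfolding E_Suc G_Suc H_Suc F_Suc by (rule dissipative_doubling[OF dis c a b a_pos b_pos])
    moreover have "realizes n m (2 ^ Suc k * p) (2 ^ Suc k * q) \<gamma> (Aab ^\<^sub>m (2 ^ Suc k)) (Dab ^\<^sub>m (2 ^ Suc k))
        (Uc (Suc k)) (Vc (Suc k)) (Wc (Suc k)) (Qc (Suc k)) (Y (Suc k)) (Z (Suc k))
        (E (Suc k)) (G (Suc k)) (H (Suc k)) (F (Suc k))"
      unfolding E_Suc G_Suc H_Suc F_Suc Y_Suc Z_Suc T S dbl pow_mat_add[OF AD(1)] pow_mat_add[OF AD(2)]
    proof (rule realizes_doubling[OF rea c inv pow_carrier_mat[OF AD(1)] pow_carrier_mat[OF AD(2)] K YZ])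
      show "Uc (Suc k) *\<^sub>v (b1 @\<^sub>v b2) = Uc k *\<^sub>v b1 + Aab ^\<^sub>m 2 ^ k *\<^sub>v (Uc k *\<^sub>v b2)"
        if "b1 \<in> carrier_vec (2 ^ k * p)" "b2 \<in> carrier_vec (2 ^ k * p)" for b1 b2
        unfolding Uc dbl by (rule block_row_iterate_action[where X = U and K = "2 ^ k", OF AD(1) Uj U_Suc that])
      show "Wc (Suc k) *\<^sub>v (a1 @\<^sub>v a2) = Wc k *\<^sub>v a1 + Dab ^\<^sub>m 2 ^ k *\<^sub>v (Wc k *\<^sub>v a2)"
        if "a1 \<in> carrier_vec (2 ^ k * q)" "a2 \<in> carrier_vec (2 ^ k * q)" for a1 a2
        unfolding Wc dbl by (rule block_row_iterate_action[where X = W and K = "2 ^ k", OF AD(2) Wj W_Suc that])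
      show "transpose_mat (Vc (Suc k)) *\<^sub>v y =
          (transpose_mat (Vc k) *\<^sub>v y) @\<^sub>v (transpose_mat (Vc k) *\<^sub>v (Aab ^\<^sub>m 2 ^ k *\<^sub>v y))"
        if "y \<in> carrier_vec m" for y
        unfolding Vc dbl by (rule transpose_block_row_iterate_action[where X = V and K = "2 ^ k", OF AD(1) Vj V_Suc that])
      show "transpose_mat (Qc (Suc k)) *\<^sub>v x =
          (transpose_mat (Qc k) *\<^sub>v x) @\<^sub>v (transpose_mat (Qc k) *\<^sub>v (Dab ^\<^sub>m 2 ^ k *\<^sub>v x))"
        if "x \<in> carrier_vec n" for x
        unfolding Qc dbl by (rule transpose_block_row_iterate_action[where X = Q and K = "2 ^ k", OF AD(2) Qj Q_Suc that])
    qed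
    moreover have "E (Suc k) \<in> carrier_mat n n" "G (Suc k) \<in> carrier_mat n m"
      "H (Suc k) \<in> carrier_mat m n" "F (Suc k) \<in> carrier_mat m m"
      unfolding E_Suc G_Suc H_Suc F_Suc using c by auto
    ultimately show ?case by blast
  qed
  show ?thesis
  proof (intro allI impI)
    fix k :: nat
    have c: "E k \<in> carrier_mat n n" "G k \<in> carrier_mat n m" "H k \<in> carrier_mat m n" "F k \<in> carrier_mat m m"
      and rea: "realizes n m (2 ^ k * p) (2 ^ k * q) \<gamma> (Aab ^\<^sub>m (2 ^ k)) (Dab ^\<^sub>m (2 ^ k))
        (Uc k) (Vc k) (Wc k) (Qc k) (Y k) (Z k) (E k) (G k) (H k) (F k)" using inv[of k] by auto
    note half1 = realizes_formulas_half[OF rea c(1,2) pow_carrier_mat[OF AD(2)] K(2-4) YZ]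
    note half2 = realizes_formulas_half[OF realizes_swap[OF c rea] c(4,3) pow_carrier_mat[OF AD(1)] K(4,1,2) YZ(2,1)]
    show "invertible_mat (1\<^sub>m (2 ^ k * p) - Y k * Z k) \<and>
      invertible_mat (1\<^sub>m (2 ^ k * q) - Z k * Y k) \<and>
      F k = Aab ^\<^sub>m (2 ^ k) +
        \<gamma> \<cdot>\<^sub>m (Uc k * minv (1\<^sub>m (2 ^ k * p) - Y k * Z k) * Y k * transpose_mat (Vc k)) \<and>
      E k = Dab ^\<^sub>m (2 ^ k) +
        \<gamma> \<cdot>\<^sub>m (Wc k * minv (1\<^sub>m (2 ^ k * q) - Z k * Y k) * Z k * transpose_mat (Qc k)) \<and>
      H k = \<gamma> \<cdot>\<^sub>m (Uc k * minv (1\<^sub>m (2 ^ k * p) - Y k * Z k) * transpose_mat (Qc k)) \<and>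
      G k = \<gamma> \<cdot>\<^sub>m (Wc k * minv (1\<^sub>m (2 ^ k * q) - Z k * Y k) * transpose_mat (Vc k))"
      using half1 half2 by blast
  qed
qed

end
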